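(* Let $m$ be a positive integer, and let $q_1,q_2,\ldots,q_s$ ($s\ge 1$) be prime powers such that $2m\mid q_i+1$ for every $i=1,\ldots,s$. For $i=1,\ldots,s$, let $G_i$ be an elementary abelian group of order $q_i^4$. Put $u=q_1^2q_2^2\cdots q_s^2$. Then for every $h\in\{0,1,\ldots,m\}$, with $c=h(u-1)/m$, there exists a strongly regular Cayley graph on $G_1\times G_2\times\cdots\times G_s$ with negative Latin square type parameters $$(u^2,\; c(u+1),\; -u+c^2+3c,\; c^2+c).$$
   Context: A strongly regular graph with parameters $(v,k,\lambda,\mu)$ is a simple undirected graph such that (i) it is regular of order $v$ and valency $k$; (ii) any two adjacent vertices have exactly $\lambda$ common neighbours; (iii) any two distinct nonadjacent vertices have exactly $\mu$ common neighbours. Here the edgeless graph (case $h=0$) and the complete graph (case $h=m$) are allowed as degenerate cases; a condition that concerns no pair of vertices is vacuous. For an additively written finite abelian group $G$ and a subset $D\subseteq G$ with $0_G\notin D$ and $-D=D$, the Cayley graph $\mathrm{Cay}(G,D)$ has vertex set $G$, with $x,y$ adjacent if and only if $x-y\in D$. A Cayley graph on $G$ is a graph of this form. *)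

theory Defs
  imports
    "HOL-Algebra.Product_Groups"
    "HOL-Number_Theory.Prime_Powers"
    "Graph_Theory.Pair_Digraph"
begin

definition elementary_abelian :: "('a, 'b) monoid_scheme \<Rightarrow> bool" where
  "elementary_abelian G \<longleftrightarrow>
     comm_group G \<and>
     (\<exists>p::nat. prime p \<and> (\<forall>x\<in>carrier G. x [^]\<^bsub>G\<^esub> p = \<one>\<^bsub>G\<^esub>))"

(* pair_graph is a finite simple undirected graph: each edge is stored as its two
   orientations. The parameters are integers because lambda may be negative in the
   degenerate edgeless case, where the condition on adjacent vertices is vacuous. *)
definition strongly_regular_graph ::
    "'a pair_pre_digraph \<Rightarrow> int \<Rightarrow> int \<Rightarrow> int \<Rightarrow> int \<Rightarrow> bool" where
  "strongly_regular_graph \<Gamma> v k l \<mu> \<longleftrightarrow>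
     pair_graph \<Gamma> \<and>
     int (card (pverts \<Gamma>)) = v \<and>
     (\<forall>x\<in>pverts \<Gamma>. int (out_degree (with_proj \<Gamma>) x) = k) \<and>
     (\<forall>x\<in>pverts \<Gamma>. \<forall>y\<in>pverts \<Gamma>. (x, y) \<in> parcs \<Gamma> \<longrightarrow>
        int (card {z \<in> pverts \<Gamma>. (x, z) \<in> parcs \<Gamma> \<and> (y, z) \<in> parcs \<Gamma>}) = l) \<and>
     (\<forall>x\<in>pverts \<Gamma>. \<forall>y\<in>pverts \<Gamma>. x \<noteq> y \<and> (x, y) \<notin> parcs \<Gamma> \<longrightarrow>
        int (card {z \<in> pverts \<Gamma>. (x, z) \<in> parcs \<Gamma> \<and> (y, z) \<in> parcs \<Gamma>}) = \<mu>)"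

(* HOL-Algebra groups are multiplicative, so the difference x - y of an additively
   written group is x \<otimes> inv y. *)
definition Cay :: "('a, 'b) monoid_scheme \<Rightarrow> 'a set \<Rightarrow> 'a pair_pre_digraph" where
  "Cay G D = \<lparr> pverts = carrier G,
      parcs = {(x, y). x \<in> carrier G \<and> y \<in> carrier G \<and> x \<otimes>\<^bsub>G\<^esub> inv\<^bsub>G\<^esub> y \<in> D} \<rparr>"

definition Cayley_graph_on :: "('a, 'b) monoid_scheme \<Rightarrow> 'a pair_pre_digraph \<Rightarrow> bool" where
  "Cayley_graph_on G \<Gamma> \<longleftrightarrow>
     (\<exists>D. D \<subseteq> carrier G \<and> \<one>\<^bsub>G\<^esub> \<notin> D \<and> (\<lambda>x. inv\<^bsub>G\<^esub> x) ` D = D \<and> \<Gamma> = Cay G D)"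

end

theory Submission
  imports Defs Complex_Main "HOL-Algebra.Algebraic_Closure" "HOL-Algebra.Multiplicative_Group"
    "HOL-Number_Theory.Residues"
begin

text \<open>
Let \<open>G\<close> be the product group. It suffices to find a function \<open>F\<close>, invariant under inversion, from
the nonidentity elements of \<open>G\<close> to the \<open>m\<close>-th roots of unity such that, for \<open>0 < k < m\<close>, the Fourier transform of \<open>F\<^sup>k\<close> is \<open>-u F'\<^sup>k\<close> at the nontrivial characters, for some function \<open>F'\<close> with values
of the same kind, and \<open>0\<close> at the trivial one. Indeed, the set \<open>D\<close> on which \<open>F\<close> takes one of \<open>h\<close> prescribed
values then has the transform \<open>c\<close> or \<open>c - u\<close> at every nontrivial character
(\<open>dual_phases_two_valued_set\<close>), and a symmetric set with two such values gives a strongly regular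
Cayley graph with the required parameters (\<open>convolution_of_two_valued_set\<close>, \<open>Cay_strongly_regular\<close>).

For a single factor, the group of order \<open>q\<^sup>4\<close>, such an \<open>F\<close> comes from a multiplicative character of
the norm form of a quadratic extension. But the property does not pass to direct products: two
transforms with sign \<open>-\<close> multiply to one with sign \<open>+\<close>, and the elements with one trivial component
have to be covered as well. The remedy is to carry a richer structure, called split type below. The
nonidentity elements are cut into two halves \<open>A\<close> and \<open>B\<close>, each of which supports a function of the
above kind, with sign \<open>-\<close>; and each half together with the identity also supports one with sign
\<open>+\<close>. The transforms are supported on two halves of the character group. Split type is preserved by
direct products (\<open>split_type_DirProd\<close>): the nonidentity elements of a product are tiled by products of
supports of opposite signs, and the resulting halves, with the identity added, are tiled by products
of supports of equal signs.

A group of order \<open>q\<^sup>4\<close> is the plane over the field \<open>K\<close> with \<open>q\<^sup>2\<close> elements. Its halves are the vectors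
whose norm \<open>Q v = a\<^sup>2 - g b\<^sup>2\<close> is a square or a nonsquare of \<open>K\<close>, where \<open>g\<close> generates the
multiplicative group. The functions with sign \<open>-\<close> are restrictions of \<open>\<chi> (Q v)\<close>, where \<open>\<chi>\<close> has order
\<open>2 m\<close> (\<open>form_class_neg_phases\<close>). As \<open>2 m\<close> divides \<open>q + 1\<close>, the character \<open>\<chi>\<close> is trivial on the subfield
of order \<open>q\<close>, and so its Gauss sums are pure (\<open>gauss_value\<close>); this determines the transforms
(\<open>form_char_transform\<close>). The functions with sign \<open>+\<close> are constant on punctured lines
(\<open>form_class_pos_phases\<close>): each half is a union of \<open>(q\<^sup>2 + 1) / 2\<close> of them, and this number is
congruent to \<open>1\<close> modulo \<open>m\<close>.

The field is constructed inside an algebraic closure of the prime field (\<open>exists_finite_field\<close>), and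
finite abelian groups of equal order and prime exponent \<open>p\<close> are isomorphic (\<open>exponent_prime_iso\<close>).
\<close>

section \<open>Dual phase functions and split type\<close>

text \<open>A pairing identifies a finite abelian group with its character group: the maps \<open>\<lambda>x. e x y\<close> are
the characters, one for each \<open>y\<close>. With the characters indexed by the group itself, Fourier
transforms live on the same carrier, and products and isomorphic copies inherit a pairing without
any appeal to the structure of the dual group.\<close>

definition pairing :: "('a, 'b) monoid_scheme \<Rightarrow> ('a \<Rightarrow> 'a \<Rightarrow> complex) \<Rightarrow> bool" where
  "pairing G e \<longleftrightarrow> comm_group G \<and> finite (carrier G) \<and>
     (\<forall>x\<in>carrier G. \<forall>x'\<in>carrier G. \<forall>y\<in>carrier G. e (x \<otimes> x') y = e x y * e x' y) \<and>
     (\<forall>x\<in>carrier G. e x \<one> = 1) \<and> (\<forall>y\<in>carrier G. e \<one> y = 1) \<and>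
     (\<forall>x\<in>carrier G - {\<one>}. (\<Sum>y\<in>carrier G. e x y) = 0) \<and>
     (\<forall>y\<in>carrier G - {\<one>}. (\<Sum>x\<in>carrier G. e x y) = 0)"
  for G (structure)

text \<open>A vectorial, partial version of a bent function: \<open>F\<close> takes \<open>m\<close>-th roots of unity as values on \<open>A\<close>,
and all its nontrivial powers have Fourier transforms of constant modulus on one and the same set
\<open>B\<close>, with phases that are powers of a single function \<open>F'\<close>. The condition on inverses makes unions
of level sets of \<open>F\<close> admissible as connection sets of undirected Cayley graphs.\<close>

definition dual_phases ::
    "('a, 'b) monoid_scheme \<Rightarrow> ('a \<Rightarrow> 'a \<Rightarrow> complex) \<Rightarrow> nat \<Rightarrow> complex \<Rightarrow> 'a set \<Rightarrow> 'a set \<Rightarrow> bool" where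
  "dual_phases G e m c A B \<longleftrightarrow> A \<subseteq> carrier G \<and> B \<subseteq> carrier G \<and>
     (\<exists>F F'. (\<forall>x\<in>A. F x ^ m = 1 \<and> inv x \<in> A \<and> F (inv x) = F x) \<and> (\<forall>y\<in>B. F' y ^ m = 1) \<and>
       (\<forall>k\<in>{1..<m}. \<forall>y\<in>carrier G.
          (\<Sum>x\<in>A. F x ^ k * e x y) = (if y \<in> B then c * F' y ^ k else 0)))"
  for G (structure)

lemma dual_phasesI:
  fixes G (structure)
  assumes "A \<subseteq> carrier G" "B \<subseteq> carrier G"
    and "\<And>x. x \<in> A \<Longrightarrow> F x ^ m = 1" "\<And>x. x \<in> A \<Longrightarrow> inv x \<in> A"
    and "\<And>x. x \<in> A \<Longrightarrow> F (inv x) = F x" "\<And>y. y \<in> B \<Longrightarrow> F' y ^ m = 1"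
    and "\<And>k y. \<lbrakk>k \<in> {1..<m}; y \<in> carrier G\<rbrakk> \<Longrightarrow>
       (\<Sum>x\<in>A. F x ^ k * e x y) = (if y \<in> B then c * F' y ^ k else 0)"
  shows "dual_phases G e m c A B"
  unfolding dual_phases_def
  by (rule conjI[OF assms(1) conjI[OF assms(2)]], rule exI[of _ F], rule exI[of _ F']) (simp add: assms)

text \<open>Transforms add, and with both pairs of supports disjoint there is no interference. This is what
turns tilings of a product group into new phase functions.\<close>

lemma dual_phases_Un:
  fixes G (structure)
  assumes "dual_phases G e m c A A'" "dual_phases G e m c B B'"
    and fin: "finite (carrier G)" and dis: "A \<inter> B = {}" "A' \<inter> B' = {}"
  shows "dual_phases G e m c (A \<union> B) (A' \<union> B')"
proof -
  from assms(1) obtain F F' where F: "A \<subseteq> carrier G" "A' \<subseteq> carrier G"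
    "\<forall>x\<in>A. F x ^ m = 1 \<and> inv x \<in> A \<and> F (inv x) = F x" "\<forall>y\<in>A'. F' y ^ m = 1"
    "\<And>k y. \<lbrakk>k \<in> {1..<m}; y \<in> carrier G\<rbrakk> \<Longrightarrow>
       (\<Sum>x\<in>A. F x ^ k * e x y) = (if y \<in> A' then c * F' y ^ k else 0)"
    unfolding dual_phases_def by blast
  from assms(2) obtain H H' where H: "B \<subseteq> carrier G" "B' \<subseteq> carrier G"
    "\<forall>x\<in>B. H x ^ m = 1 \<and> inv x \<in> B \<and> H (inv x) = H x" "\<forall>y\<in>B'. H' y ^ m = 1"
    "\<And>k y. \<lbrakk>k \<in> {1..<m}; y \<in> carrier G\<rbrakk> \<Longrightarrow>
       (\<Sum>x\<in>B. H x ^ k * e x y) = (if y \<in> B' then c * H' y ^ k else 0)"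
    unfolding dual_phases_def by blast
  define J J' where "J = (\<lambda>x. if x \<in> A then F x else H x)"
    and "J' = (\<lambda>x. if x \<in> A' then F' x else H' x)"
  have notA: "x \<notin> A" if "x \<in> B" for x using that dis by blast
  have notA': "x \<notin> A'" if "x \<in> B'" for x using that dis by blast
  have "(\<Sum>x\<in>A \<union> B. J x ^ k * e x y) = (if y \<in> A' \<union> B' then c * J' y ^ k else 0)"
    if "k \<in> {1..<m}" "y \<in> carrier G" for k y
  proof -
    have "finite A" "finite B" using F(1) H(1) fin by (auto intro: finite_subset)
    then have "(\<Sum>x\<in>A \<union> B. J x ^ k * e x y) = (\<Sum>x\<in>A. J x ^ k * e x y) + (\<Sum>x\<in>B. J x ^ k * e x y)"
      using dis by (intro sum.union_disjoint)
    also have "(\<Sum>x\<in>A. J x ^ k * e x y) = (\<Sum>x\<in>A. F x ^ k * e x y)"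
      by (intro sum.cong) (auto simp: J_def)
    also have "(\<Sum>x\<in>B. J x ^ k * e x y) = (\<Sum>x\<in>B. H x ^ k * e x y)"
      by (intro sum.cong) (auto simp: J_def notA)
    finally show ?thesis using F(5)[OF that] H(5)[OF that] notA' by (auto simp: J'_def)
  qed
  moreover have "\<forall>x\<in>A \<union> B. J x ^ m = 1 \<and> inv x \<in> A \<union> B \<and> J (inv x) = J x"
    using F(3) H(3) notA by (auto simp: J_def)
  moreover have "\<forall>y\<in>A' \<union> B'. J' y ^ m = 1"
    using F(4) H(4) by (auto simp: J'_def)
  ultimately show ?thesis
    unfolding dual_phases_def using F(1,2) H(1,2) by (intro conjI exI[of _ J] exI[of _ J']) auto
qed

definition prod_pairing :: "('a \<Rightarrow> 'a \<Rightarrow> complex) \<Rightarrow> ('c \<Rightarrow> 'c \<Rightarrow> complex) \<Rightarrow> 'a \<times> 'c \<Rightarrow> 'a \<times> 'c \<Rightarrow> complex"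
  where "prod_pairing e f = (\<lambda>(x, y) (x', y'). e x x' * f y y')"

lemma sum_prod_split:
  fixes f :: "'a \<Rightarrow> complex"
  shows "(\<Sum>z\<in>A \<times> B. f (fst z) * g (snd z)) = (\<Sum>x\<in>A. f x) * (\<Sum>y\<in>B. g y)"
  by (simp add: sum_product sum.cartesian_product case_prod_beta)

lemma comm_group_DirProd:
  assumes "comm_group G" "comm_group H" shows "comm_group (G \<times>\<times> H)"
proof -
  interpret G: comm_group G by fact
  interpret H: comm_group H by fact
  have "group (G \<times>\<times> H)" by (rule DirProd_group) unfold_locales
  then show ?thesis
    by (rule group.group_comm_groupI) (auto simp: G.m_comm H.m_comm)
qed

lemma pairing_DirProd:
  assumes "pairing G e" "pairing H f"
  shows "pairing (G \<times>\<times> H) (prod_pairing e f)"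
proof -
  have G: "comm_group G" and H: "comm_group H" using assms by (auto simp: pairing_def)
  have oG: "\<one>\<^bsub>G\<^esub> \<in> carrier G" and oH: "\<one>\<^bsub>H\<^esub> \<in> carrier H"
    using G H by (auto simp: comm_group_def group_def intro: monoid.one_closed)
  have s1: "(\<Sum>y\<in>carrier G \<times> carrier H. prod_pairing e f x y) =
      (\<Sum>y\<in>carrier G. e (fst x) y) * (\<Sum>y\<in>carrier H. f (snd x) y)" for x
    unfolding sum_prod_split[symmetric] by (simp add: prod_pairing_def case_prod_beta)
  have s2: "(\<Sum>x\<in>carrier G \<times> carrier H. prod_pairing e f x y) =
      (\<Sum>x\<in>carrier G. e x (fst y)) * (\<Sum>x\<in>carrier H. f x (snd y))" for y
    unfolding sum_prod_split[symmetric] by (simp add: prod_pairing_def case_prod_beta)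
  note pG = assms(1)[unfolded pairing_def] and pH = assms(2)[unfolded pairing_def]
  show ?thesis
    unfolding pairing_def carrier_DirProd s1 s2 one_DirProd
  proof (intro conjI ballI)
    show "comm_group (G \<times>\<times> H)" by (rule comm_group_DirProd[OF G H])
    show "finite (carrier G \<times> carrier H)" using pG pH by simp
    fix x x' y assume "x \<in> carrier G \<times> carrier H" "x' \<in> carrier G \<times> carrier H" "y \<in> carrier G \<times> carrier H"
    then show "prod_pairing e f (x \<otimes>\<^bsub>G \<times>\<times> H\<^esub> x') y = prod_pairing e f x y * prod_pairing e f x' y"
      using pG pH by (cases x; cases x'; cases y) (simp add: prod_pairing_def)
  next
    fix x assume "x \<in> carrier G \<times> carrier H"
    then show "prod_pairing e f x (\<one>\<^bsub>G\<^esub>, \<one>\<^bsub>H\<^esub>) = 1"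
      using pG pH by (cases x) (simp add: prod_pairing_def)
  next
    fix x assume "x \<in> carrier G \<times> carrier H"
    then show "prod_pairing e f (\<one>\<^bsub>G\<^esub>, \<one>\<^bsub>H\<^esub>) x = 1"
      using pG pH by (cases x) (simp add: prod_pairing_def)
  next
    fix x assume "x \<in> carrier G \<times> carrier H - {(\<one>\<^bsub>G\<^esub>, \<one>\<^bsub>H\<^esub>)}"
    then show "(\<Sum>y\<in>carrier G. e (fst x) y) * (\<Sum>y\<in>carrier H. f (snd x) y) = 0"
      using pG pH by (cases x) auto
  next
    fix x assume "x \<in> carrier G \<times> carrier H - {(\<one>\<^bsub>G\<^esub>, \<one>\<^bsub>H\<^esub>)}"
    then show "(\<Sum>y\<in>carrier G. e y (fst x)) * (\<Sum>y\<in>carrier H. f y (snd x)) = 0"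
      using pG pH by (cases x) auto
  qed
qed

text \<open>The Fourier transform of a tensor product is the tensor product of the transforms, so constants
multiply: a product of a positive and a negative phase function is negative, and a product of two
of equal sign is positive.\<close>

lemma dual_phases_Times:
  assumes "dual_phases G e m c A A'" "dual_phases H f m d B B'"
    and gG: "group G" and gH: "group H"
  shows "dual_phases (G \<times>\<times> H) (prod_pairing e f) m (c * d) (A \<times> B) (A' \<times> B')"
proof -
  from assms(1) obtain F F' where F: "A \<subseteq> carrier G" "A' \<subseteq> carrier G"
    "\<forall>x\<in>A. F x ^ m = 1 \<and> inv\<^bsub>G\<^esub> x \<in> A \<and> F (inv\<^bsub>G\<^esub> x) = F x" "\<forall>y\<in>A'. F' y ^ m = 1"
    "\<And>k y. \<lbrakk>k \<in> {1..<m}; y \<in> carrier G\<rbrakk> \<Longrightarrow>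
       (\<Sum>x\<in>A. F x ^ k * e x y) = (if y \<in> A' then c * F' y ^ k else 0)"
    unfolding dual_phases_def by blast
  from assms(2) obtain E E' where E: "B \<subseteq> carrier H" "B' \<subseteq> carrier H"
    "\<forall>x\<in>B. E x ^ m = 1 \<and> inv\<^bsub>H\<^esub> x \<in> B \<and> E (inv\<^bsub>H\<^esub> x) = E x" "\<forall>y\<in>B'. E' y ^ m = 1"
    "\<And>k y. \<lbrakk>k \<in> {1..<m}; y \<in> carrier H\<rbrakk> \<Longrightarrow>
       (\<Sum>x\<in>B. E x ^ k * f x y) = (if y \<in> B' then d * E' y ^ k else 0)"
    unfolding dual_phases_def by blast
  define J J' where "J = (\<lambda>z. F (fst z) * E (snd z))" and "J' = (\<lambda>z. F' (fst z) * E' (snd z))"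
  have "(\<Sum>z\<in>A \<times> B. J z ^ k * prod_pairing e f z w) =
      (if w \<in> A' \<times> B' then c * d * J' w ^ k else 0)"
    if "k \<in> {1..<m}" "w \<in> carrier (G \<times>\<times> H)" for k w
  proof -
    have "(\<Sum>z\<in>A \<times> B. J z ^ k * prod_pairing e f z w) =
        (\<Sum>z\<in>A \<times> B. (F (fst z) ^ k * e (fst z) (fst w)) * (E (snd z) ^ k * f (snd z) (snd w)))"
      by (intro sum.cong) (auto simp: J_def prod_pairing_def case_prod_beta power_mult_distrib)
    also have "\<dots> = (\<Sum>x\<in>A. F x ^ k * e x (fst w)) * (\<Sum>y\<in>B. E y ^ k * f y (snd w))"
      by (rule sum_prod_split)
    finally show ?thesis
      using that F(5)[of k "fst w"] E(5)[of k "snd w"]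
      by (cases w) (auto simp: J'_def power_mult_distrib)
  qed
  moreover have "\<forall>z\<in>A \<times> B. J z ^ m = 1 \<and> inv\<^bsub>G \<times>\<times> H\<^esub> z \<in> A \<times> B \<and> J (inv\<^bsub>G \<times>\<times> H\<^esub> z) = J z"
  proof
    fix z assume z: "z \<in> A \<times> B"
    then obtain x y where xy: "z = (x, y)" "x \<in> A" "y \<in> B" by auto
    have "inv\<^bsub>G \<times>\<times> H\<^esub> z = (inv\<^bsub>G\<^esub> x, inv\<^bsub>H\<^esub> y)"
      unfolding xy using F(1) E(1) xy by (intro inv_DirProd gG gH) auto
    then show "J z ^ m = 1 \<and> inv\<^bsub>G \<times>\<times> H\<^esub> z \<in> A \<times> B \<and> J (inv\<^bsub>G \<times>\<times> H\<^esub> z) = J z"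
      using F(3) E(3) xy by (auto simp: J_def power_mult_distrib)
  qed
  moreover have "\<forall>w\<in>A' \<times> B'. J' w ^ m = 1"
    using F(4) E(4) by (auto simp: J'_def power_mult_distrib)
  ultimately show ?thesis
    unfolding dual_phases_def using F(1,2) E(1,2)
    by (intro conjI exI[of _ J] exI[of _ J']) auto
qed

text \<open>The nonidentity elements are split twice, into \<open>A\<close>, \<open>B\<close> on the side of the group and into \<open>A'\<close>, \<open>B'\<close>
on the side of its characters. Each half carries a negative phase function, with constant \<open>-u\<close>, and,
after the identity is added, also a positive one, with constant \<open>u\<close>. The positive functions
exchange the two dual halves; it is exactly this crossing that makes the property multiplicative.\<close>

definition split_type :: "nat \<Rightarrow> nat \<Rightarrow> ('a, 'b) monoid_scheme \<Rightarrow> bool" where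
  "split_type m u G \<longleftrightarrow> (\<exists>e A B A' B'. pairing G e \<and>
     A \<inter> B = {} \<and> A \<union> B = carrier G - {\<one>} \<and>
     A' \<inter> B' = {} \<and> A' \<union> B' = carrier G - {\<one>} \<and>
     dual_phases G e m (- of_nat u) A A' \<and> dual_phases G e m (- of_nat u) B B' \<and>
     dual_phases G e m (of_nat u) (insert \<one> A) (insert \<one> B') \<and>
     dual_phases G e m (of_nat u) (insert \<one> B) (insert \<one> A'))"
  for G (structure)

lemma split_typeI:
  fixes G (structure)
  assumes "pairing G e"
    "A \<inter> B = {}" "A \<union> B = carrier G - {\<one>}" "A' \<inter> B' = {}" "A' \<union> B' = carrier G - {\<one>}"
    "dual_phases G e m (- of_nat u) A A'" "dual_phases G e m (- of_nat u) B B'"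
    "dual_phases G e m (of_nat u) (insert \<one> A) (insert \<one> B')"
    "dual_phases G e m (of_nat u) (insert \<one> B) (insert \<one> A')"
  shows "split_type m u G"
  unfolding split_type_def
  by (intro exI[of _ e] exI[of _ A] exI[of _ B] exI[of _ A'] exI[of _ B'] conjI assms)

text \<open>With \<open>A\<^sub>0\<close> for \<open>A\<close> together with the identity, the nonidentity elements of the product are tiled by
\<open>A \<times> D\<^sub>0\<close>, \<open>A\<^sub>0 \<times> C\<close>, \<open>B \<times> C\<^sub>0\<close> and \<open>B\<^sub>0 \<times> D\<close>. Every tile is a product of a negative and a positive
support, so it carries a negative phase function. The first two tiles form one new half and the
last two the other; adding the identity to the first half gives \<open>A\<^sub>0 \<times> C\<^sub>0 \<union> A \<times> D\<close>, which is a tiling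
by products of equal sign and hence positive. Because of the crossing of the dual halves, the dual
supports of all these tiles are again disjoint and fit the same pattern.\<close>

lemma split_type_DirProd:
  assumes "split_type m u G" "split_type m v H"
  shows "split_type m (u * v) (G \<times>\<times> H)"
proof -
  from assms(1) obtain e A B A' B' where 1: "pairing G e"
    "A \<inter> B = {}" "A \<union> B = carrier G - {\<one>\<^bsub>G\<^esub>}" "A' \<inter> B' = {}" "A' \<union> B' = carrier G - {\<one>\<^bsub>G\<^esub>}"
    "dual_phases G e m (- of_nat u) A A'" "dual_phases G e m (- of_nat u) B B'"
    "dual_phases G e m (of_nat u) (insert \<one>\<^bsub>G\<^esub> A) (insert \<one>\<^bsub>G\<^esub> B')"
    "dual_phases G e m (of_nat u) (insert \<one>\<^bsub>G\<^esub> B) (insert \<one>\<^bsub>G\<^esub> A')"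
    unfolding split_type_def by (elim exE conjE) (rule that)
  from assms(2) obtain f C D C' D' where 2: "pairing H f"
    "C \<inter> D = {}" "C \<union> D = carrier H - {\<one>\<^bsub>H\<^esub>}" "C' \<inter> D' = {}" "C' \<union> D' = carrier H - {\<one>\<^bsub>H\<^esub>}"
    "dual_phases H f m (- of_nat v) C C'" "dual_phases H f m (- of_nat v) D D'"
    "dual_phases H f m (of_nat v) (insert \<one>\<^bsub>H\<^esub> C) (insert \<one>\<^bsub>H\<^esub> D')"
    "dual_phases H f m (of_nat v) (insert \<one>\<^bsub>H\<^esub> D) (insert \<one>\<^bsub>H\<^esub> C')"
    unfolding split_type_def by (elim exE conjE) (rule that)
  define a b where "a = \<one>\<^bsub>G\<^esub>" and "b = \<one>\<^bsub>H\<^esub>"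
  have gr: "comm_group G" "comm_group H" "group G" "group H" "finite (carrier G)" "finite (carrier H)"
    using 1(1) 2(1) by (auto simp: pairing_def comm_group_def)
  have car: "carrier G = insert a (A \<union> B)" "carrier H = insert b (C \<union> D)"
    and car': "carrier G = insert a (A' \<union> B')" "carrier H = insert b (C' \<union> D')"
    using 1(3,5) 2(3,5) monoid.one_closed[of G] monoid.one_closed[of H] gr
    by (auto simp: a_def b_def group_def)
  have na: "a \<notin> A" "a \<notin> B" "a \<notin> A'" "a \<notin> B'" "b \<notin> C" "b \<notin> D" "b \<notin> C'" "b \<notin> D'"
    using 1(3,5) 2(3,5) by (auto simp: a_def b_def)
  define P where "P = G \<times>\<times> H"
  define g where "g = prod_pairing e f"
  have fin: "finite (carrier P)" using gr by (simp add: P_def)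
  note times = dual_phases_Times[of G e m _ _ _ H f, OF _ _ gr(3,4), folded P_def g_def]
  have neg: "- of_nat u * of_nat v = (- of_nat (u * v) :: complex)"
    "of_nat u * - of_nat v = (- of_nat (u * v) :: complex)"
    "of_nat u * of_nat v = (of_nat (u * v) :: complex)"
    "- of_nat u * - of_nat v = (of_nat (u * v) :: complex)" by simp_all
  note FG = 1(6-9)[folded a_def] and FH = 2(6-9)[folded b_def]
  define S T S' T' where "S = A \<times> insert b D \<union> insert a A \<times> C"
    and "T = B \<times> insert b C \<union> insert a B \<times> D"
    and "S' = A' \<times> insert b C' \<union> insert a B' \<times> C'"
    and "T' = B' \<times> insert b D' \<union> insert a A' \<times> D'"
  have one: "\<one>\<^bsub>P\<^esub> = (a, b)" by (simp add: P_def a_def b_def)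
  have "dual_phases P g m (- of_nat (u * v)) S S'"
    unfolding S_def S'_def
    using 1(2,4) 2(2,4) na
    by (intro dual_phases_Un[OF times[OF FG(1) FH(4), unfolded neg] times[OF FG(3) FH(1), unfolded neg] fin]) auto
  moreover have "dual_phases P g m (- of_nat (u * v)) T T'"
    unfolding T_def T'_def
    using 1(2,4) 2(2,4) na
    by (intro dual_phases_Un[OF times[OF FG(2) FH(3), unfolded neg] times[OF FG(4) FH(2), unfolded neg] fin]) auto
  moreover have "dual_phases P g m (of_nat (u * v)) (insert (a, b) S) (insert (a, b) T')"
  proof -
    have *: "insert (a, b) S = insert a A \<times> insert b C \<union> A \<times> D"
      "insert (a, b) T' = insert a B' \<times> insert b D' \<union> A' \<times> D'"
      unfolding S_def T'_def by auto
    show ?thesis unfolding *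
      using 1(2,4) 2(2,4) na
    by (intro dual_phases_Un[OF times[OF FG(3) FH(3), unfolded neg] times[OF FG(1) FH(2), unfolded neg] fin]) auto
  qed
  moreover have "dual_phases P g m (of_nat (u * v)) (insert (a, b) T) (insert (a, b) S')"
  proof -
    have *: "insert (a, b) T = insert a B \<times> insert b D \<union> B \<times> C"
      "insert (a, b) S' = insert a A' \<times> insert b C' \<union> B' \<times> C'"
      unfolding T_def S'_def by auto
    show ?thesis unfolding *
      using 1(2,4) 2(2,4) na
    by (intro dual_phases_Un[OF times[OF FG(4) FH(4), unfolded neg] times[OF FG(2) FH(1), unfolded neg] fin]) auto
  qed
  moreover have "S \<inter> T = {}" "S' \<inter> T' = {}"
    unfolding S_def T_def S'_def T'_def using 1(2,4) 2(2,4) na by auto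
  moreover have "S \<union> T = carrier P - {(a, b)}"
    unfolding S_def T_def P_def carrier_DirProd car using na by auto
  moreover have "S' \<union> T' = carrier P - {(a, b)}"
    unfolding S'_def T'_def P_def carrier_DirProd car' using na by auto
  moreover have "pairing P g" unfolding P_def g_def by (rule pairing_DirProd[OF 1(1) 2(1)])
  ultimately show ?thesis unfolding P_def[symmetric] by (intro split_typeI[of P g S T S' T'], unfold one)
qed

text \<open>The empty product, which starts the induction over the factors.\<close>

lemma split_type_trivial:
  fixes G (structure)
  assumes "trivial_group G" shows "split_type m 1 G"
proof -
  have g: "group G" and c: "carrier G = {\<one>}" using assms by (auto simp: trivial_group_def)
  then interpret group G by simp
  have "comm_group G" by (rule group_comm_groupI) (simp add: c)
  then have "pairing G (\<lambda>x y. 1)" by (simp add: pairing_def c)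
  moreover have "dual_phases G (\<lambda>x y. 1) m 1 {\<one>} {\<one>}"
    unfolding dual_phases_def
    by (intro conjI exI[of _ "\<lambda>_. 1"]) (auto simp: c)
  moreover have "dual_phases G (\<lambda>x y. 1) m (- 1) {} {}"
    unfolding dual_phases_def by auto
  ultimately show ?thesis 
    by (intro split_typeI[of G "\<lambda>x y. 1" "{}" "{}" "{}" "{}"]) (simp_all add: c)
qed

lemma dual_phases_iso:
  assumes h: "h \<in> iso G H" and g: "group G" "group H" and d: "dual_phases G e m c A A'"
    and f: "\<And>x y. \<lbrakk>x \<in> carrier G; y \<in> carrier G\<rbrakk> \<Longrightarrow> f (h x) (h y) = e x y"
  shows "dual_phases H f m c (h ` A) (h ` A')"
proof -
  from d obtain F F' where F: "A \<subseteq> carrier G" "A' \<subseteq> carrier G"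
    "\<forall>x\<in>A. F x ^ m = 1 \<and> inv\<^bsub>G\<^esub> x \<in> A \<and> F (inv\<^bsub>G\<^esub> x) = F x" "\<forall>y\<in>A'. F' y ^ m = 1"
    "\<And>k y. \<lbrakk>k \<in> {1..<m}; y \<in> carrier G\<rbrakk> \<Longrightarrow>
       (\<Sum>x\<in>A. F x ^ k * e x y) = (if y \<in> A' then c * F' y ^ k else 0)"
    unfolding dual_phases_def by blast
  interpret group_hom G H h
    using g h by (auto simp: group_hom_def group_hom_axioms_def iso_def)
  have bij: "bij_betw h (carrier G) (carrier H)" using h by (simp add: iso_def)
  then have inj: "inj_on h (carrier G)" and im: "h ` carrier G = carrier H"
    by (auto simp: bij_betw_def)
  define i where "i = inv_into (carrier G) h"
  have i: "i (h x) = x" if "x \<in> carrier G" for x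
    using that inj by (simp add: i_def)
  have "(\<Sum>x\<in>h ` A. F (i x) ^ k * f x y) = (if y \<in> h ` A' then c * F' (i y) ^ k else 0)"
    if k: "k \<in> {1..<m}" and y: "y \<in> carrier H" for k y
  proof -
    obtain z where z: "z \<in> carrier G" "y = h z" using y im by auto
    have "(\<Sum>x\<in>h ` A. F (i x) ^ k * f x y) = (\<Sum>x\<in>A. F (i (h x)) ^ k * f (h x) y)"
      using inj F(1) by (subst sum.reindex) (auto intro: inj_on_subset)
    also have "\<dots> = (\<Sum>x\<in>A. F x ^ k * e x z)"
      using F(1) z by (intro sum.cong) (auto simp: i f subsetD)
    also have "\<dots> = (if z \<in> A' then c * F' z ^ k else 0)" by (rule F(5)[OF k z(1)])
    finally show ?thesis
      using z F(2) inj by (auto simp: i inj_on_image_mem_iff)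
  qed
  moreover have "\<forall>x\<in>h ` A. F (i x) ^ m = 1 \<and> inv\<^bsub>H\<^esub> x \<in> h ` A \<and> F (i (inv\<^bsub>H\<^esub> x)) = F (i x)"
  proof
    fix x assume "x \<in> h ` A"
    then obtain z where z: "z \<in> A" "x = h z" "z \<in> carrier G" using F(1) by auto
    have "inv\<^bsub>H\<^esub> x = h (inv\<^bsub>G\<^esub> z)" using z by simp
    moreover have "inv\<^bsub>G\<^esub> z \<in> carrier G" using z by simp
    ultimately show "F (i x) ^ m = 1 \<and> inv\<^bsub>H\<^esub> x \<in> h ` A \<and> F (i (inv\<^bsub>H\<^esub> x)) = F (i x)"
      using F(3) z by (metis i image_eqI)
  qed
  moreover have "\<forall>y\<in>h ` A'. F' (i y) ^ m = 1"
    using F(2,4) by (auto simp: i subsetD)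
  ultimately show ?thesis unfolding dual_phases_def using F(1,2) im
    by (intro conjI exI[of _ "\<lambda>x. F (i x)"] exI[of _ "\<lambda>x. F' (i x)"]) auto
qed

lemma split_type_iso:
  assumes st: "split_type m u G" and i: "G \<cong> H" and gH: "group H"
  shows "split_type m u H"
proof -
  from st obtain e A B A' B' where 1: "pairing G e"
    "A \<inter> B = {}" "A \<union> B = carrier G - {\<one>\<^bsub>G\<^esub>}" "A' \<inter> B' = {}" "A' \<union> B' = carrier G - {\<one>\<^bsub>G\<^esub>}"
    "dual_phases G e m (- of_nat u) A A'" "dual_phases G e m (- of_nat u) B B'"
    "dual_phases G e m (of_nat u) (insert \<one>\<^bsub>G\<^esub> A) (insert \<one>\<^bsub>G\<^esub> B')"
    "dual_phases G e m (of_nat u) (insert \<one>\<^bsub>G\<^esub> B) (insert \<one>\<^bsub>G\<^esub> A')"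
    unfolding split_type_def by (elim exE conjE) (rule that)
  from i obtain h where h: "h \<in> iso G H" by (auto simp: is_iso_def)
  have cG: "comm_group G" using 1(1) by (simp add: pairing_def)
  then have gG: "group G" by (simp add: comm_group_def)
  interpret group_hom G H h
    using gG gH h by (auto simp: group_hom_def group_hom_axioms_def iso_def)
  have inj: "inj_on h (carrier G)" and im: "h ` carrier G = carrier H"
    using h by (auto simp: bij_betw_def iso_def)
  define k where "k = inv_into (carrier G) h"
  have k: "k (h x) = x" if "x \<in> carrier G" for x using that inj by (simp add: k_def)
  define f where "f = (\<lambda>x y. e (k x) (k y))"
  have f: "f (h x) (h y) = e x y" if "x \<in> carrier G" "y \<in> carrier G" for x y
    using that by (simp add: f_def k)
  note d = dual_phases_iso[where e = e and f = f and m = m, OF h gG gH _ f]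
  have sum: "(\<Sum>y\<in>carrier H. t y) = (\<Sum>y\<in>carrier G. t (h y))" for t :: "_ \<Rightarrow> complex"
    unfolding im[symmetric] using inj by (simp add: sum.reindex)
  have sb: "A \<subseteq> carrier G" "B \<subseteq> carrier G" "A' \<subseteq> carrier G" "B' \<subseteq> carrier G"
    using 1(3,5) by blast+
  have car: "carrier H - {\<one>\<^bsub>H\<^esub>} = h ` (carrier G - {\<one>\<^bsub>G\<^esub>})"
    using im inj by (subst inj_on_image_set_diff[of h "carrier G"]) auto
  have "comm_group H"
    using comm_group.iso_imp_comm_group[OF cG i] gH by (simp add: group_def)
  moreover have "finite (carrier H)" using iso_finite[OF i] 1(1) by (simp add: pairing_def)
  moreover have "\<forall>x\<in>carrier H. \<forall>x'\<in>carrier H. \<forall>y\<in>carrier H. f (x \<otimes>\<^bsub>H\<^esub> x') y = f x y * f x' y"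
    unfolding im[symmetric] using 1(1) by (auto simp: f pairing_def hom_mult[symmetric] simp del: hom_mult)
  moreover have "\<forall>x\<in>carrier H. f x \<one>\<^bsub>H\<^esub> = 1" "\<forall>y\<in>carrier H. f \<one>\<^bsub>H\<^esub> y = 1"
    unfolding im[symmetric] using 1(1) by (auto simp: f pairing_def hom_one[symmetric] simp del: hom_one)
  moreover have "\<forall>x\<in>carrier H - {\<one>\<^bsub>H\<^esub>}. (\<Sum>y\<in>carrier H. f x y) = 0"
     "\<forall>y\<in>carrier H - {\<one>\<^bsub>H\<^esub>}. (\<Sum>x\<in>carrier H. f x y) = 0"
    unfolding car sum using 1(1) by (auto simp: f pairing_def)
  ultimately have "pairing H f" unfolding pairing_def by blast
  moreover have "h ` A \<inter> h ` B = {}" "h ` A' \<inter> h ` B' = {}"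
    using inj_on_image_Int[OF inj, of A B] inj_on_image_Int[OF inj, of A' B'] 1(2,4) sb by simp_all
  moreover have "h ` A \<union> h ` B = carrier H - {\<one>\<^bsub>H\<^esub>}" "h ` A' \<union> h ` B' = carrier H - {\<one>\<^bsub>H\<^esub>}"
    unfolding car by (simp_all add: 1(3,5) flip: image_Un)
  moreover note d[OF 1(6)] d[OF 1(7)] d[OF 1(8), unfolded image_insert hom_one]
    d[OF 1(9), unfolded image_insert hom_one]
  ultimately show ?thesis by (intro split_typeI[of H f "h ` A" "h ` B" "h ` A'" "h ` B'"])
qed

lemma product_group_Suc_iso:
  assumes "\<And>i. i \<in> {1..Suc n} \<Longrightarrow> group (G i)"
  shows "product_group {1..n} G \<times>\<times> G (Suc n) \<cong> product_group {1..Suc n} G"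
proof -
  let ?h = "\<lambda>z. \<lambda>i\<in>{1..Suc n}. if i = Suc n then snd z else fst z i"
  have "?h \<in> hom (product_group {1..n} G \<times>\<times> G (Suc n)) (product_group {1..Suc n} G)"
    by (rule homI) (auto simp: PiE_iff fun_eq_iff split: if_splits)
  moreover have "bij_betw ?h (carrier (product_group {1..n} G \<times>\<times> G (Suc n))) (carrier (product_group {1..Suc n} G))"
  proof (rule bij_betw_byWitness[where f' = "\<lambda>x. (restrict x {1..n}, x (Suc n))"])
    show "\<forall>a\<in>carrier (product_group {1..n} G \<times>\<times> G (Suc n)).
       (restrict (?h a) {1..n}, ?h a (Suc n)) = a"
      by (auto simp: PiE_iff fun_eq_iff extensional_def)
    show "\<forall>a'\<in>carrier (product_group {1..Suc n} G). ?h (restrict a' {1..n}, a' (Suc n)) = a'"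
      by (auto simp: PiE_iff fun_eq_iff extensional_def)
    show "?h ` carrier (product_group {1..n} G \<times>\<times> G (Suc n)) \<subseteq> carrier (product_group {1..Suc n} G)"
      by (auto simp: PiE_iff)
    show "(\<lambda>x. (restrict x {1..n}, x (Suc n))) ` carrier (product_group {1..Suc n} G)
      \<subseteq> carrier (product_group {1..n} G \<times>\<times> G (Suc n))"
      by (auto simp: PiE_iff)
  qed
  ultimately show ?thesis unfolding is_iso_def iso_def by blast
qed

lemma split_type_product_group:
  fixes G :: "nat \<Rightarrow> ('a, 'b) monoid_scheme"
  assumes "\<And>i. i \<in> {1..s} \<Longrightarrow> group (G i)" "\<And>i. i \<in> {1..s} \<Longrightarrow> split_type m (w i) (G i)"
  shows "split_type m (\<Prod>i\<in>{1..s}. w i) (product_group {1..s} G)"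
  using assms
proof (induction s)
  case 0
  have "trivial_group (product_group {1..0} G)" by (auto simp: trivial_product_group)
  then show ?case using split_type_trivial by simp
next
  case (Suc n)
  have "split_type m ((\<Prod>i\<in>{1..n}. w i) * w (Suc n)) (product_group {1..n} G \<times>\<times> G (Suc n))"
    using Suc by (intro split_type_DirProd) auto
  then have "split_type m ((\<Prod>i\<in>{1..n}. w i) * w (Suc n)) (product_group {1..Suc n} G)"
    using Suc.prems by (intro split_type_iso[OF _ product_group_Suc_iso product_group]) auto
  then show ?case by simp
qed

section \<open>From split type to strongly regular graphs\<close>

lemma sum_powers_root_of_unity:
  fixes z :: complex
  assumes "z ^ m = 1" shows "(\<Sum>k<m. z ^ k) = (if z = 1 then of_nat m else 0)"
  using assms by (simp add: geometric_sum)

text \<open>Fourier inversion in the weak form that a function is determined by its transform.\<close>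

lemma pairing_inversion:
  fixes G (structure)
  assumes p: "pairing G e" and z: "\<And>y. y \<in> carrier G \<Longrightarrow> (\<Sum>x\<in>carrier G. \<Phi> x * e x y) = 0"
    and g: "g \<in> carrier G"
  shows "\<Phi> g = 0"
proof -
  have cG: "comm_group G" and fin: "finite (carrier G)" using p by (auto simp: pairing_def)
  interpret comm_group G by fact
  have mult: "e (x \<otimes> x') y = e x y * e x' y" if "x \<in> carrier G" "x' \<in> carrier G" "y \<in> carrier G" for x x' y
    using p that by (simp add: pairing_def)
  have orth: "(\<Sum>y\<in>carrier G. e x y) = (if x = \<one> then of_nat (card (carrier G)) else 0)" if "x \<in> carrier G" for x
    using p that by (auto simp: pairing_def)
  have "0 = (\<Sum>y\<in>carrier G. e (inv g) y * (\<Sum>x\<in>carrier G. \<Phi> x * e x y))"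
    by (simp add: z)
  also have "\<dots> = (\<Sum>y\<in>carrier G. \<Sum>x\<in>carrier G. \<Phi> x * e (x \<otimes> inv g) y)"
    using g by (intro sum.cong refl) (simp add: sum_distrib_left mult mult_ac)
  also have "\<dots> = (\<Sum>x\<in>carrier G. \<Phi> x * (\<Sum>y\<in>carrier G. e (x \<otimes> inv g) y))"
    by (subst sum.swap) (simp add: sum_distrib_left)
  also have "\<dots> = (\<Sum>x\<in>carrier G. if x = g then \<Phi> g * of_nat (card (carrier G)) else 0)"
  proof (rule sum.cong[OF refl])
    fix x assume x: "x \<in> carrier G"
    have "x \<otimes> inv g = \<one> \<longleftrightarrow> x = g" using x g by (metis inv_closed inv_equality inv_inv r_inv)
    then show "\<Phi> x * (\<Sum>y\<in>carrier G. e (x \<otimes> inv g) y) = (if x = g then \<Phi> g * of_nat (card (carrier G)) else 0)"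
      using orth[of "x \<otimes> inv g"] x g by auto
  qed
  also have "\<dots> = \<Phi> g * of_nat (card (carrier G))" using fin g by simp
  finally show ?thesis using fin g by (auto simp: card_eq_0_iff)
qed

text \<open>The set consists of the \<open>x\<close> for which \<open>F x\<close> is one of \<open>h\<close> chosen \<open>m\<close>-th roots of unity. Its indicator
is a linear combination of the powers \<open>F\<^sup>k\<close> by orthogonality of roots of unity. The term \<open>k = 0\<close>
contributes the transform of the indicator of the nonidentity elements, and the other terms
reassemble to \<open>-u\<close> times the indicator of the condition that \<open>F' y\<close> is one of the chosen roots.\<close>

lemma dual_phases_two_valued_set:
  fixes G (structure)
  assumes p: "pairing G e" and ph: "dual_phases G e m (- of_nat u) (carrier G - {\<one>}) (carrier G - {\<one>})"
    and card: "card (carrier G) = u ^ 2" and m: "m > 0" and h: "h \<le> m"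
    and c: "int m * c = int h * (int u - 1)"
  obtains D where "D \<subseteq> carrier G - {\<one>}" "\<And>x. x \<in> D \<Longrightarrow> inv x \<in> D"
    "\<And>y. y \<in> carrier G - {\<one>} \<Longrightarrow> (\<Sum>x\<in>D. e x y) = of_int c \<or> (\<Sum>x\<in>D. e x y) = of_int c - of_nat u"
    "int (card D) = c * (int u + 1)"
proof -
  define G0 where "G0 = carrier G - {\<one>}"
  from ph obtain F F' where F:
    "\<forall>x\<in>G0. F x ^ m = 1 \<and> inv x \<in> G0 \<and> F (inv x) = F x" "\<forall>y\<in>G0. F' y ^ m = 1"
    "\<And>k y. \<lbrakk>k \<in> {1..<m}; y \<in> carrier G\<rbrakk> \<Longrightarrow>
       (\<Sum>x\<in>G0. F x ^ k * e x y) = (if y \<in> G0 then - of_nat u * F' y ^ k else 0)"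
    unfolding dual_phases_def G0_def[symmetric] by blast
  have fin: "finite (carrier G)" and gG: "group G" using p by (auto simp: pairing_def comm_group_def)
  then have one: "\<one> \<in> carrier G" and finG0: "finite G0"
    by (auto simp: G0_def group_def monoid.one_closed)
  define \<omega> where "\<omega> = cis (2 * pi / m)"
  have wnz: "\<omega> ^ j \<noteq> 0" for j by (simp add: \<omega>_def)
  have wm: "\<omega> ^ m = 1" using m by (simp add: \<omega>_def DeMoivre)
  have winj: "i = j" if "\<omega> ^ i = \<omega> ^ j" "i < m" "j < m" for i j
  proof -
    have "inj_on (\<lambda>k. cis (2 * pi * real k / real m)) {..<m}"
      using bij_betw_roots_unity[OF m] by (rule bij_betw_imp_inj_on)
    moreover have "\<omega> ^ k = cis (2 * pi * real k / real m)" for k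
      by (simp add: \<omega>_def DeMoivre mult_ac)
    ultimately show ?thesis using that by (auto simp: inj_on_def)
  qed
  \<comment> \<open>the chosen roots of unity\<close>
  define R where "R = (\<lambda>j. \<omega> ^ j) ` {..<h}"
  have ind: "(\<Sum>j<h. \<Sum>k<m. (z / \<omega> ^ j) ^ k) = (if z \<in> R then of_nat m else 0)" if z: "z ^ m = 1" for z
  proof -
    have "(\<Sum>k<m. (z / \<omega> ^ j) ^ k) = (if z = \<omega> ^ j then of_nat m else 0)" for j
    proof -
      have "(\<omega> ^ j) ^ m = 1" by (metis wm power_mult mult.commute power_one)
      then show ?thesis using sum_powers_root_of_unity[of "z / \<omega> ^ j" m] z wnz[of j]
        by (auto simp: power_divide)
    qed
    then have *: "(\<Sum>j<h. \<Sum>k<m. (z / \<omega> ^ j) ^ k) = (\<Sum>j<h. if z = \<omega> ^ j then of_nat m else 0)" by simp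
    show ?thesis
    proof (cases "z \<in> R")
      case True
      then obtain i where i: "i < h" "z = \<omega> ^ i" by (auto simp: R_def)
      have "(\<Sum>j<h. if z = \<omega> ^ j then of_nat m else 0 :: complex) = (\<Sum>j<h. if j = i then of_nat m else 0)"
        using i h winj[of i] by (intro sum.cong refl) auto
      then show ?thesis using True i * by simp
    next
      case False
      then have "(\<Sum>j<h. if z = \<omega> ^ j then of_nat m else 0 :: complex) = 0"
        by (intro sum.neutral) (auto simp: R_def)
      then show ?thesis using False * by simp
    qed
  qed
  define D where "D = {x \<in> G0. F x \<in> R}"
  have S: "of_nat m * (\<Sum>x\<in>D. e x y) =
      (\<Sum>j<h. \<Sum>k<m. (1 / \<omega> ^ j) ^ k * (\<Sum>x\<in>G0. F x ^ k * e x y))" for y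
  proof -
    have "of_nat m * (\<Sum>x\<in>D. e x y) = (\<Sum>x\<in>G0. if F x \<in> R then of_nat m * e x y else 0)"
      unfolding D_def using finG0 by (simp add: sum.If_cases sum_distrib_left Collect_conj_eq)
    also have "\<dots> = (\<Sum>x\<in>G0. (\<Sum>j<h. \<Sum>k<m. (F x / \<omega> ^ j) ^ k) * e x y)"
      using F(1) by (intro sum.cong refl) (auto simp: ind)
    also have "\<dots> = (\<Sum>x\<in>G0. \<Sum>j<h. \<Sum>k<m. (1 / \<omega> ^ j) ^ k * (F x ^ k * e x y))"
      by (simp add: sum_distrib_right power_divide)
    also have "\<dots> = (\<Sum>j<h. \<Sum>x\<in>G0. \<Sum>k<m. (1 / \<omega> ^ j) ^ k * (F x ^ k * e x y))"
      by (rule sum.swap)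
    also have "\<dots> = (\<Sum>j<h. \<Sum>k<m. \<Sum>x\<in>G0. (1 / \<omega> ^ j) ^ k * (F x ^ k * e x y))"
      by (intro sum.cong refl sum.swap)
    finally show ?thesis by (simp add: sum_distrib_left)
  qed
  have cc: "of_nat m * (of_int c :: complex) = of_nat h * (of_nat u - 1)"
    using arg_cong[OF c, of "of_int :: int \<Rightarrow> complex"] by simp
  have nontriv: "(\<Sum>x\<in>D. e x y) = of_int c - (if F' y \<in> R then of_nat u else 0)" if y: "y \<in> G0" for y
  proof -
    have yc: "y \<in> carrier G" "y \<noteq> \<one>" using y by (auto simp: G0_def)
    have "(\<Sum>x\<in>carrier G. e x y) = e \<one> y + (\<Sum>x\<in>G0. e x y)"
      unfolding G0_def by (rule sum.remove[OF fin one])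
    then have s0: "(\<Sum>x\<in>G0. e x y) = -1"
      using p yc by (simp add: pairing_def eq_neg_iff_add_eq_0 add.commute)
    have "(1 / \<omega> ^ j) ^ k * (\<Sum>x\<in>G0. F x ^ k * e x y) =
        (if k = 0 then of_nat u - 1 else 0) - of_nat u * (F' y / \<omega> ^ j) ^ k" if "k < m" for j k
      using F(3)[of k y] that y yc s0 by (cases "k = 0") (auto simp: power_divide)
    then have "of_nat m * (\<Sum>x\<in>D. e x y) =
       (\<Sum>j<h. \<Sum>k<m. (if k = 0 then of_nat u - 1 else 0) - of_nat u * (F' y / \<omega> ^ j) ^ k)"
      unfolding S by simp
    also have "\<dots> = of_nat h * (of_nat u - 1) - of_nat u * (\<Sum>j<h. \<Sum>k<m. (F' y / \<omega> ^ j) ^ k)"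
      using m by (simp add: sum_subtractf sum_distrib_left)
    also have "\<dots> = of_nat m * (of_int c - (if F' y \<in> R then of_nat u else 0))"
      using F(2) y by (simp add: ind cc right_diff_distrib)
    finally show ?thesis using m by simp
  qed
  have card_D: "of_nat (card D) = (of_int (c * (int u + 1)) :: complex)"
  proof -
    have e1: "e x \<one> = 1" if "x \<in> carrier G" for x using p that by (simp add: pairing_def)
    have s: "(\<Sum>x\<in>G0. e x \<one>) = of_nat u ^ 2 - 1"
    proof -
      have "u ^ 2 > 0" using card fin one by (metis card_gt_0_iff empty_iff)
      have "(\<Sum>x\<in>G0. e x \<one>) = of_nat (card G0)" by (simp add: e1 G0_def)
      also have "card G0 = u ^ 2 - 1" unfolding G0_def using fin one card by simp
      finally show ?thesis using \<open>u ^ 2 > 0\<close> by (simp add: of_nat_diff Suc_leI)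
    qed
    have "(1 / \<omega> ^ j) ^ k * (\<Sum>x\<in>G0. F x ^ k * e x \<one>) = (if k = 0 then of_nat u ^ 2 - 1 else 0)"
      if "k < m" for j k
      using F(3)[of k "\<one>"] that one s by (cases "k = 0") (auto simp: G0_def)
    then have "of_nat m * (\<Sum>x\<in>D. e x \<one>) = of_nat h * (of_nat u ^ 2 - 1)"
      unfolding S using m by simp
    also have "\<dots> = (of_nat h * (of_nat u - 1)) * (of_nat u + 1)"
      by (simp add: power2_eq_square algebra_simps)
    also have "\<dots> = of_nat m * (of_int c * (of_nat u + 1))"
      by (simp only: cc[symmetric] mult.assoc)
    finally have "(\<Sum>x\<in>D. e x \<one>) = of_int c * (of_nat u + 1)" using m by simp
    moreover have "(\<Sum>x\<in>D. e x \<one>) = of_nat (card D)"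
      by (simp add: e1 D_def G0_def)
    ultimately show ?thesis by simp
  qed
  show thesis
  proof (rule that[of D])
    show "D \<subseteq> carrier G - {\<one>}" by (auto simp: D_def G0_def)
    show "inv x \<in> D" if "x \<in> D" for x using that F(1) by (auto simp: D_def)
    show "(\<Sum>x\<in>D. e x y) = of_int c \<or> (\<Sum>x\<in>D. e x y) = of_int c - of_nat u"
      if "y \<in> carrier G - {\<one>}" for y
      using nontriv[of y] that by (auto simp: G0_def)
    have "(of_int (int (card D)) :: complex) = of_int (c * (int u + 1))" using card_D by simp
    then show "int (card D) = c * (int u + 1)" by (simp only: of_int_eq_iff)
  qed
qed

text \<open>The transform \<open>d\<close> of the set is a root of \<open>(X - c) (X - c + u)\<close> at every nontrivial character. Hence the
convolution square of the set and the stated combination of the set, the identity and the whole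
group have equal transforms there; the cardinalities settle the trivial character, and Fourier
inversion gives the identity.\<close>

lemma convolution_of_two_valued_set:
  fixes G (structure)
  assumes p: "pairing G e" and D: "D \<subseteq> carrier G - {\<one>}"
    and dual: "\<And>y. y \<in> carrier G - {\<one>} \<Longrightarrow> (\<Sum>x\<in>D. e x y) = of_int c \<or> (\<Sum>x\<in>D. e x y) = of_int c - of_nat u"
    and cD: "int (card D) = c * (int u + 1)" and card: "card (carrier G) = u ^ 2" and g: "g \<in> carrier G"
  shows "int (card {z \<in> D. g \<otimes> inv z \<in> D}) =
    (if g \<in> D then 2 * c - int u else 0) + (if g = \<one> then c * (int u - c) else 0) + (c ^ 2 + c)"
proof -
  have cG: "comm_group G" and fin: "finite (carrier G)" using p by (auto simp: pairing_def)
  interpret comm_group G by fact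
  have mult: "e (x \<otimes> x') y = e x y * e x' y" if "x \<in> carrier G" "x' \<in> carrier G" "y \<in> carrier G" for x x' y
    using p that by (simp add: pairing_def)
  have Dc: "x \<in> carrier G" if "x \<in> D" for x using D that by auto
  have finD: "finite D" using D fin by (meson Diff_subset finite_subset)
  define M where "M = (\<lambda>g. (of_nat (card {z \<in> D. g \<otimes> inv z \<in> D}) :: complex))"
  define d where "d = (\<lambda>y. \<Sum>x\<in>D. e x y)"
  have hatM: "(\<Sum>x\<in>carrier G. M x * e x y) = d y ^ 2" if y: "y \<in> carrier G" for y
  proof -
    have "(\<Sum>x\<in>carrier G. M x * e x y) = (\<Sum>x\<in>carrier G. \<Sum>z\<in>D. if x \<otimes> inv z \<in> D then e x y else 0)"
      using finD by (simp add: M_def sum.If_cases Collect_conj_eq)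
    also have "\<dots> = (\<Sum>z\<in>D. \<Sum>x\<in>carrier G. if x \<otimes> inv z \<in> D then e x y else 0)"
      by (rule sum.swap)
    also have "\<dots> = (\<Sum>z\<in>D. \<Sum>w\<in>D. e w y * e z y)"
    proof (rule sum.cong[OF refl])
      fix z assume z: "z \<in> D"
      have "(\<Sum>x\<in>carrier G. if x \<otimes> inv z \<in> D then e x y else 0) =
          (\<Sum>x\<in>{x \<in> carrier G. x \<otimes> inv z \<in> D}. e x y)"
        using fin by (simp add: sum.If_cases Collect_conj_eq)
      also have "\<dots> = (\<Sum>w\<in>D. e (w \<otimes> z) y)"
        by (rule sum.reindex_bij_witness[of _ "\<lambda>w. w \<otimes> z" "\<lambda>x. x \<otimes> inv z"])
          (use z Dc in \<open>auto simp: m_assoc\<close>)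
      also have "\<dots> = (\<Sum>w\<in>D. e w y * e z y)"
        using z y Dc by (intro sum.cong refl) (simp add: mult)
      finally show "(\<Sum>x\<in>carrier G. if x \<otimes> inv z \<in> D then e x y else 0) = \<dots>" .
    qed
    also have "\<dots> = d y ^ 2" by (simp add: d_def power2_eq_square sum_product mult.commute)
    finally show ?thesis .
  qed
  define a b f where "a = (2 * of_int c - of_nat u :: complex)" and "b = (of_int c * (of_nat u - of_int c) :: complex)"
    and "f = (of_int c ^ 2 + of_int c :: complex)"
  \<comment> \<open>the difference of the two sides of the claim, whose transform is to vanish\<close>
  define \<Phi> where "\<Phi> = (\<lambda>x. M x - (if x \<in> D then a else 0) - (if x = \<one> then b else 0) - f)"
  have "\<Phi> g = 0"
  proof (rule pairing_inversion[OF p _ g])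
    fix y assume y: "y \<in> carrier G"
    have "(\<Sum>x\<in>carrier G. \<Phi> x * e x y) = (\<Sum>x\<in>carrier G. M x * e x y)
        - (\<Sum>x\<in>carrier G. if x \<in> D then a * e x y else 0)
        - (\<Sum>x\<in>carrier G. if x = \<one> then b * e x y else 0) - f * (\<Sum>x\<in>carrier G. e x y)"
      unfolding \<Phi>_def sum_distrib_left sum_subtractf[symmetric]
      by (intro sum.cong refl) (auto simp: algebra_simps)
    also have "(\<Sum>x\<in>carrier G. if x \<in> D then a * e x y else 0) = a * d y"
    proof -
      have "carrier G \<inter> D = D" using Dc by auto
      then show ?thesis using fin by (simp add: sum.If_cases d_def sum_distrib_left)
    qed
    also have "(\<Sum>x\<in>carrier G. if x = \<one> then b * e x y else 0) = b"
      using fin p y by (simp add: pairing_def)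
    finally have eq: "(\<Sum>x\<in>carrier G. \<Phi> x * e x y) = d y ^ 2 - a * d y - b - f * (\<Sum>x\<in>carrier G. e x y)"
      by (simp add: hatM[OF y])
    show "(\<Sum>x\<in>carrier G. \<Phi> x * e x y) = 0"
    proof (cases "y = \<one>")
      case True
      have e1: "e x \<one> = 1" if "x \<in> carrier G" for x using p that by (simp add: pairing_def)
      have "d y = of_nat (card D)" using Dc by (simp add: d_def True e1)
      then have "d y = of_int (int (card D))" by simp
      then have dy: "d y = of_int c * (of_nat u + 1)" by (simp add: cD)
      have "(\<Sum>x\<in>carrier G. e x y) = of_nat u ^ 2" by (simp add: True e1 card)
      then show ?thesis unfolding eq dy a_def b_def f_def by (simp add: power2_eq_square algebra_simps)
    next
      case False
      then have s: "(\<Sum>x\<in>carrier G. e x y) = 0" using p y by (simp add: pairing_def)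
      from False y dual[of y] have "d y = of_int c \<or> d y = of_int c - of_nat u" by (simp add: d_def)
      then have "(d y - of_int c) * (d y - (of_int c - of_nat u)) = 0" by auto
      then show ?thesis unfolding eq s a_def b_def f_def by (simp add: power2_eq_square algebra_simps)
    qed
  qed
  then have "M g = of_int ((if g \<in> D then 2 * c - int u else 0) + (if g = \<one> then c * (int u - c) else 0) + (c ^ 2 + c))"
  proof -
    have "M g = (if g \<in> D then a else 0) + (if g = \<one> then b else 0) + f"
      using \<open>\<Phi> g = 0\<close> by (simp only: \<Phi>_def diff_diff_eq right_minus_eq)
    then show ?thesis
      by (cases "g \<in> D"; cases "g = \<one>") (simp_all add: a_def b_def f_def)
  qed
  then have "(of_int (int (card {z \<in> D. g \<otimes> inv z \<in> D})) :: complex) =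
      of_int ((if g \<in> D then 2 * c - int u else 0) + (if g = \<one> then c * (int u - c) else 0) + (c ^ 2 + c))"
    by (simp only: M_def of_int_of_nat_eq)
  then show ?thesis by (simp only: of_int_eq_iff)
qed

text \<open>The common neighbours \<open>z\<close> of \<open>x\<close> and \<open>y\<close> correspond, through \<open>w = x - z\<close> in additive notation, to the
decompositions of \<open>x - y\<close> into a sum of two elements of \<open>D\<close>.\<close>

lemma Cay_strongly_regular:
  fixes G (structure)
  assumes G: "comm_group G" and fin: "finite (carrier G)"
    and D: "D \<subseteq> carrier G - {\<one>}" and inv: "\<And>x. x \<in> D \<Longrightarrow> inv x \<in> D"
    and v: "int (card (carrier G)) = v" and k: "int (card D) = k"
    and l: "\<And>g. g \<in> D \<Longrightarrow> int (card {z \<in> D. g \<otimes> inv z \<in> D}) = l"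
    and mu: "\<And>g. \<lbrakk>g \<in> carrier G; g \<noteq> \<one>; g \<notin> D\<rbrakk> \<Longrightarrow> int (card {z \<in> D. g \<otimes> inv z \<in> D}) = \<mu>"
  shows "Cayley_graph_on G (Cay G D)" "strongly_regular_graph (Cay G D) v k l \<mu>"
proof -
  interpret comm_group G by fact
  have Dc: "x \<in> carrier G" if "x \<in> D" for x using D that by auto
  have "(\<lambda>x. inv x) ` D = D"
  proof
    show "D \<subseteq> (\<lambda>x. inv x) ` D"
    proof
      fix x assume x: "x \<in> D"
      then have "x = inv (inv x)" using Dc by simp
      then show "x \<in> (\<lambda>x. inv x) ` D" using inv[OF x] by blast
    qed
  qed (use inv in auto)
  then show "Cayley_graph_on G (Cay G D)" unfolding Cayley_graph_on_def using D by blast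
  have cancel: "x \<otimes> (z \<otimes> inv x) = z" if "x \<in> carrier G" "z \<in> carrier G" for x z
    using that by (metis inv_closed m_assoc m_comm r_inv r_one)
  have swap: "x \<otimes> inv y \<in> D \<longleftrightarrow> y \<otimes> inv x \<in> D" if "x \<in> carrier G" "y \<in> carrier G" for x y
  proof -
    have *: "inv (a \<otimes> inv b) = b \<otimes> inv a" if "a \<in> carrier G" "b \<in> carrier G" for a b
      using that by (simp add: inv_mult m_comm)
    show ?thesis using inv *[OF that] *[OF that(2,1)] by metis
  qed
  define E where "E = parcs (Cay G D)"
  have E: "(x, y) \<in> E \<longleftrightarrow> x \<in> carrier G \<and> y \<in> carrier G \<and> x \<otimes> inv y \<in> D" for x y
    by (simp add: E_def Cay_def)
  have verts: "pverts (Cay G D) = carrier G" by (simp add: Cay_def)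
  have "E \<subseteq> carrier G \<times> carrier G" using E by auto
  then have finE: "finite E" using fin by (meson finite_SigmaI finite_subset)
  have pg: "pair_graph (Cay G D)"
  proof unfold_locales
    show "symmetric (with_proj (Cay G D))"
      unfolding symmetric_def using swap by (auto simp: E_def[symmetric] E intro!: symI)
    fix e assume "e \<in> parcs (Cay G D)"
    then have e: "e \<in> E" by (simp add: E_def)
    then show "fst e \<in> pverts (Cay G D)" "snd e \<in> pverts (Cay G D)"
      using E[of "fst e" "snd e"] by (simp_all add: verts)
    show "fst e \<noteq> snd e" using E[of "fst e" "snd e"] e D by auto
  qed (use fin finE in \<open>simp_all add: verts E_def\<close>)
  have deg: "int (out_degree (with_proj (Cay G D)) x) = k" if x: "x \<in> carrier G" for x
  proof -
    have "out_arcs (with_proj (Cay G D)) x = (\<lambda>d. (x, inv d \<otimes> x)) ` D"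
    proof (intro subset_antisym subsetI)
      fix a assume "a \<in> out_arcs (with_proj (Cay G D)) x"
      then obtain y where y: "a = (x, y)" "y \<in> carrier G" "x \<otimes> inv y \<in> D"
        by (cases a) (auto simp: out_arcs_def E_def[symmetric] E)
      moreover have "x \<otimes> (y \<otimes> inv x) = y"
        using x y(2) by (metis inv_closed m_assoc m_comm r_inv r_one)
      then have "y = inv (x \<otimes> inv y) \<otimes> x"
        using x y(2) by (simp add: inv_mult m_ac cancel)
      ultimately show "a \<in> (\<lambda>d. (x, inv d \<otimes> x)) ` D" by blast
    next
      fix a assume "a \<in> (\<lambda>d. (x, inv d \<otimes> x)) ` D"
      then obtain d where d: "d \<in> D" "a = (x, inv d \<otimes> x)" by auto
      have "x \<otimes> inv (inv d \<otimes> x) = d" using x Dc[OF d(1)] by (simp add: inv_mult m_ac cancel)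
      then show "a \<in> out_arcs (with_proj (Cay G D)) x"
        using d x Dc by (auto simp: out_arcs_def E_def[symmetric] E)
    qed
    moreover have "inj_on (\<lambda>d. (x, inv d \<otimes> x)) D"
      using x Dc by (intro inj_onI) (metis Pair_inject inv_closed inv_inv r_cancel)
    ultimately show ?thesis using k by (simp add: out_degree_def card_image)
  qed
  have common: "card {z \<in> carrier G. (x, z) \<in> E \<and> (y, z) \<in> E} =
      card {z \<in> D. (x \<otimes> inv y) \<otimes> inv z \<in> D}" if xy: "x \<in> carrier G" "y \<in> carrier G" for x y
  proof (rule bij_betw_same_card[of "\<lambda>z. x \<otimes> inv z"], rule bij_betw_byWitness[where f' = "\<lambda>w. inv w \<otimes> x"])
    have key: "(x \<otimes> inv y) \<otimes> inv (x \<otimes> inv z) = z \<otimes> inv y" if z: "z \<in> carrier G" for z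
    proof -
      have ac: "a \<otimes> b \<otimes> (c \<otimes> d) = (a \<otimes> d) \<otimes> (c \<otimes> b)"
        if "a \<in> carrier G" "b \<in> carrier G" "c \<in> carrier G" "d \<in> carrier G" for a b c d
        using that by (simp add: m_ac)
      have "inv (x \<otimes> inv z) = z \<otimes> inv x" using xy z by (simp add: inv_mult m_comm)
      then have "(x \<otimes> inv y) \<otimes> inv (x \<otimes> inv z) = (x \<otimes> inv x) \<otimes> (z \<otimes> inv y)"
        using ac[of x "inv y" z "inv x"] xy z by (simp only: inv_closed)
      then show ?thesis using xy z by simp
    qed
    have backward: "inv (x \<otimes> inv z) \<otimes> x = z" if z: "z \<in> carrier G" for z
      using xy z by (simp add: inv_mult m_ac cancel)
    have forward: "x \<otimes> inv (inv w \<otimes> x) = w" if w: "w \<in> carrier G" for w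
      using xy w by (simp add: inv_mult m_ac cancel)
    show "\<forall>a\<in>{z \<in> carrier G. (x, z) \<in> E \<and> (y, z) \<in> E}. inv (x \<otimes> inv a) \<otimes> x = a"
      using backward by auto
    show "\<forall>a'\<in>{z \<in> D. x \<otimes> inv y \<otimes> inv z \<in> D}. x \<otimes> inv (inv a' \<otimes> x) = a'"
      using forward Dc by auto
    show "(\<lambda>z. x \<otimes> inv z) ` {z \<in> carrier G. (x, z) \<in> E \<and> (y, z) \<in> E} \<subseteq> {z \<in> D. x \<otimes> inv y \<otimes> inv z \<in> D}"
      using key swap xy by (auto simp: E)
    show "(\<lambda>w. inv w \<otimes> x) ` {z \<in> D. x \<otimes> inv y \<otimes> inv z \<in> D} \<subseteq> {z \<in> carrier G. (x, z) \<in> E \<and> (y, z) \<in> E}"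
    proof safe
      fix w assume w: "w \<in> D" "x \<otimes> inv y \<otimes> inv w \<in> D"
      define z where "z = inv w \<otimes> x"
      have z: "z \<in> carrier G" "x \<otimes> inv z = w" using w Dc xy forward by (auto simp: z_def)
      then show "z \<in> carrier G" "(x, z) \<in> E" using w xy by (auto simp: E)
      have "z \<otimes> inv y \<in> D" using key[OF z(1)] z(2) w(2) by simp
      then show "(y, z) \<in> E" using swap z xy by (auto simp: E)
    qed
  qed
  have ne: "x \<otimes> inv y \<noteq> \<one>" if "x \<in> carrier G" "y \<in> carrier G" "x \<noteq> y" for x y
    using that by (metis inv_closed inv_equality inv_inv)
  show "strongly_regular_graph (Cay G D) v k l \<mu>"
    unfolding strongly_regular_graph_def verts E_def[symmetric]
    using pg v deg common l mu ne by (auto simp: E)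
qed

lemma split_type_cayley:
  fixes G (structure)
  assumes st: "split_type m u G" and card: "card (carrier G) = u ^ 2" and m: "m > 0" and h: "h \<le> m"
    and c: "int m * c = int h * (int u - 1)"
  shows "\<exists>\<Gamma>. Cayley_graph_on G \<Gamma> \<and>
    strongly_regular_graph \<Gamma> (int u ^ 2) (c * (int u + 1)) (- int u + c ^ 2 + 3 * c) (c ^ 2 + c)"
proof -
  from st obtain e A B A' B' where 1: "pairing G e"
    "A \<inter> B = {}" "A \<union> B = carrier G - {\<one>}" "A' \<inter> B' = {}" "A' \<union> B' = carrier G - {\<one>}"
    "dual_phases G e m (- of_nat u) A A'" "dual_phases G e m (- of_nat u) B B'"
    unfolding split_type_def by (elim exE conjE) (rule that)
  have G: "comm_group G" and fin: "finite (carrier G)" using 1(1) by (auto simp: pairing_def)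
  have "dual_phases G e m (- of_nat u) (carrier G - {\<one>}) (carrier G - {\<one>})"
    using dual_phases_Un[OF 1(6,7) fin 1(2,4)] by (simp only: 1(3,5))
  from dual_phases_two_valued_set[OF 1(1) this card m h c]
  obtain D where D: "D \<subseteq> carrier G - {\<one>}" "\<And>x. x \<in> D \<Longrightarrow> inv x \<in> D"
    "\<And>y. y \<in> carrier G - {\<one>} \<Longrightarrow> (\<Sum>x\<in>D. e x y) = of_int c \<or> (\<Sum>x\<in>D. e x y) = of_int c - of_nat u"
    "int (card D) = c * (int u + 1)" by blast
  have conv: "int (card {z \<in> D. g \<otimes> inv z \<in> D}) =
    (if g \<in> D then 2 * c - int u else 0) + (if g = \<one> then c * (int u - c) else 0) + (c ^ 2 + c)"
    if "g \<in> carrier G" for g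
    by (rule convolution_of_two_valued_set[OF 1(1) D(1) D(3) D(4) card that])
  have v: "int (card (carrier G)) = int u ^ 2" by (simp add: card)
  have l: "int (card {z \<in> D. g \<otimes> inv z \<in> D}) = - int u + c ^ 2 + 3 * c" if "g \<in> D" for g
  proof -
    have "g \<in> carrier G" "g \<noteq> \<one>" using that D(1) by auto
    then show ?thesis using conv[of g] that by simp
  qed
  have mu: "int (card {z \<in> D. g \<otimes> inv z \<in> D}) = c ^ 2 + c"
    if "g \<in> carrier G" "g \<noteq> \<one>" "g \<notin> D" for g
    using conv[OF that(1)] that by simp
  show ?thesis using Cay_strongly_regular[OF G fin D(1,2) v D(4) l mu] by blast
qed

section \<open>Elementary abelian groups\<close>

text \<open>A maximal proper subgroup \<open>H\<close> and any element \<open>x\<close> outside it generate the group. A power of \<open>x\<close> with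
exponent prime to \<open>p\<close> generates the same cyclic group as \<open>x\<close>, so it does not lie in \<open>H\<close>, and the
sum is direct.\<close>

lemma (in comm_group) exponent_prime_splits:
  fixes p :: nat
  assumes fin: "finite (carrier G)" and p: "Factorial_Ring.prime p"
    and exp: "\<And>x. x \<in> carrier G \<Longrightarrow> x [^]\<^bsub>G\<^esub> p = \<one>\<^bsub>G\<^esub>" and nt: "carrier G \<noteq> {\<one>\<^bsub>G\<^esub>}"
  obtains H where "subgroup H G" "G\<lparr>carrier := H\<rparr> \<times>\<times> integer_mod_group p \<cong> G"
proof -
  define S where "S = {H. subgroup H G \<and> H \<noteq> carrier G}"
  have "S \<subseteq> Pow (carrier G)" by (auto simp: S_def dest: subgroup.subset)
  then have finS: "finite S" using fin by (meson finite_Pow_iff finite_subset)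
  have "{\<one>} \<in> S" using nt triv_subgroup by (auto simp: S_def)
  then have "Max (card ` S) \<in> card ` S" using finS by (intro Max_in) auto
  then obtain H where H: "H \<in> S" "card H = Max (card ` S)" by auto
  have max: "card K \<le> card H" if "K \<in> S" for K using that finS H(2) by simp
  have sub: "subgroup H G" and ne: "H \<noteq> carrier G" using H by (auto simp: S_def)
  have Hc: "H \<subseteq> carrier G" using sub by (rule subgroup.subset)
  with ne obtain x where x: "x \<in> carrier G" "x \<notin> H" by blast
  have p0: "p > 0" using p by (simp add: prime_gt_0_nat)
  have xp: "x [^] int p = \<one>" using exp[OF x(1)] by (simp add: int_pow_int)
  have xmod: "x [^] (i mod int p) = x [^] i" for i :: int
  proof -
    have "x [^] i = x [^] (int p * (i div int p) + i mod int p)" by simp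
    also have "\<dots> = x [^] (int p * (i div int p)) \<otimes> x [^] (i mod int p)"
      using x by (simp only: int_pow_mult)
    also have "x [^] (int p * (i div int p)) = \<one>"
      using x xp by (simp add: int_pow_pow[symmetric] del: int_pow_pow)
    finally show ?thesis using x by simp
  qed
  have inH: "i = 0" if i: "x [^] i \<in> H" and b: "\<bar>i\<bar> < int p" for i :: int
  proof (rule ccontr)
    assume "i \<noteq> 0"
    then have "\<not> int p dvd i" using b zdvd_imp_le[of "int p" "\<bar>i\<bar>"] by auto
    then have "coprime i (int p)" using p by (meson coprime_commute prime_imp_coprime prime_nat_int_transfer)
    then obtain u v where uv: "u * i + v * int p = 1"
      using bezout_int[of i "int p"] by (auto simp: coprime_iff_gcd_eq_1)
    have "x = x [^] (u * i + v * int p)" using x by (simp add: uv int_pow_1)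
    also have "\<dots> = (x [^] i) [^] u \<otimes> (x [^] int p) [^] v"
      using x by (simp add: int_pow_mult int_pow_pow mult.commute)
    also have "\<dots> = (x [^] i) [^] u" using x by (simp add: xp)
    also have "\<dots> \<in> H" using i by (rule subgroup_int_pow_closed[OF sub])
    finally show False using x by simp
  qed
  let ?P = "G\<lparr>carrier := H\<rparr> \<times>\<times> integer_mod_group p"
  define f where "f = (\<lambda>(h, i::int). h \<otimes> x [^] i)"
  have carP: "carrier ?P = H \<times> {0..<int p}" using p0 by (simp add: carrier_integer_mod_group)
  have fcl: "f z \<in> carrier G" if "z \<in> carrier ?P" for z
    using that Hc x by (auto simp: f_def carP)
  have hom: "f \<in> hom ?P G"
  proof (rule homI)
    fix z w assume "z \<in> carrier ?P" "w \<in> carrier ?P"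
    then obtain h i k j where zw: "z = (h, i)" "w = (k, j)" "h \<in> carrier G" "k \<in> carrier G"
      using Hc by (cases z; cases w) auto
    have "f (z \<otimes>\<^bsub>?P\<^esub> w) = h \<otimes> k \<otimes> x [^] (i + j)" by (simp add: zw f_def xmod)
    also have "\<dots> = f z \<otimes> f w" using zw x by (simp add: f_def int_pow_mult m_ac)
    finally show "f (z \<otimes>\<^bsub>?P\<^esub> w) = f z \<otimes> f w" .
  qed (rule fcl)
  have gP: "group ?P" by (intro DirProd_group subgroup.subgroup_is_group[OF sub]) (simp_all add: is_group)
  then interpret f: group_hom ?P G f
    using hom by (simp add: group_hom_def group_hom_axioms_def is_group)
  have inj: "inj_on f (carrier ?P)"
  proof (rule inj_onI)
    fix z w assume zw: "z \<in> carrier ?P" "w \<in> carrier ?P" and eq: "f z = f w"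
    then obtain h i k j where d: "z = (h, i)" "w = (k, j)" "h \<in> H" "k \<in> H" "0 \<le> i" "i < int p" "0 \<le> j" "j < int p"
      using carP by (cases z; cases w) (simp del: carrier_DirProd)
    then have hk: "h \<in> carrier G" "k \<in> carrier G" using Hc by auto
    have "x [^] (i - j) = inv h \<otimes> k"
    proof -
      have "h \<otimes> x [^] i = k \<otimes> x [^] j" using eq by (simp add: d f_def)
      then have "x [^] i = inv h \<otimes> (k \<otimes> x [^] j)" using hk x by (metis int_pow_closed inv_solve_left m_closed)
      then have "x [^] i \<otimes> x [^] (- j) = inv h \<otimes> k \<otimes> (x [^] j \<otimes> x [^] (- j))"
        using hk x by (simp add: m_assoc)
      then show ?thesis using hk x by (simp add: int_pow_mult[symmetric])
    qed
    also have "\<dots> \<in> H" using d sub by (simp add: subgroup.m_closed subgroup.m_inv_closed)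
    finally have "i - j = 0" using d by (intro inH) auto
    then have ij: "i = j" by simp
    then have "h = k" using eq hk x by (simp add: d f_def)
    with ij show "z = w" by (simp add: d)
  qed
  have "subgroup (f ` carrier ?P) G" by (rule f.img_is_subgroup)
  moreover have "card (f ` carrier ?P) > card H"
  proof -
    have "card (carrier ?P) = card H * p" by (simp add: carP card_cartesian_product del: carrier_DirProd)
    then have "card (f ` carrier ?P) = card H * p" using inj by (simp add: card_image del: carrier_DirProd)
    moreover have "card H > 0" using Hc fin sub subgroup.one_closed
      by (metis card_gt_0_iff empty_iff finite_subset)
    ultimately show ?thesis using prime_gt_1_nat[OF p] by simp
  qed
  ultimately have "f ` carrier ?P = carrier G"
    using max[of "f ` carrier ?P"] by (force simp: S_def)
  with hom inj have "f \<in> iso ?P G" by (simp add: iso_def bij_betw_def)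
  then show thesis using that[OF sub] by (auto simp: is_iso_def)
qed

lemma exponent_prime_subgroup:
  fixes p :: nat
  assumes G: "comm_group G" and sub: "subgroup H G"
    and exp: "\<And>x. x \<in> carrier G \<Longrightarrow> x [^]\<^bsub>G\<^esub> p = \<one>\<^bsub>G\<^esub>"
  shows "comm_group (G\<lparr>carrier := H\<rparr>)"
    "\<And>x. x \<in> carrier (G\<lparr>carrier := H\<rparr>) \<Longrightarrow> x [^]\<^bsub>G\<lparr>carrier := H\<rparr>\<^esub> p = \<one>\<^bsub>G\<lparr>carrier := H\<rparr>\<^esub>"
proof -
  interpret comm_group G by fact
  show "comm_group (G\<lparr>carrier := H\<rparr>)" 
    using subgroup.mem_carrier[OF sub]
    by (intro group.group_comm_groupI subgroup.subgroup_is_group[OF sub is_group]) (auto simp: m_comm)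
  show "x [^]\<^bsub>G\<lparr>carrier := H\<rparr>\<^esub> p = \<one>\<^bsub>G\<lparr>carrier := H\<rparr>\<^esub>" if "x \<in> carrier (G\<lparr>carrier := H\<rparr>)" for x
    using exp[of x] subgroup.mem_carrier[OF sub] that by (simp add: nat_pow_consistent[symmetric])
qed

text \<open>Induction on the order, splitting off a cyclic factor of order \<open>p\<close> on both sides.\<close>

lemma exponent_prime_iso:
  fixes p :: nat and G :: "('a, 'b) monoid_scheme" and K :: "('c, 'd) monoid_scheme"
  assumes p: "Factorial_Ring.prime p"
  shows "\<lbrakk>comm_group G; finite (carrier G); \<And>x. x \<in> carrier G \<Longrightarrow> x [^]\<^bsub>G\<^esub> p = \<one>\<^bsub>G\<^esub>;
    comm_group K; finite (carrier K); \<And>x. x \<in> carrier K \<Longrightarrow> x [^]\<^bsub>K\<^esub> p = \<one>\<^bsub>K\<^esub>;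
    card (carrier G) = card (carrier K)\<rbrakk> \<Longrightarrow> G \<cong> K"
proof (induction "card (carrier G)" arbitrary: G K rule: less_induct)
  case less
  interpret G: comm_group G by fact
  interpret K: comm_group K by fact
  show ?case
  proof (cases "carrier G = {\<one>\<^bsub>G\<^esub>}")
    case True
    then have "card (carrier K) = 1" using less.prems by simp
    then have K: "carrier K = {\<one>\<^bsub>K\<^esub>}" by (metis K.one_closed card_1_singletonE singletonD)
    have "(\<lambda>_. \<one>\<^bsub>K\<^esub>) \<in> iso G K" using True K by (auto simp: iso_def hom_def bij_betw_def)
    then show ?thesis by (auto simp: is_iso_def)
  next
    case False
    obtain A where A: "subgroup A G" "G\<lparr>carrier := A\<rparr> \<times>\<times> integer_mod_group p \<cong> G"
      using comm_group.exponent_prime_splits[OF less.prems(1,2) p less.prems(3) False] by blast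
    have "card (carrier G) \<noteq> 1" using False by (metis G.one_closed card_1_singletonE singletonD)
    then have "carrier K \<noteq> {\<one>\<^bsub>K\<^esub>}" using less.prems(7) by auto
    then obtain B where B: "subgroup B K" "K\<lparr>carrier := B\<rparr> \<times>\<times> integer_mod_group p \<cong> K"
      using comm_group.exponent_prime_splits[OF less.prems(4,5) p less.prems(6)] by blast
    let ?A = "G\<lparr>carrier := A\<rparr>" and ?B = "K\<lparr>carrier := B\<rparr>"
    have p0: "p > 1" using p by (rule prime_gt_1_nat)
    have cA: "card A * p = card (carrier G)" and cB: "card B * p = card (carrier K)"
      using iso_same_card[OF A(2)] iso_same_card[OF B(2)] p0
      by (auto simp: card_cartesian_product carrier_integer_mod_group)
    have finAB: "finite A" "finite B"
      using A(1) B(1) less.prems(2,5) by (auto dest: subgroup.subset intro: finite_subset)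
    then have "card A > 0" using A(1) by (metis card_gt_0_iff empty_iff subgroup.one_closed)
    then have lt: "card A < card (carrier G)" using cA p0 by (metis nat_mult_less_cancel1 nat_mult_1_right)
    have "card A = card B" using cA cB less.prems(7) p0 by (metis less_numeral_extra(3) mult_cancel2 not_one_less_zero)
    then have AB: "?A \<cong> ?B"
      using lt finAB exponent_prime_subgroup[OF less.prems(1) A(1) less.prems(3)]
        exponent_prime_subgroup[OF less.prems(4) B(1) less.prems(6)]
      by (intro less.hyps) auto
    have gA: "group ?A" by (rule subgroup.subgroup_is_group[OF A(1) G.is_group])
    have gB: "group ?B" by (rule subgroup.subgroup_is_group[OF B(1) K.is_group])
    have "?A \<times>\<times> integer_mod_group p \<cong> ?B \<times>\<times> integer_mod_group p"
      by (rule group.DirProd_iso_trans[OF gA AB iso_refl])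
    from this B(2) have *: "?A \<times>\<times> integer_mod_group p \<cong> K" by (rule iso_trans)
    have "G \<cong> ?A \<times>\<times> integer_mod_group p"
      by (rule group.iso_sym[OF DirProd_group[OF gA group_integer_mod_group] A(2)])
    from this * show ?thesis by (rule iso_trans)
  qed
qed

definition additive_char :: "('a, 'b) monoid_scheme \<Rightarrow> ('a \<Rightarrow> complex) \<Rightarrow> bool" where
  "additive_char G \<psi> \<longleftrightarrow>
     (\<forall>x\<in>carrier G. \<forall>y\<in>carrier G. \<psi> (x \<otimes>\<^bsub>G\<^esub> y) = \<psi> x * \<psi> y) \<and> (\<forall>x\<in>carrier G. \<psi> x \<noteq> 0)"

text \<open>Project to a split-off cyclic factor of order \<open>p\<close> and exponentiate.\<close>

lemma exponent_prime_nontrivial_char: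
  fixes p :: nat
  assumes G: "comm_group G" and fin: "finite (carrier G)" and p: "Factorial_Ring.prime p"
    and exp: "\<And>x. x \<in> carrier G \<Longrightarrow> x [^]\<^bsub>G\<^esub> p = \<one>\<^bsub>G\<^esub>" and nt: "carrier G \<noteq> {\<one>\<^bsub>G\<^esub>}"
  obtains \<psi> a where "additive_char G \<psi>" "a \<in> carrier G" "\<psi> a \<noteq> 1"
proof -
  obtain H where H: "subgroup H G" "G\<lparr>carrier := H\<rparr> \<times>\<times> integer_mod_group p \<cong> G"
    using comm_group.exponent_prime_splits[OF assms] by blast
  let ?H = "G\<lparr>carrier := H\<rparr>" and ?Z = "integer_mod_group p"
  have gG: "group G" using G by (simp add: comm_group_def)
  have gH: "group ?H" by (rule subgroup.subgroup_is_group[OF H(1) gG])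
  have "G \<cong> ?H \<times>\<times> ?Z" by (rule group.iso_sym[OF DirProd_group[OF gH group_integer_mod_group] H(2)])
  then obtain f where f: "f \<in> iso G (?H \<times>\<times> ?Z)" by (auto simp: is_iso_def)
  define \<psi> where "\<psi> = (\<lambda>x. cis (2 * pi * of_int (snd (f x)) / of_nat p))"
  have p1: "p > 1" using p by (rule prime_gt_1_nat)
  have per: "cis (2 * pi * of_int (i mod int p) / of_nat p) = cis (2 * pi * of_int i / of_nat p)" for i :: int
  proof -
    have "of_int i = (of_int (i mod int p) + of_nat p * of_int (i div int p) :: real)"
      by (metis (no_types, lifting) mod_mult_div_eq of_int_add of_int_mult of_int_of_nat_eq)
    then have "2 * pi * of_int i / of_nat p = 2 * pi * of_int (i mod int p) / of_nat p + 2 * pi * of_int (i div int p)"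
      using p1 by (simp add: field_simps)
    then have "cis (2 * pi * of_int i / of_nat p) = cis (2 * pi * of_int (i mod int p) / of_nat p) * cis (2 * pi * of_int (i div int p))"
      by (simp only: cis_mult)
    also have "cis (2 * pi * of_int (i div int p)) = 1" by (rule cis_multiple_2pi) simp
    finally show ?thesis by simp
  qed
  have "additive_char G \<psi>"
    unfolding additive_char_def
  proof (intro conjI ballI)
    fix x y assume "x \<in> carrier G" "y \<in> carrier G"
    then have "f (x \<otimes>\<^bsub>G\<^esub> y) = f x \<otimes>\<^bsub>?H \<times>\<times> ?Z\<^esub> f y" using f by (auto simp: iso_def hom_def)
    then have "snd (f (x \<otimes>\<^bsub>G\<^esub> y)) = (snd (f x) + snd (f y)) mod int p"
      by (cases "f x"; cases "f y") simp
    then show "\<psi> (x \<otimes>\<^bsub>G\<^esub> y) = \<psi> x * \<psi> y"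
      by (simp add: \<psi>_def per cis_mult add_divide_distrib ring_distribs)
  qed (simp add: \<psi>_def)
  moreover
  have "(\<one>\<^bsub>G\<^esub>, 1) \<in> carrier (?H \<times>\<times> ?Z)" using p1 subgroup.one_closed[OF H(1)] by simp
  then have "(\<one>\<^bsub>G\<^esub>, 1) \<in> f ` carrier G" using f by (simp add: iso_def bij_betw_def)
  then obtain a where a: "a \<in> carrier G" "f a = (\<one>\<^bsub>G\<^esub>, 1)" by force
  have "\<psi> a \<noteq> 1"
  proof
    assume "\<psi> a = 1"
    then have c: "cos (2 * pi / p) = 1" by (simp add: \<psi>_def a complex_eq_iff)
    then obtain n :: int where "2 * pi / p = real_of_int n * 2 * pi" by (auto simp: cos_one_2pi_int)
    then have "1 = real_of_int (n * int p)" using p1 by (simp add: field_simps)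
    then have "1 = n * int p" by linarith
    then have "int p dvd 1" by (metis dvd_triv_right)
    then show False using p1 by simp
  qed
  ultimately show thesis using that a by blast
qed

section \<open>Existence of finite fields\<close>

lemma (in cring) binomial_expansion:
  assumes xy: "x \<in> carrier R" "y \<in> carrier R"
  shows "(x \<oplus> y) [^] n = (\<Oplus>k\<in>{..n}. [(n choose k)] \<cdot>\<^bsub>R\<^esub> (x [^] k \<otimes> y [^] (n - k)))"
proof (induction n)
  case 0
  then show ?case using xy by simp
next
  case (Suc n)
  define t where "t = (\<lambda>n k. [(n choose k)] \<cdot>\<^bsub>R\<^esub> (x [^] k \<otimes> y [^] (n - k)))"
  have tc [simp]: "t i k \<in> carrier R" for i k using xy by (simp add: t_def)
  have last: "t n (Suc n) = \<zero>" using xy by (simp add: t_def binomial_eq_0)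
  have shift: "t (Suc n) (Suc k) = x \<otimes> t n k \<oplus> y \<otimes> t n (Suc k)" if "k \<le> n" for k
  proof -
    have 1: "x \<otimes> t n k = [(n choose k)] \<cdot>\<^bsub>R\<^esub> (x [^] Suc k \<otimes> y [^] (n - k))"
      unfolding t_def using xy by (subst add_pow_rdistr) (auto simp: m_ac)
    have 2: "y \<otimes> t n (Suc k) = [(n choose Suc k)] \<cdot>\<^bsub>R\<^esub> (x [^] Suc k \<otimes> y [^] (n - k))"
    proof (cases "k = n")
      case True
      then show ?thesis using xy by (simp add: t_def binomial_eq_0)
    next
      case False
      with that have "n - k = Suc (n - Suc k)" by simp
      then show ?thesis unfolding t_def using xy by (subst add_pow_rdistr) (auto simp: m_ac)
    qed
    show ?thesis unfolding 1 2 using xy by (simp add: t_def add.nat_pow_mult)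
  qed
  have 0: "t (Suc n) 0 = y \<otimes> t n 0" using xy by (simp add: t_def m_comm)
  have "(x \<oplus> y) [^] Suc n = (x \<oplus> y) \<otimes> (\<Oplus>k\<in>{..n}. t n k)"
    using xy Suc by (simp add: t_def m_comm)
  also have "\<dots> = x \<otimes> (\<Oplus>k\<in>{..n}. t n k) \<oplus> y \<otimes> ((\<Oplus>k\<in>{..n}. t n k) \<oplus> t n (Suc n))"
    using xy by (simp add: l_distr last)
  also have "(\<Oplus>k\<in>{..n}. t n k) \<oplus> t n (Suc n) = (\<Oplus>k\<in>{..Suc n}. t n k)"
    by (simp add: a_comm)
  also have "y \<otimes> (\<Oplus>k\<in>{..Suc n}. t n k) = (\<Oplus>k\<in>{..Suc n}. y \<otimes> t n k)"
    using xy by (intro finsum_rdistr) auto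
  also have "\<dots> = (\<Oplus>k\<in>{..n}. y \<otimes> t n (Suc k)) \<oplus> y \<otimes> t n 0"
    using xy by (intro finsum_Suc2) auto
  also have "x \<otimes> (\<Oplus>k\<in>{..n}. t n k) = (\<Oplus>k\<in>{..n}. x \<otimes> t n k)"
    using xy by (intro finsum_rdistr) auto
  also have "(\<Oplus>k\<in>{..n}. x \<otimes> t n k) \<oplus> ((\<Oplus>k\<in>{..n}. y \<otimes> t n (Suc k)) \<oplus> y \<otimes> t n 0) =
      (\<Oplus>k\<in>{..n}. x \<otimes> t n k \<oplus> y \<otimes> t n (Suc k)) \<oplus> y \<otimes> t n 0"
    using xy by (subst finsum_addf) (auto simp: a_assoc intro!: finsum_closed)
  also have "(\<Oplus>k\<in>{..n}. x \<otimes> t n k \<oplus> y \<otimes> t n (Suc k)) = (\<Oplus>k\<in>{..n}. t (Suc n) (Suc k))"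
    using xy by (intro finsum_cong') (auto simp: shift)
  also have "(\<Oplus>k\<in>{..n}. t (Suc n) (Suc k)) \<oplus> y \<otimes> t n 0 = (\<Oplus>k\<in>{..Suc n}. t (Suc n) k)"
    unfolding 0[symmetric] by (intro finsum_Suc2[symmetric]) auto
  finally show ?case by (simp add: t_def)
qed

text \<open>Additivity of the Frobenius map and its iterates: the inner binomial coefficients are divisible by \<open>p\<close>.\<close>

lemma (in cring) freshman_power:
  assumes p: "Factorial_Ring.prime p" and char: "[p] \<cdot>\<^bsub>R\<^esub> \<one> = \<zero>" and xy: "x \<in> carrier R" "y \<in> carrier R"
  shows "(x \<oplus> y) [^] (p ^ n :: nat) = x [^] (p ^ n) \<oplus> y [^] (p ^ n)"
proof -
  have p0: "[p] \<cdot>\<^bsub>R\<^esub> z = \<zero>" if "z \<in> carrier R" for z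
  proof -
    have "[p] \<cdot>\<^bsub>R\<^esub> z = [p] \<cdot>\<^bsub>R\<^esub> (\<one> \<otimes> z)" using that by simp
    also have "\<dots> = ([p] \<cdot>\<^bsub>R\<^esub> \<one>) \<otimes> z" using that by (intro add_pow_ldistr[symmetric]) auto
    finally show ?thesis using that by (simp add: char)
  qed
  have pz: "[(p * j)] \<cdot>\<^bsub>R\<^esub> z = \<zero>" if "z \<in> carrier R" for z j
    using that add.nat_pow_pow[of z p j] p0[of "[j] \<cdot>\<^bsub>R\<^esub> z"] by (simp add: mult.commute)
  have step: "(x \<oplus> y) [^] p = x [^] p \<oplus> y [^] p" if xy: "x \<in> carrier R" "y \<in> carrier R" for x y
  proof -
    obtain r where r: "p = Suc (Suc r)" using p by (metis not0_implies_Suc not_prime_0 not_prime_1 One_nat_def)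
    have "(x \<oplus> y) [^] p = (\<Oplus>k\<in>{..p}. [(p choose k)] \<cdot>\<^bsub>R\<^esub> (x [^] k \<otimes> y [^] (p - k)))"
      by (rule binomial_expansion[OF xy])
    also have "\<dots> = (\<Oplus>k\<in>{..p}. if k = 0 then y [^] p else if k = p then x [^] p else \<zero>)"
    proof (intro finsum_cong' refl)
      fix k assume k: "k \<in> {..p}"
      show "[(p choose k)] \<cdot>\<^bsub>R\<^esub> (x [^] k \<otimes> y [^] (p - k)) =
          (if k = 0 then y [^] p else if k = p then x [^] p else \<zero>)"
      proof (cases "k = 0 \<or> k = p")
        case True
        then show ?thesis using xy by auto
      next
        case False
        then have "p dvd (p choose k)" using k p by (intro dvd_choose_prime) auto
        then obtain j where "p choose k = p * j" by blast
        then show ?thesis using False xy by (simp add: pz)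
      qed
    qed (use xy in auto)
    also have "\<dots> = x [^] p \<oplus> y [^] p"
    proof -
      have "(\<Oplus>k\<in>{..r}. if Suc k = p then x [^] p else \<zero>) = (\<Oplus>k\<in>{..r}. \<zero>)"
        using xy by (intro finsum_cong') (auto simp: r)
      also have "\<dots> = \<zero>" by simp
      finally have "(\<Oplus>k\<in>{..r}. if Suc k = p then x [^] p else \<zero>) = \<zero>" .
      then show ?thesis unfolding r using xy by (subst finsum_Suc2) auto
    qed
    finally show ?thesis .
  qed
  show ?thesis
    using xy by (induction n) (simp_all add: nat_pow_pow[symmetric] step mult.commute[of p])
qed


text \<open>Meant for polynomial rings, with \<open>x\<close> the indeterminate and \<open>a\<close> a constant fixed by the Frobenius power:
\<open>x\<^sup>Q - x\<close>, where \<open>Q = p\<^sup>n\<close>, has no repeated root. Additivity of the Frobenius turns it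
into \<open>d\<^sup>Q - d\<close> with \<open>d = x - a\<close>; if \<open>d\<^sup>2\<close> divides this, cancelling \<open>d\<close> shows that \<open>d\<close> divides \<open>1\<close>. This
replaces the usual argument with derivatives.\<close>

lemma (in domain) double_factor_of_pow_minus_self:
  assumes p: "Factorial_Ring.prime p" and char: "[p] \<cdot>\<^bsub>R\<^esub> \<one> = \<zero>" and n: "n > 0"
    and x: "x \<in> carrier R" and a: "a \<in> carrier R" "a [^] (p ^ n :: nat) = a"
    and h: "h \<in> carrier R" and eq: "x [^] (p ^ n) \<ominus> x = (x \<ominus> a) \<otimes> (x \<ominus> a) \<otimes> h"
    and ne: "x \<noteq> a"
  shows "x \<ominus> a \<in> Units R"
proof -
  define d where "d = x \<ominus> a"
  have d: "d \<in> carrier R" "d \<noteq> \<zero>" using x a ne by (auto simp: d_def)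
  have p1: "p ^ n > 1" using p n prime_gt_1_nat by (metis one_less_power)
  then have r: "p ^ n = Suc (Suc (p ^ n - 2))" by simp
  define r where "r = p ^ n - 2"
  note r = r[folded r_def]
  have "x = d \<oplus> a" using x a by (simp add: d_def a_minus_def a_assoc l_neg)
  then have "x [^] (p ^ n) = d [^] (p ^ n) \<oplus> a"
    using freshman_power[OF p char d(1) a(1), of n] a(2) by simp
  then have "x [^] (p ^ n) \<ominus> x = d [^] (p ^ n) \<oplus> (a \<ominus> x)"
    using x a d by (simp add: a_minus_def a_assoc)
  also have "a \<ominus> x = \<ominus> d" using x a unfolding d_def by algebra
  finally have "x [^] (p ^ n) \<ominus> x = d [^] (p ^ n) \<oplus> \<ominus> d" .
  moreover have "x [^] (p ^ n) \<ominus> x = d \<otimes> d \<otimes> h" using eq by (simp only: d_def)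
  ultimately have "d \<otimes> d \<otimes> h = d [^] (p ^ n) \<ominus> d" by (simp add: a_minus_def)
  moreover have "d [^] (p ^ n) = d \<otimes> (d \<otimes> d [^] r)"
    using d by (simp only: r nat_pow_Suc2 nat_pow_closed)
  ultimately have "d \<otimes> (d \<otimes> h) = d \<otimes> (d \<otimes> d [^] r \<ominus> \<one>)"
    using d h by (simp add: m_assoc r_distr a_minus_def r_minus)
  then have "d \<otimes> h = d \<otimes> d [^] r \<ominus> \<one>" using d h by (subst (asm) m_lcancel) auto
  then have "d \<otimes> d [^] r \<ominus> d \<otimes> h = \<one>"
    using d h by (simp add: a_minus_def minus_add a_assoc[symmetric] r_neg)
  then have "d \<otimes> (d [^] r \<ominus> h) = \<one>"
    using d h by (simp add: r_distr a_minus_def r_minus)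
  moreover from this have "(d [^] r \<ominus> h) \<otimes> d = \<one>" using d h by (simp add: m_comm)
  ultimately show ?thesis using d h unfolding d_def[symmetric] Units_def
    by (auto intro!: bexI[of _ "d [^] r \<ominus> h"])
qed

lemma (in ring) add_pow_hom:
  assumes "ring_hom_ring R S h" "x \<in> carrier R"
  shows "h ([(n::nat)] \<cdot>\<^bsub>R\<^esub> x) = [n] \<cdot>\<^bsub>S\<^esub> (h x)"
proof -
  interpret ring_hom_ring R S h by fact
  show ?thesis using assms(2) by (induction n) simp_all
qed

lemma residue_ring_prime:
  assumes p: "Factorial_Ring.prime p"
  shows "field (residue_ring (int p))"
    "[p] \<cdot>\<^bsub>residue_ring (int p)\<^esub> \<one>\<^bsub>residue_ring (int p)\<^esub> = \<zero>\<^bsub>residue_ring (int p)\<^esub>"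
proof -
  interpret rp: residues_prime p "residue_ring (int p)" using p by unfold_locales simp_all
  show "field (residue_ring (int p))" by (rule rp.is_field)
  have "[k] \<cdot>\<^bsub>residue_ring (int p)\<^esub> \<one>\<^bsub>residue_ring (int p)\<^esub> = int k mod int p" for k :: nat
    by (induction k) (simp_all add: rp.res_zero_eq rp.res_one_eq rp.res_add_eq mod_simps add.commute)
  then show "[p] \<cdot>\<^bsub>residue_ring (int p)\<^esub> \<one>\<^bsub>residue_ring (int p)\<^esub> = \<zero>\<^bsub>residue_ring (int p)\<^esub>"
    by (simp add: rp.res_zero_eq)
qed

text \<open>The points are the roots of \<open>X\<^sup>Q - X\<close>, for \<open>Q = p\<^sup>n\<close>, which splits and has no repeated roots.\<close>

lemma (in algebraically_closed) card_frobenius_fixed_points: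
  assumes p: "Factorial_Ring.prime p" and n: "n > 0" and charL: "[p] \<cdot>\<^bsub>L\<^esub> \<one> = \<zero>"
  shows "card {x \<in> carrier L. x [^] (p ^ n :: nat) = x} = p ^ n"
proof -
  define Q where "Q = p ^ n"
  have Q1: "Q > 1" using p n prime_gt_1_nat by (metis Q_def one_less_power)
  define P where "P = poly_ring L"
  interpret P: domain P unfolding P_def by (rule univ_poly_is_domain[OF carrier_is_subring])
  have homP: "ring_hom_ring L P poly_of_const"
    using canonical_embedding_ring_hom[OF carrier_is_subring] by (simp add: P_def)
  have charP: "[p] \<cdot>\<^bsub>P\<^esub> \<one>\<^bsub>P\<^esub> = \<zero>\<^bsub>P\<^esub>"
    using add_pow_hom[OF homP one_closed, of p] ring_hom_ring.homh[OF homP]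
    by (simp add: charL ring_hom_one ring_hom_zero[OF _ ring_axioms P.ring_axioms])
  have X: "X \<in> carrier P" unfolding P_def by (rule var_closed[OF carrier_is_subring])
  define f where "f = X [^]\<^bsub>P\<^esub> Q \<ominus>\<^bsub>P\<^esub> X"
  have f: "f \<in> carrier P" using X by (simp add: f_def)
  have "splitted f" using f unfolding P_def by (rule roots_over_carrier)
  have deg: "degree f = Q"
  proof -
    have m: "X [^]\<^bsub>P\<^esub> Q = monom \<one> Q"
      unfolding P_def by (rule unitary_monom_eq_var_pow[OF carrier_is_subring, symmetric])
    have d1: "degree (X [^]\<^bsub>P\<^esub> Q) = Q" unfolding m by (simp add: monom_def)
    have d2: "degree (\<ominus>\<^bsub>P\<^esub> X) = 1"
      using X univ_poly_a_inv_degree[OF carrier_is_subring] unfolding P_def by (simp add: var_def)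
    have XQ: "X [^]\<^bsub>P\<^esub> Q \<in> carrier P" "\<ominus>\<^bsub>P\<^esub> X \<in> carrier P" using X by simp_all
    have "degree f = degree (poly_add (X [^]\<^bsub>P\<^esub> Q) (\<ominus>\<^bsub>P\<^esub> X))"
      by (simp add: f_def a_minus_def P_def univ_poly_add)
    also have "\<dots> = max (degree (X [^]\<^bsub>P\<^esub> Q)) (degree (\<ominus>\<^bsub>P\<^esub> X))"
      using XQ Q1 d1 d2 by (intro poly_add_degree_eq[OF carrier_is_subring]) (auto simp: P_def univ_poly_carrier)
    finally show ?thesis using d1 d2 Q1 by simp
  qed
  have eval: "eval f x = x [^] Q \<ominus> x" if x: "x \<in> carrier L" for x
  proof -
    interpret e: ring_hom_ring P L "\<lambda>q. eval q x"
      unfolding P_def by (rule eval_ring_hom[OF carrier_is_subring x])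
    show ?thesis using X x by (simp add: f_def a_minus_def e.hom_nat_pow eval_var)
  qed
  define K where "K = {x \<in> carrier L. x [^] Q = x}"
  have f0: "f \<noteq> []" using deg Q1 by auto
  have root: "x \<in># roots f \<longleftrightarrow> x \<in> K" for x
  proof -
    have "eval f x = \<zero> \<longleftrightarrow> x [^] Q = x" if "x \<in> carrier L"
      unfolding eval[OF that] using that by (intro r_right_minus_eq) auto
    then show ?thesis
      using roots_mem_iff_is_root[of f x] f f0 by (auto simp: is_root_def K_def P_def)
  qed
  have mult1: "count (roots f) a \<le> 1" for a
  proof (rule ccontr)
    assume "\<not> ?thesis"
    then have c: "2 \<le> alg_mult f a" using alg_mult_eq_count_roots[of f] f by (simp add: P_def)
    then have "a \<in># roots f" using alg_mult_eq_count_roots[of f] f by (auto simp: P_def simp flip: count_greater_zero_iff)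
    then have a: "a \<in> carrier L" "a [^] Q = a" by (auto simp: root K_def)
    define c where "c = poly_of_const a"
    have cP: "c \<in> carrier P" using ring_hom_ring.homh[OF homP] a(1) by (auto simp: c_def ring_hom_def)
    have cQ: "c [^]\<^bsub>P\<^esub> (p ^ n) = c"
      using ring_hom_ring.hom_nat_pow[OF homP a(1), of Q] a(2) by (simp add: c_def Q_def)
    \<comment> \<open>multiplicities are defined through the coefficient list of \<open>X - a\<close>\<close>
    have d: "[\<one>, \<ominus> a] = X \<ominus>\<^bsub>P\<^esub> c"
    proof -
      have dP: "[\<one>, \<ominus> a] \<in> carrier P"
        using a(1) by (auto simp: P_def univ_poly_carrier[symmetric] polynomial_def)
      have "[\<one>, \<ominus> a] \<oplus>\<^bsub>P\<^esub> c = X"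
        using a(1) by (cases "a = \<zero>")
          (simp_all add: P_def univ_poly_add c_def poly_of_const_def var_def l_neg)
      then have "X \<ominus>\<^bsub>P\<^esub> c = [\<one>, \<ominus> a] \<oplus>\<^bsub>P\<^esub> (c \<ominus>\<^bsub>P\<^esub> c)"
        using dP cP by (simp add: a_minus_def P.a_assoc[symmetric])
      then show ?thesis using dP cP by (simp add: a_minus_def P.r_neg)
    qed
    have "([\<one>, \<ominus> a] [^]\<^bsub>P\<^esub> (2::nat)) pdivides f"
      using le_alg_mult_imp_pdivides[OF a(1), of f 2] c f by (simp add: P_def)
    then obtain h where h: "h \<in> carrier P" "f = (X \<ominus>\<^bsub>P\<^esub> c) [^]\<^bsub>P\<^esub> (2::nat) \<otimes>\<^bsub>P\<^esub> h"
      unfolding d by (auto simp: pdivides_def factor_def P_def)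
    have "f = (X \<ominus>\<^bsub>P\<^esub> c) \<otimes>\<^bsub>P\<^esub> (X \<ominus>\<^bsub>P\<^esub> c) \<otimes>\<^bsub>P\<^esub> h"
      using h X cP by (simp add: numeral_2_eq_2)
    moreover have "X \<noteq> c" using d X cP by (metis P.r_right_minus_eq list.distinct(1) univ_poly_zero P_def)
    ultimately have "X \<ominus>\<^bsub>P\<^esub> c \<in> Units P"
      using X cP cQ h(1) n p charP unfolding f_def Q_def
      by (intro P.double_factor_of_pow_minus_self[of p n]) auto
    then obtain e where e: "e \<in> carrier P" "(X \<ominus>\<^bsub>P\<^esub> c) \<otimes>\<^bsub>P\<^esub> e = \<one>\<^bsub>P\<^esub>" by (auto simp: Units_def)
    interpret ev: ring_hom_ring P L "\<lambda>q. eval q a"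
      unfolding P_def by (rule eval_ring_hom[OF carrier_is_subring a(1)])
    have "eval (X \<ominus>\<^bsub>P\<^esub> c) a = \<zero>"
      unfolding d[symmetric] using a(1) by (simp add: r_neg)
    then have "eval ((X \<ominus>\<^bsub>P\<^esub> c) \<otimes>\<^bsub>P\<^esub> e) a = \<zero>"
      using e(1) X cP by simp
    then show False unfolding e(2) by simp
  qed
  have K: "K = set_mset (roots f)" using root by auto
  have "card K = size (roots f)"
  proof -
    have "count (roots f) a = 1" if "a \<in> K" for a
      using mult1[of a] that count_greater_zero_iff[of "roots f" a] unfolding K by linarith
    then show ?thesis by (simp add: size_multiset_overloaded_eq K)
  qed
  then show ?thesis using \<open>splitted f\<close> deg by (simp add: splitted_def K_def Q_def)
qed

text \<open>Closure under addition is the additivity of the Frobenius.\<close>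

lemma (in field) frobenius_fixed_subfield:
  assumes p: "Factorial_Ring.prime p" and char: "[p] \<cdot>\<^bsub>R\<^esub> \<one> = \<zero>"
  shows "subfield {x \<in> carrier R. x [^] (p ^ n :: nat) = x} R"
proof -
  define Q where "Q = p ^ n"
  have Q1: "Q > 0" using p by (simp add: Q_def prime_gt_0_nat)
  define K where "K = {x \<in> carrier R. x [^] Q = x}"
  have frob: "(x \<oplus> y) [^] Q = x [^] Q \<oplus> y [^] Q" if "x \<in> carrier R" "y \<in> carrier R" for x y
    unfolding Q_def by (rule freshman_power[OF p char that])
  have zeroQ: "\<zero> [^] Q = \<zero>" using Q1 by (intro nat_pow_zero) auto
  have "subring K R"
  proof (rule subringI)
    fix x assume "x \<in> K"
    then have x: "x \<in> carrier R" "x [^] Q = x" by (auto simp: K_def)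
    have "x [^] Q \<oplus> (\<ominus> x) [^] Q = \<zero>"
      using frob[of x "\<ominus> x"] x zeroQ by (simp add: r_neg)
    then have "(\<ominus> x) [^] Q = \<ominus> x" using x by (metis a_inv_closed minus_equality nat_pow_closed a_comm)
    then show "\<ominus> x \<in> K" using x by (simp add: K_def)
  qed (auto simp: K_def frob nat_pow_distrib)
  then have "subfield K R"
  proof (rule subfieldI')
    fix k assume "k \<in> K - {\<zero>}"
    then have k: "k \<in> carrier R" "k [^] Q = k" "k \<in> Units R" by (auto simp: K_def field_Units)
    have "k \<otimes> (inv k) [^] Q = (k \<otimes> inv k) [^] Q"
      using k by (subst nat_pow_distrib) auto
    also have "\<dots> = \<one>" using k by simp
    finally have "inv k = (inv k) [^] Q"
      using k by (intro comm_inv_char) auto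
    then show "inv k \<in> K" using k by (auto simp: K_def)
  qed
  then show ?thesis by (simp add: K_def Q_def)
qed

text \<open>The field is found inside an algebraic closure of the prime field.\<close>

lemma exists_finite_field:
  fixes p n :: nat
  assumes p: "Factorial_Ring.prime p" and n: "n > 0"
  shows "\<exists>F :: ((int list \<times> nat) multiset \<Rightarrow> int) ring.
    field F \<and> card (carrier F) = p ^ n \<and> (\<forall>x\<in>carrier F. [p] \<cdot>\<^bsub>F\<^esub> x = \<zero>\<^bsub>F\<^esub>)"
proof -
  define Q where "Q = p ^ n"
  define Zp where "Zp = residue_ring (int p)"
  interpret Z: field Zp unfolding Zp_def by (rule residue_ring_prime(1)[OF p])
  define L where "L = Z.alg_closure"
  have "algebraically_closed L"
  proof -
    interpret A: algebraic_closure L "Z.indexed_const ` carrier Zp"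
      unfolding L_def by (rule Z.alg_closureE)
    show ?thesis by unfold_locales
  qed
  then interpret L: algebraically_closed L .
  have charZ: "[p] \<cdot>\<^bsub>Zp\<^esub> \<one>\<^bsub>Zp\<^esub> = \<zero>\<^bsub>Zp\<^esub>"
    unfolding Zp_def by (rule residue_ring_prime(2)[OF p])
  have hom: "ring_hom_ring Zp L Z.indexed_const"
    using Z.alg_closureE(2) by (intro ring_hom_ringI2 Z.ring_axioms L.ring_axioms) (simp add: L_def)
  have charL: "[p] \<cdot>\<^bsub>L\<^esub> \<one>\<^bsub>L\<^esub> = \<zero>\<^bsub>L\<^esub>"
    using Z.add_pow_hom[OF hom Z.one_closed, of p] ring_hom_ring.homh[OF hom] 
    by (simp add: charZ ring_hom_one ring_hom_zero[OF _ Z.ring_axioms L.ring_axioms])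
  define K where "K = {x \<in> carrier L. x [^]\<^bsub>L\<^esub> Q = x}"
  have cardK: "card K = Q" unfolding K_def Q_def by (rule L.card_frobenius_fixed_points[OF p n charL])
  have sf: "subfield K L" unfolding K_def Q_def by (rule L.frobenius_fixed_subfield[OF p charL])
  have "field (L\<lparr>carrier := K\<rparr>)" by (rule L.subfield_iff(2)[OF sf])
  moreover have "[p] \<cdot>\<^bsub>L\<lparr>carrier := K\<rparr>\<^esub> x = \<zero>\<^bsub>L\<^esub>" if "x \<in> K" for x
  proof -
    have x: "x \<in> carrier L" using that by (simp add: K_def)
    have "[p] \<cdot>\<^bsub>L\<lparr>carrier := K\<rparr>\<^esub> x = [p] \<cdot>\<^bsub>L\<^esub> (\<one>\<^bsub>L\<^esub> \<otimes>\<^bsub>L\<^esub> x)"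
      using x by (simp add: add_pow_def nat_pow_def)
    also have "\<dots> = ([p] \<cdot>\<^bsub>L\<^esub> \<one>\<^bsub>L\<^esub>) \<otimes>\<^bsub>L\<^esub> x" using x by (intro L.add_pow_ldistr[symmetric]) auto
    finally show ?thesis using x by (simp add: charL)
  qed
  ultimately show ?thesis using cardK
    by (intro exI[of _ "L\<lparr>carrier := K\<rparr>"]) (simp add: Q_def)
qed

section \<open>Exponential sums of an anisotropic binary form\<close>

locale finite_field_char = field R for R (structure) +
  fixes \<psi> :: "'a \<Rightarrow> complex"
  assumes fin [simp]: "finite (carrier R)"
    and psi_add: "\<lbrakk>x \<in> carrier R; y \<in> carrier R\<rbrakk> \<Longrightarrow> \<psi> (x \<oplus> y) = \<psi> x * \<psi> y"
    and psi_nz: "x \<in> carrier R \<Longrightarrow> \<psi> x \<noteq> 0"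
    and psi_nontrivial: "\<exists>a\<in>carrier R. \<psi> a \<noteq> 1"
begin

lemma psi_zero: "\<psi> \<zero> = 1"
  using psi_add[of \<zero> \<zero>] psi_nz[of \<zero>] by simp

lemma sum_translate:
  assumes "t \<in> carrier R" shows "(\<Sum>a\<in>carrier R. f (a \<oplus> t)) = (\<Sum>a\<in>carrier R. f a :: complex)"
  by (rule sum.reindex_bij_witness[of _ "\<lambda>a. a \<ominus> t" "\<lambda>a. a \<oplus> t"])
    (use assms in \<open>auto simp: a_minus_def a_assoc r_neg l_neg\<close>)

lemma sum_scale:
  assumes "w \<in> carrier R" "w \<noteq> \<zero>" shows "(\<Sum>a\<in>carrier R. f (w \<otimes> a)) = (\<Sum>a\<in>carrier R. f a :: complex)"
proof -
  have w: "w \<in> Units R" using assms by (simp add: field_Units)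
  show ?thesis
    by (rule sum.reindex_bij_witness[of _ "\<lambda>a. inv w \<otimes> a" "\<lambda>a. w \<otimes> a"])
      (use assms w in \<open>auto simp: m_assoc[symmetric]\<close>)
qed

lemma psi_sum:
  assumes w: "w \<in> carrier R"
  shows "(\<Sum>x\<in>carrier R. \<psi> (w \<otimes> x)) = (if w = \<zero> then of_nat (card (carrier R)) else 0)"
proof (cases "w = \<zero>")
  case True
  then show ?thesis by (simp add: psi_zero)
next
  case False
  obtain a where a: "a \<in> carrier R" "\<psi> a \<noteq> 1" using psi_nontrivial by blast
  have "(\<Sum>x\<in>carrier R. \<psi> (w \<otimes> x)) = (\<Sum>x\<in>carrier R. \<psi> x)" by (rule sum_scale[OF w False])
  moreover have "(\<Sum>x\<in>carrier R. \<psi> (x \<oplus> a)) = (\<Sum>x\<in>carrier R. \<psi> x)" by (rule sum_translate[OF a(1)])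
  moreover have "(\<Sum>x\<in>carrier R. \<psi> (x \<oplus> a)) = \<psi> a * (\<Sum>x\<in>carrier R. \<psi> x)"
    using a by (simp add: psi_add sum_distrib_left mult.commute)
  ultimately show ?thesis using a False by auto
qed

text \<open>Used to compare sums over squares with sums over the whole field.\<close>

lemma sum_fibres:
  assumes "finite B" "\<phi> ` B \<subseteq> carrier R"
  shows "(\<Sum>b\<in>B. F (\<phi> b)) = (\<Sum>x\<in>carrier R. of_nat (card {b \<in> B. \<phi> b = x}) * F x :: complex)"
proof -
  have "(\<Sum>b\<in>B. F (\<phi> b)) = (\<Sum>x\<in>carrier R. \<Sum>b\<in>{b \<in> B. \<phi> b = x}. F (\<phi> b))"
    using assms by (intro sum.group[symmetric]) auto
  also have "\<dots> = (\<Sum>x\<in>carrier R. \<Sum>b\<in>{b \<in> B. \<phi> b = x}. F x)"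
    by (intro sum.cong) auto
  finally show ?thesis by simp
qed

definition qgauss :: "'a \<Rightarrow> complex" where "qgauss w = (\<Sum>b\<in>carrier R. \<psi> (w \<otimes> (b \<otimes> b)))"

end

text \<open>The field has \<open>q\<^sup>2\<close> elements and odd characteristic, \<open>g\<close> generates its multiplicative group, and \<open>\<chi>\<close> is
the multiplicative character of order \<open>2 m\<close> with \<open>\<chi> g = exp (\<i> \<pi> / m)\<close>. The last three assumptions
concern the subfield of order \<open>q\<close>, whose nonzero elements lie in the kernel of \<open>\<chi>\<close>: this is where
the divisibility of \<open>q + 1\<close> by \<open>2 m\<close> enters.\<close>

locale finite_field_mult_char = finite_field_char R \<psi> for R (structure) and \<psi> +
  fixes \<chi> :: "'a \<Rightarrow> complex" and g :: 'a and m q :: nat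
  assumes two: "\<one> \<oplus> \<one> \<noteq> \<zero>"
    and q1: "q > 1" and m0: "m > 0" and card: "card (carrier R) = q ^ 2"
    and chi_zero: "\<chi> \<zero> = 0"
    and chi_mult: "\<lbrakk>x \<in> carrier R; y \<in> carrier R\<rbrakk> \<Longrightarrow> \<chi> (x \<otimes> y) = \<chi> x * \<chi> y"
    and g: "g \<in> carrier R" "g \<noteq> \<zero>"
    and gen: "\<And>x. \<lbrakk>x \<in> carrier R; x \<noteq> \<zero>\<rbrakk> \<Longrightarrow> \<exists>i::nat. x = g [^] i"
    and chi_g: "\<chi> g = cis (pi / m)"
    and sub_add: "\<lbrakk>x \<in> carrier R; y \<in> carrier R; x [^] q = x; y [^] q = y\<rbrakk> \<Longrightarrow> (x \<oplus> y) [^] q = x \<oplus> y"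
    and sub_card: "card {x \<in> carrier R. x [^] q = x} = q"
    and sub_chi: "\<lbrakk>x \<in> carrier R; x [^] q = x; x \<noteq> \<zero>\<rbrakk> \<Longrightarrow> \<chi> x = 1"
begin

lemma chi_one: "\<chi> \<one> = 1"
  by (rule sub_chi) auto

lemma chi_pow: "x \<in> carrier R \<Longrightarrow> \<chi> (x [^] (n::nat)) = \<chi> x ^ n"
  by (induction n) (simp_all add: chi_one chi_mult mult.commute)

lemma chi_g_m: "\<chi> g ^ m = -1"
  using m0 by (simp add: chi_g DeMoivre)

lemma chi_order:
  assumes "x \<in> carrier R" "x \<noteq> \<zero>" shows "\<chi> x ^ (2 * m) = 1"
proof -
  obtain i :: nat where "x = g [^] i" using gen[OF assms] by blast
  then have "\<chi> x ^ (2 * m) = ((\<chi> g ^ m) ^ 2) ^ i"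
    using g by (simp add: chi_pow power_mult[symmetric] mult.commute mult.left_commute)
  then show ?thesis by (simp add: chi_g_m)
qed

lemma chi_m: "\<lbrakk>x \<in> carrier R; x \<noteq> \<zero>\<rbrakk> \<Longrightarrow> \<chi> x ^ m = 1 \<or> \<chi> x ^ m = -1"
  using chi_order[of x] by (simp add: power_mult[symmetric] mult.commute[of 2] power2_eq_1_iff)
    (metis power2_eq_1_iff power_mult mult.commute)

lemma chi_square_m: "\<lbrakk>x \<in> carrier R; x \<noteq> \<zero>\<rbrakk> \<Longrightarrow> \<chi> (x \<otimes> x) ^ m = 1"
  using chi_order[of x] by (simp add: chi_mult power_mult_distrib power_add[symmetric] mult_2)

lemma square_eq_iff:
  assumes "b \<in> carrier R" "c \<in> carrier R"
  shows "b \<otimes> b = c \<otimes> c \<longleftrightarrow> b = c \<or> b = \<ominus> c"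
proof -
  have "b \<otimes> b \<ominus> c \<otimes> c = (b \<ominus> c) \<otimes> (b \<oplus> c)" using assms by algebra
  then have "b \<otimes> b = c \<otimes> c \<longleftrightarrow> (b \<ominus> c) \<otimes> (b \<oplus> c) = \<zero>" using assms by (metis m_closed r_right_minus_eq)
  also have "\<dots> \<longleftrightarrow> b \<ominus> c = \<zero> \<or> b \<oplus> c = \<zero>" using assms by (simp add: integral_iff)
  also have "b \<oplus> c = \<zero> \<longleftrightarrow> b = \<ominus> c" using assms by (metis minus_equality l_neg a_inv_closed)
  finally show ?thesis using assms by simp
qed

lemma double_zero: "c \<in> carrier R \<Longrightarrow> c \<oplus> c = \<zero> \<longleftrightarrow> c = \<zero>"
proof -
  assume c: "c \<in> carrier R"
  then have "c \<oplus> c = (\<one> \<oplus> \<one>) \<otimes> c" by (simp add: l_distr)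
  then show ?thesis using c two by (simp add: integral_iff)
qed

lemma square_roots_card:
  assumes "c \<in> carrier R" "c \<noteq> \<zero>"
  shows "card {b \<in> carrier R. b \<otimes> b = c \<otimes> c} = 2"
proof -
  have "{b \<in> carrier R. b \<otimes> b = c \<otimes> c} = {c, \<ominus> c}"
    using assms square_eq_iff by auto
  moreover have "c \<noteq> \<ominus> c" using assms double_zero[of c] by (metis r_neg)
  ultimately show ?thesis by simp
qed

lemma square_ne_g_square:
  assumes "b \<in> carrier R" "c \<in> carrier R" "b \<otimes> b = g \<otimes> (c \<otimes> c)"
  shows "b = \<zero> \<and> c = \<zero>"
proof (cases "c = \<zero>")
  case True
  then show ?thesis using assms g by (auto simp: integral_iff)
next
  case False
  then have "b \<noteq> \<zero>" using assms g by (metis integral_iff m_closed r_null)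
  then have "1 = \<chi> (g \<otimes> (c \<otimes> c)) ^ m" using chi_square_m assms by metis
  also have "\<dots> = \<chi> g ^ m * \<chi> (c \<otimes> c) ^ m" using assms g by (simp add: chi_mult power_mult_distrib)
  also have "\<dots> = -1" using chi_square_m[OF assms(2) False] by (simp add: chi_g_m)
  finally show ?thesis by simp
qed

lemma square_or_g_square:
  assumes "x \<in> carrier R" "x \<noteq> \<zero>"
  obtains c where "c \<in> carrier R" "c \<noteq> \<zero>" "x = c \<otimes> c \<or> x = g \<otimes> (c \<otimes> c)"
proof -
  obtain i :: nat where i: "x = g [^] i" using gen[OF assms] by blast
  define c where "c = g [^] (i div 2)"
  have c: "c \<in> carrier R" using g by (simp add: c_def)
  have "i = i div 2 + i div 2 \<or> i = Suc (i div 2 + i div 2)" by presburger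
  then have "x = c \<otimes> c \<or> x = (c \<otimes> c) \<otimes> g"
    unfolding i c_def using g by (metis nat_pow_Suc nat_pow_mult)
  then have "x = c \<otimes> c \<or> x = g \<otimes> (c \<otimes> c)" using c g by (metis m_closed m_comm)
  moreover have "c \<noteq> \<zero>" using calculation assms g by auto
  ultimately show thesis using that c by blast
qed

text \<open>Every nonzero element is, in exactly two ways, either a square or \<open>g\<close> times a square, so the two
quadratic Gauss sums together run twice through the field and cancel.\<close>

lemma qgauss_g:
  assumes w: "w \<in> carrier R" "w \<noteq> \<zero>"
  shows "qgauss (w \<otimes> g) = - qgauss w"
proof -
  have 1: "qgauss w = (\<Sum>x\<in>carrier R. of_nat (card {b \<in> carrier R. b \<otimes> b = x}) * \<psi> (w \<otimes> x))"
    unfolding qgauss_def by (rule sum_fibres[of _ "\<lambda>b. b \<otimes> b" "\<lambda>x. \<psi> (w \<otimes> x)"]) auto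
  have "qgauss (w \<otimes> g) = (\<Sum>b\<in>carrier R. \<psi> (w \<otimes> (g \<otimes> (b \<otimes> b))))"
    unfolding qgauss_def using w g by (simp add: m_assoc)
  also have "\<dots> = (\<Sum>x\<in>carrier R. of_nat (card {b \<in> carrier R. g \<otimes> (b \<otimes> b) = x}) * \<psi> (w \<otimes> x))"
    using g by (intro sum_fibres[of _ "\<lambda>b. g \<otimes> (b \<otimes> b)" "\<lambda>x. \<psi> (w \<otimes> x)"]) auto
  finally have 2: "qgauss (w \<otimes> g) = \<dots>" .
  have two: "card {b \<in> carrier R. b \<otimes> b = x} + card {b \<in> carrier R. g \<otimes> (b \<otimes> b) = x} = 2"
    if x: "x \<in> carrier R" for x
  proof (cases "x = \<zero>")
    case True
    have "{b \<in> carrier R. b \<otimes> b = x} = {\<zero>}" "{b \<in> carrier R. g \<otimes> (b \<otimes> b) = x} = {\<zero>}"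
      using True g by (auto simp: integral_iff)
    then show ?thesis by simp
  next
    case False
    then obtain c where c: "c \<in> carrier R" "c \<noteq> \<zero>" "x = c \<otimes> c \<or> x = g \<otimes> (c \<otimes> c)"
      using square_or_g_square x by blast
    from c(3) show ?thesis
    proof
      assume xc: "x = c \<otimes> c"
      have "{b \<in> carrier R. g \<otimes> (b \<otimes> b) = x} = {}"
        unfolding xc using square_ne_g_square[OF c(1) _ sym] c(2) by blast
      then show ?thesis using square_roots_card[OF c(1,2)] by (simp only: xc) simp
    next
      assume xc: "x = g \<otimes> (c \<otimes> c)"
      have "{b \<in> carrier R. b \<otimes> b = x} = {}"
        unfolding xc using square_ne_g_square[OF _ c(1)] c(2) by blast
      moreover have "{b \<in> carrier R. g \<otimes> (b \<otimes> b) = x} = {b \<in> carrier R. b \<otimes> b = c \<otimes> c}"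
        unfolding xc using g c m_lcancel[OF g(2,1)] by auto
      ultimately show ?thesis using square_roots_card[OF c(1,2)] by simp
    qed
  qed
  have "qgauss w + qgauss (w \<otimes> g) = (\<Sum>x\<in>carrier R. of_nat (card {b \<in> carrier R. b \<otimes> b = x} +
      card {b \<in> carrier R. g \<otimes> (b \<otimes> b) = x}) * \<psi> (w \<otimes> x))"
    unfolding 1 2 by (simp only: of_nat_add distrib_right sum.distrib)
  also have "\<dots> = (\<Sum>x\<in>carrier R. 2 * \<psi> (w \<otimes> x))"
    by (intro sum.cong refl) (simp only: two, simp)
  also have "\<dots> = 0" using psi_sum[OF w(1)] w(2) by (simp flip: sum_distrib_left)
  finally show ?thesis by (simp add: eq_neg_iff_add_eq_0 add.commute)
qed

text \<open>After the substitution \<open>a = c + b\<close> the double sum is linear in \<open>b\<close>, and only \<open>c = 0\<close> survives.\<close>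

lemma qgauss_minus:
  assumes w: "w \<in> carrier R" "w \<noteq> \<zero>"
  shows "qgauss w * qgauss (\<ominus> w) = of_nat q ^ 2"
proof -
  have "qgauss w * qgauss (\<ominus> w) = (\<Sum>b\<in>carrier R. \<Sum>a\<in>carrier R. \<psi> (w \<otimes> (a \<otimes> a)) * \<psi> (\<ominus> w \<otimes> (b \<otimes> b)))"
    unfolding qgauss_def sum_product by (rule sum.swap)
  also have "\<dots> = (\<Sum>b\<in>carrier R. \<Sum>c\<in>carrier R. \<psi> (w \<otimes> (c \<otimes> c)) * \<psi> ((w \<otimes> (c \<oplus> c)) \<otimes> b))"
  proof (rule sum.cong[OF refl])
    fix b assume b: "b \<in> carrier R"
    have "(\<Sum>a\<in>carrier R. \<psi> (w \<otimes> (a \<otimes> a)) * \<psi> (\<ominus> w \<otimes> (b \<otimes> b))) =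
       (\<Sum>c\<in>carrier R. \<psi> (w \<otimes> ((c \<oplus> b) \<otimes> (c \<oplus> b))) * \<psi> (\<ominus> w \<otimes> (b \<otimes> b)))"
      by (rule sum_translate[OF b, symmetric])
    also have "\<dots> = (\<Sum>c\<in>carrier R. \<psi> (w \<otimes> (c \<otimes> c)) * \<psi> ((w \<otimes> (c \<oplus> c)) \<otimes> b))"
    proof (intro sum.cong refl)
      fix c assume c: "c \<in> carrier R"
      have "w \<otimes> ((c \<oplus> b) \<otimes> (c \<oplus> b)) \<oplus> \<ominus> w \<otimes> (b \<otimes> b) = w \<otimes> (c \<otimes> c) \<oplus> (w \<otimes> (c \<oplus> c)) \<otimes> b"
        using w b c by algebra
      then show "\<psi> (w \<otimes> ((c \<oplus> b) \<otimes> (c \<oplus> b))) * \<psi> (\<ominus> w \<otimes> (b \<otimes> b)) = \<psi> (w \<otimes> (c \<otimes> c)) * \<psi> ((w \<otimes> (c \<oplus> c)) \<otimes> b)"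
        using w b c by (simp add: psi_add[symmetric])
    qed
    finally show "(\<Sum>a\<in>carrier R. \<psi> (w \<otimes> (a \<otimes> a)) * \<psi> (\<ominus> w \<otimes> (b \<otimes> b))) = \<dots>" .
  qed
  also have "\<dots> = (\<Sum>c\<in>carrier R. \<psi> (w \<otimes> (c \<otimes> c)) * (\<Sum>b\<in>carrier R. \<psi> ((w \<otimes> (c \<oplus> c)) \<otimes> b)))"
    by (subst sum.swap) (simp add: sum_distrib_left)
  also have "\<dots> = (\<Sum>c\<in>carrier R. if c = \<zero> then of_nat q ^ 2 else 0)"
    using w by (intro sum.cong refl) (auto simp: psi_sum double_zero integral_iff psi_zero card)
  finally show ?thesis by simp
qed

lemma complete_square:
  assumes "w \<in> carrier R" "t \<in> carrier R" "d = w \<otimes> (t \<oplus> t)"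
  shows "(\<Sum>a\<in>carrier R. \<psi> (w \<otimes> (a \<otimes> a) \<oplus> a \<otimes> d)) = \<psi> (\<ominus> (w \<otimes> (t \<otimes> t))) * qgauss w"
proof -
  have "qgauss w = (\<Sum>a\<in>carrier R. \<psi> (w \<otimes> ((a \<oplus> t) \<otimes> (a \<oplus> t))))"
    unfolding qgauss_def by (rule sum_translate[OF assms(2), symmetric])
  then have "\<psi> (\<ominus> (w \<otimes> (t \<otimes> t))) * qgauss w = (\<Sum>a\<in>carrier R. \<psi> (\<ominus> (w \<otimes> (t \<otimes> t))) * \<psi> (w \<otimes> ((a \<oplus> t) \<otimes> (a \<oplus> t))))"
    by (simp add: sum_distrib_left)
  also have "\<dots> = (\<Sum>a\<in>carrier R. \<psi> (w \<otimes> (a \<otimes> a) \<oplus> a \<otimes> d))"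
  proof (intro sum.cong refl)
    fix a assume a: "a \<in> carrier R"
    have "\<ominus> (w \<otimes> (t \<otimes> t)) \<oplus> w \<otimes> ((a \<oplus> t) \<otimes> (a \<oplus> t)) = w \<otimes> (a \<otimes> a) \<oplus> a \<otimes> d"
      unfolding assms(3) using a assms(1,2) by algebra
    then show "\<psi> (\<ominus> (w \<otimes> (t \<otimes> t))) * \<psi> (w \<otimes> ((a \<oplus> t) \<otimes> (a \<oplus> t))) = \<psi> (w \<otimes> (a \<otimes> a) \<oplus> a \<otimes> d)"
      using a assms(1,2) by (simp add: psi_add[symmetric])
  qed
  finally show ?thesis by simp
qed

text \<open>The norm form of the quadratic extension generated by a square root of \<open>g\<close>.\<close>

definition Q :: "'a \<times> 'a \<Rightarrow> 'a" where "Q v = fst v \<otimes> fst v \<ominus> g \<otimes> (snd v \<otimes> snd v)"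

text \<open>The symplectic form; with it every line of the plane is its own annihilator.\<close>

definition det2 :: "'a \<times> 'a \<Rightarrow> 'a \<times> 'a \<Rightarrow> 'a" where
  "det2 v y = fst v \<otimes> snd y \<ominus> snd v \<otimes> fst y"

abbreviation V where "V \<equiv> carrier R \<times> carrier R"

definition four_g :: 'a where "four_g = (\<one> \<oplus> \<one>) \<otimes> (\<one> \<oplus> \<one>) \<otimes> g"

lemma four_g: "four_g \<in> carrier R" "four_g \<noteq> \<zero>"
  using two g by (auto simp: four_g_def integral_iff)

lemma Q_closed [simp]: "v \<in> V \<Longrightarrow> Q v \<in> carrier R"
  using g by (auto simp: Q_def)

lemma det2_closed [simp]: "\<lbrakk>v \<in> V; y \<in> V\<rbrakk> \<Longrightarrow> det2 v y \<in> carrier R"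
  by (auto simp: det2_def)

lemma Q_zero_iff: "v \<in> V \<Longrightarrow> Q v = \<zero> \<longleftrightarrow> v = (\<zero>, \<zero>)"
  using g square_ne_g_square[of "fst v" "snd v"] by (auto simp: Q_def)

lemma square_form_identity:
  assumes "w \<in> carrier R" "g \<in> carrier R" "h \<in> carrier R" "s \<in> carrier R" "t \<in> carrier R"
  shows "(w \<otimes> g \<otimes> (h \<otimes> s)) \<otimes> (w \<otimes> g \<otimes> (h \<otimes> s)) \<ominus> g \<otimes> ((w \<otimes> (h \<otimes> t)) \<otimes> (w \<otimes> (h \<otimes> t))) =
    h \<otimes> h \<otimes> g \<otimes> w \<otimes> (\<ominus> (w \<otimes> (t \<otimes> t)) \<oplus> \<ominus> (\<ominus> (w \<otimes> g) \<otimes> (s \<otimes> s)))"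
  using assms by algebra

text \<open>Completing the square in both variables leaves the product of two quadratic Gauss sums, with parameters
\<open>w\<close> and \<open>- w g\<close>. The nonsquare \<open>g\<close> produces the minus sign, which is the reason for parameters of
negative Latin square type.\<close>

lemma quadratic_exponential_sum:
  assumes w: "w \<in> carrier R" "w \<noteq> \<zero>" and y: "y \<in> V"
  shows "(\<Sum>v\<in>V. \<psi> (w \<otimes> Q v \<oplus> det2 v y)) = - (of_nat q ^ 2) * \<psi> (Q y \<otimes> inv four_g \<otimes> inv w)"
proof -
  obtain c d where cd: "y = (c, d)" "c \<in> carrier R" "d \<in> carrier R" using y by auto
  define i2 where "i2 = inv (\<one> \<oplus> \<one>)"
  \<comment> \<open>half the linear coefficients, divided by the quadratic ones: the shifts that complete the squares\<close>
  define t s where "t = d \<otimes> i2 \<otimes> inv w" and "s = c \<otimes> i2 \<otimes> inv w \<otimes> inv g"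
  define w' where "w' = \<ominus> (w \<otimes> g)"
  have U: "\<one> \<oplus> \<one> \<in> Units R" "w \<in> Units R" "g \<in> Units R" using two w g by (simp_all add: field_Units)
  have cl: "t \<in> carrier R" "s \<in> carrier R" "w' \<in> carrier R" "i2 \<in> carrier R" "inv w \<in> carrier R" "inv g \<in> carrier R"
    using cd U w g by (auto simp: t_def s_def w'_def i2_def)
  have i2: "i2 \<oplus> i2 = \<one>"
  proof -
    have "i2 \<oplus> i2 = (\<one> \<oplus> \<one>) \<otimes> i2" using cl by (simp add: l_distr)
    then show ?thesis using U by (simp add: i2_def)
  qed
  have d: "d = w \<otimes> (t \<oplus> t)"
  proof -
    have "w \<otimes> (t \<oplus> t) = d \<otimes> (i2 \<oplus> i2) \<otimes> (w \<otimes> inv w)"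
      unfolding t_def using cl cd w by algebra
    then show ?thesis using U cd by (simp add: i2)
  qed
  have c: "\<ominus> c = w' \<otimes> (s \<oplus> s)"
  proof -
    have "w' \<otimes> (s \<oplus> s) = \<ominus> (c \<otimes> (i2 \<oplus> i2) \<otimes> (w \<otimes> inv w) \<otimes> (g \<otimes> inv g))"
      unfolding s_def w'_def using cl cd w g by algebra
    then show ?thesis using U cd by (simp add: i2)
  qed
  have "(\<Sum>v\<in>V. \<psi> (w \<otimes> Q v \<oplus> det2 v y)) =
      (\<Sum>v\<in>V. \<psi> (w \<otimes> (fst v \<otimes> fst v) \<oplus> fst v \<otimes> d) * \<psi> (w' \<otimes> (snd v \<otimes> snd v) \<oplus> snd v \<otimes> \<ominus> c))"
  proof (intro sum.cong refl)
    fix v assume "v \<in> V"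
    then obtain a b where v: "v = (a, b)" "a \<in> carrier R" "b \<in> carrier R" by auto
    have "w \<otimes> Q v \<oplus> det2 v y = (w \<otimes> (a \<otimes> a) \<oplus> a \<otimes> d) \<oplus> (w' \<otimes> (b \<otimes> b) \<oplus> b \<otimes> \<ominus> c)"
      unfolding Q_def det2_def v cd w'_def fst_conv snd_conv using v cd w g by algebra
    then show "\<psi> (w \<otimes> Q v \<oplus> det2 v y) = \<psi> (w \<otimes> (fst v \<otimes> fst v) \<oplus> fst v \<otimes> d) * \<psi> (w' \<otimes> (snd v \<otimes> snd v) \<oplus> snd v \<otimes> \<ominus> c)"
      using v cd w cl by (simp add: psi_add)
  qed
  also have "\<dots> = (\<Sum>a\<in>carrier R. \<psi> (w \<otimes> (a \<otimes> a) \<oplus> a \<otimes> d)) * (\<Sum>b\<in>carrier R. \<psi> (w' \<otimes> (b \<otimes> b) \<oplus> b \<otimes> \<ominus> c))"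
    by (simp add: sum_product sum.cartesian_product case_prod_beta)
  also have "\<dots> = \<psi> (\<ominus> (w \<otimes> (t \<otimes> t))) * qgauss w * (\<psi> (\<ominus> (w' \<otimes> (s \<otimes> s))) * qgauss w')"
    by (simp only: complete_square[OF w(1) cl(1) d] complete_square[OF cl(3) cl(2) c])
  also have "qgauss w' = - qgauss (\<ominus> w)"
  proof -
    have "w' = \<ominus> w \<otimes> g" using w g by (simp add: w'_def l_minus)
    moreover have "\<ominus> w \<noteq> \<zero>" using w by (metis add.inv_eq_1_iff)
    ultimately show ?thesis using qgauss_g[of "\<ominus> w"] w by simp
  qed
  also have "\<psi> (\<ominus> (w \<otimes> (t \<otimes> t))) * qgauss w * (\<psi> (\<ominus> (w' \<otimes> (s \<otimes> s))) * - qgauss (\<ominus> w)) =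
      - (qgauss w * qgauss (\<ominus> w)) * (\<psi> (\<ominus> (w \<otimes> (t \<otimes> t))) * \<psi> (\<ominus> (w' \<otimes> (s \<otimes> s))))"
    by (simp add: mult_ac)
  also have "\<psi> (\<ominus> (w \<otimes> (t \<otimes> t))) * \<psi> (\<ominus> (w' \<otimes> (s \<otimes> s))) = \<psi> (Q y \<otimes> inv four_g \<otimes> inv w)"
  proof -
    have "Q y = four_g \<otimes> w \<otimes> (\<ominus> (w \<otimes> (t \<otimes> t)) \<oplus> \<ominus> (w' \<otimes> (s \<otimes> s)))"
    proof -
      define h where "h = \<one> \<oplus> \<one>"
      have h: "h \<in> carrier R" by (simp add: h_def)
      have "\<ominus> c = w' \<otimes> (h \<otimes> s)" "d = w \<otimes> (h \<otimes> t)"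
        using c d cl by (simp_all add: h_def l_distr)
      then have "c = w \<otimes> g \<otimes> (h \<otimes> s)" "d = w \<otimes> (h \<otimes> t)"
        using cd cl h w g by (auto simp: w'_def l_minus dest: arg_cong[of "\<ominus> c" _ "a_inv R"])
      then show ?thesis unfolding Q_def cd fst_conv snd_conv four_g_def w'_def h_def[symmetric]
        using square_form_identity[OF w(1) g(1) h cl(2,1)] by simp
    qed
    moreover have ifg: "inv four_g \<in> carrier R" using four_g by (simp add: field_Units)
    ultimately have "Q y \<otimes> inv four_g \<otimes> inv w = (four_g \<otimes> inv four_g) \<otimes> (w \<otimes> inv w) \<otimes> (\<ominus> (w \<otimes> (t \<otimes> t)) \<oplus> \<ominus> (w' \<otimes> (s \<otimes> s)))"
      using cl w four_g ifg by algebra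
    also have "\<dots> = \<ominus> (w \<otimes> (t \<otimes> t)) \<oplus> \<ominus> (w' \<otimes> (s \<otimes> s))"
      using U cl w four_g field_Units by simp
    finally show ?thesis using cl w by (simp add: psi_add)
  qed
  finally show ?thesis using qgauss_minus[OF w] by simp
qed


definition Fq :: "'a set" where "Fq = {x \<in> carrier R. x [^] q = x}"

lemma Fq_closed: "\<lbrakk>x \<in> Fq; y \<in> Fq\<rbrakk> \<Longrightarrow> x \<oplus> y \<in> Fq" "\<zero> \<in> Fq" "Fq \<subseteq> carrier R"
  using q1 sub_add nat_pow_zero[of q] by (auto simp: Fq_def)

lemma Fq_minus: "x \<in> Fq \<Longrightarrow> \<ominus> x \<in> Fq"
proof -
  assume "x \<in> Fq"
  then have x: "x \<in> carrier R" "x \<in> Fq" using Fq_closed by auto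
  have "(\<lambda>y. y \<oplus> x) ` Fq = Fq"
  proof (rule endo_inj_surj)
    show "finite Fq" using finite_subset[OF Fq_closed(3)] by simp
    show "(\<lambda>y. y \<oplus> x) ` Fq \<subseteq> Fq" using x Fq_closed by auto
    show "inj_on (\<lambda>y. y \<oplus> x) Fq"
    proof (rule inj_onI)
      fix a b assume ab: "a \<in> Fq" "b \<in> Fq" "a \<oplus> x = b \<oplus> x"
      then have c: "a \<in> carrier R" "b \<in> carrier R" using Fq_closed(3) by auto
      from ab(3) have "a \<oplus> x \<oplus> \<ominus> x = b \<oplus> x \<oplus> \<ominus> x" by simp
      then show "a = b" using c x by (simp add: a_assoc r_neg)
    qed
  qed
  then obtain y where "y \<in> Fq" "y \<oplus> x = \<zero>" using Fq_closed(2) by (metis imageE)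
  then show ?thesis using x Fq_closed(3) by (metis minus_equality subsetD)
qed

lemma psi_sum_Fq:
  assumes x: "x \<in> carrier R"
  shows "(\<Sum>a\<in>Fq. \<psi> (a \<otimes> x)) = (if \<forall>a\<in>Fq. \<psi> (a \<otimes> x) = 1 then of_nat q else 0)"
proof (cases "\<forall>a\<in>Fq. \<psi> (a \<otimes> x) = 1")
  case True
  then show ?thesis using sub_card by (simp add: Fq_def)
next
  case False
  then obtain b where b: "b \<in> Fq" "\<psi> (b \<otimes> x) \<noteq> 1" by blast
  have c: "a \<in> carrier R" if "a \<in> Fq" for a using that Fq_closed by auto
  have "(\<Sum>a\<in>Fq. \<psi> (a \<otimes> x)) = (\<Sum>a\<in>Fq. \<psi> ((a \<oplus> b) \<otimes> x))"
    by (rule sum.reindex_bij_witness[of _ "\<lambda>a. a \<oplus> b" "\<lambda>a. a \<oplus> \<ominus> b"])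
      (use b c x Fq_minus Fq_closed(1) in \<open>auto simp: a_assoc r_neg l_neg\<close>)
  also have "\<dots> = \<psi> (b \<otimes> x) * (\<Sum>a\<in>Fq. \<psi> (a \<otimes> x))"
    using b(1) c x by (simp add: l_distr psi_add sum_distrib_left mult.commute)
  finally show ?thesis using b False by auto
qed

text \<open>The annihilator, with respect to \<open>\<psi>\<close>, of the subfield of order \<open>q\<close>.\<close>

definition Fq_perp :: "'a set" where "Fq_perp = {x \<in> carrier R. \<forall>a\<in>Fq. \<psi> (a \<otimes> x) = 1}"

text \<open>Count \<open>\<psi> (a x)\<close> over all \<open>a\<close> in the subfield and all \<open>x\<close> in two ways.\<close>

lemma card_Fq_perp: "card Fq_perp = q"
proof -
  have "of_nat q * (of_nat (card Fq_perp) :: complex) = (\<Sum>x\<in>carrier R. \<Sum>a\<in>Fq. \<psi> (a \<otimes> x))"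
    by (simp add: psi_sum_Fq Fq_perp_def sum.If_cases Int_def mult.commute)
  also have "\<dots> = (\<Sum>a\<in>Fq. \<Sum>x\<in>carrier R. \<psi> (a \<otimes> x))" by (rule sum.swap)
  also have "\<dots> = (\<Sum>a\<in>Fq. if a = \<zero> then of_nat (q ^ 2) else 0)"
    using Fq_closed(3) by (intro sum.cong refl) (auto simp: psi_sum psi_zero card)
  also have "\<dots> = of_nat (q ^ 2)"
    using Fq_closed(2) finite_subset[OF Fq_closed(3)] by simp
  finally have "of_nat (q * card Fq_perp) = (of_nat (q ^ 2) :: complex)" by simp
  then have "q * card Fq_perp = q ^ 2" using of_nat_eq_iff by blast
  then show ?thesis using q1 by (simp add: power2_eq_square)
qed

text \<open>A generator of the annihilator as a one-dimensional space over the subfield of order \<open>q\<close>.\<close>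

definition t0 :: 'a where "t0 = (SOME t. t \<in> Fq_perp \<and> t \<noteq> \<zero>)"

lemma t0: "t0 \<in> carrier R" "t0 \<noteq> \<zero>" "Fq_perp = (\<lambda>a. a \<otimes> t0) ` Fq"
proof -
  have "\<not> Fq_perp \<subseteq> {\<zero>}"
    using card_Fq_perp q1 card_mono[of "{\<zero>}" Fq_perp] by auto
  then have t: "t0 \<in> Fq_perp" "t0 \<noteq> \<zero>" unfolding t0_def by (metis (mono_tags, lifting) someI_ex singletonI subsetI)+
  then show c: "t0 \<in> carrier R" "t0 \<noteq> \<zero>" by (auto simp: Fq_perp_def)
  have cl: "a \<in> carrier R" if "a \<in> Fq" for a using that Fq_closed by auto
  have "(\<lambda>a. a \<otimes> t0) ` Fq \<subseteq> Fq_perp"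
  proof safe
    fix a assume a: "a \<in> Fq"
    have "\<psi> (b \<otimes> (a \<otimes> t0)) = 1" if b: "b \<in> Fq" for b
    proof -
      have "b \<otimes> a \<in> Fq" using a b by (auto simp: Fq_def nat_pow_distrib)
      then have "\<psi> ((b \<otimes> a) \<otimes> t0) = 1" using t by (auto simp: Fq_perp_def)
      then show ?thesis using a b c cl by (simp add: m_assoc)
    qed
    then show "a \<otimes> t0 \<in> Fq_perp" using a c cl by (auto simp: Fq_perp_def)
  qed
  moreover have "card ((\<lambda>a. a \<otimes> t0) ` Fq) = card Fq_perp"
    using sub_card unfolding card_Fq_perp
    by (subst card_image) (use c cl in \<open>auto simp: inj_on_def Fq_def[symmetric] m_rcancel\<close>)
  ultimately show "Fq_perp = (\<lambda>a. a \<otimes> t0) ` Fq"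
    by (intro card_subset_eq[symmetric]) (auto simp: Fq_perp_def)
qed

definition gauss :: "nat \<Rightarrow> complex" where "gauss k = (\<Sum>x\<in>carrier R. \<chi> x ^ k * \<psi> x)"

lemma chi_power_nontrivial:
  assumes "\<not> 2 * m dvd k" shows "\<chi> g ^ k \<noteq> 1"
proof
  assume "\<chi> g ^ k = 1"
  then have "cis (of_nat k * (pi / m)) = 1" by (simp add: chi_g DeMoivre)
  then have "cos (of_nat k * (pi / m)) = 1" by (simp add: complex_eq_iff)
  then obtain n :: int where "of_nat k * (pi / m) = real_of_int n * 2 * pi" by (auto simp: cos_one_2pi_int)
  then have "real k = real_of_int (n * 2 * int m)" using m0 by (simp add: field_simps)
  then have "int k = n * (2 * int m)" by linarith
  then have "int (2 * m) dvd int k" by simp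
  then show False using assms by (metis int_dvd_int_iff)
qed

lemma sum_chi_power:
  assumes "\<not> 2 * m dvd k" shows "(\<Sum>x\<in>carrier R. \<chi> x ^ k) = 0"
proof -
  have "(\<Sum>x\<in>carrier R. \<chi> x ^ k) = (\<Sum>x\<in>carrier R. \<chi> (g \<otimes> x) ^ k)"
    by (rule sum_scale[OF g, symmetric])
  also have "\<dots> = \<chi> g ^ k * (\<Sum>x\<in>carrier R. \<chi> x ^ k)"
    using g by (simp add: chi_mult power_mult_distrib sum_distrib_left)
  finally show ?thesis using chi_power_nontrivial[OF assms] by auto
qed

text \<open>The pure Gauss sums of Stickelberger: \<open>\<chi>\<close> is constant on the cosets of the multiplicative group of the
subfield, and averaging \<open>\<psi>\<close> over a coset leaves only the coset inside the annihilator.\<close>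

lemma gauss_value:
  assumes k: "\<not> 2 * m dvd k" shows "gauss k = of_nat q * \<chi> t0 ^ k"
proof -
  have k0: "k > 0" using k by (intro Nat.gr0I) auto
  have finite_Fq: "finite Fq" by (rule finite_subset[OF Fq_closed(3)]) simp
  have cl: "a \<in> carrier R" if "a \<in> Fq" for a using that Fq_closed by auto
  have tw: "(\<Sum>x\<in>carrier R. \<chi> x ^ k * \<psi> (a \<otimes> x)) = gauss k" if a: "a \<in> Fq - {\<zero>}" for a
  proof -
    have "gauss k = (\<Sum>x\<in>carrier R. \<chi> (a \<otimes> x) ^ k * \<psi> (a \<otimes> x))"
      unfolding gauss_def using a cl by (intro sum_scale[symmetric]) auto
    also have "\<dots> = (\<Sum>x\<in>carrier R. \<chi> x ^ k * \<psi> (a \<otimes> x))"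
      using a sub_chi by (intro sum.cong refl) (auto simp: chi_mult Fq_def)
    finally show ?thesis ..
  qed
  have "(of_nat q - 1) * gauss k = (\<Sum>a\<in>Fq - {\<zero>}. \<Sum>x\<in>carrier R. \<chi> x ^ k * \<psi> (a \<otimes> x))"
    using sub_card Fq_closed(2) q1 finite_Fq by (simp add: tw Fq_def[symmetric] of_nat_diff)
  also have "\<dots> = (\<Sum>a\<in>Fq. \<Sum>x\<in>carrier R. \<chi> x ^ k * \<psi> (a \<otimes> x))"
    using finite_Fq Fq_closed(2) sum_chi_power[OF k] by (subst sum.remove[OF finite_Fq Fq_closed(2)]) (simp add: psi_zero)
  also have "\<dots> = (\<Sum>x\<in>carrier R. \<chi> x ^ k * (\<Sum>a\<in>Fq. \<psi> (a \<otimes> x)))"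
    by (subst sum.swap) (simp add: sum_distrib_left)
  also have "\<dots> = (\<Sum>x\<in>carrier R. if x \<in> Fq_perp then of_nat q * \<chi> x ^ k else 0)"
    by (intro sum.cong refl) (auto simp: psi_sum_Fq Fq_perp_def)
  also have "\<dots> = (\<Sum>x\<in>Fq_perp. of_nat q * \<chi> x ^ k)"
    by (simp add: sum.If_cases Fq_perp_def Collect_conj_eq)
  also have "\<dots> = (\<Sum>a\<in>Fq. of_nat q * \<chi> (a \<otimes> t0) ^ k)"
    unfolding t0(3) using t0 cl by (subst sum.reindex) (auto simp: inj_on_def m_rcancel)
  also have "\<dots> = (\<Sum>a\<in>Fq - {\<zero>}. of_nat q * \<chi> t0 ^ k)"
  proof (rule sum.mono_neutral_cong_right[OF finite_Fq])
    show "\<forall>i\<in>Fq - (Fq - {\<zero>}). of_nat q * \<chi> (i \<otimes> t0) ^ k = 0"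
      using t0 k0 by (auto simp: chi_zero power_0_left)
    show "\<And>x. x \<in> Fq - {\<zero>} \<Longrightarrow> of_nat q * \<chi> (x \<otimes> t0) ^ k = of_nat q * \<chi> t0 ^ k"
      using t0 sub_chi by (auto simp: chi_mult Fq_def)
  qed auto
  also have "\<dots> = (of_nat q - 1) * (of_nat q * \<chi> t0 ^ k)"
    using sub_card Fq_closed(2) q1 finite_Fq by (simp add: Fq_def[symmetric] of_nat_diff)
  finally show ?thesis using q1 by simp
qed


text \<open>Since \<open>\<chi>\<^sup>2\<^sup>m = 1\<close>, this exponent gives the complex conjugate of \<open>\<chi>\<^sup>k\<close>.\<close>

abbreviation conj_exp :: "nat \<Rightarrow> nat" where "conj_exp k \<equiv> (2 * m - 1) * k"

lemma conj_exp_nontrivial: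
  assumes "\<not> 2 * m dvd k" shows "\<not> 2 * m dvd conj_exp k"
proof
  assume "2 * m dvd conj_exp k"
  moreover have "conj_exp k + k = 2 * m * k" using m0 by (cases m) (simp_all add: algebra_simps)
  ultimately have "2 * m dvd k" by (metis dvd_add_right_iff dvd_triv_left)
  then show False using assms by simp
qed

lemma chi_conj: "\<lbrakk>x \<in> carrier R; x \<noteq> \<zero>\<rbrakk> \<Longrightarrow> \<chi> x ^ conj_exp k * \<chi> x ^ k = 1"
proof -
  assume x: "x \<in> carrier R" "x \<noteq> \<zero>"
  have "conj_exp k + k = 2 * m * k" using m0 by (cases m) (simp_all add: algebra_simps)
  then have "\<chi> x ^ conj_exp k * \<chi> x ^ k = (\<chi> x ^ (2 * m)) ^ k"
    by (simp only: power_add[symmetric] power_mult[symmetric])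
  then show ?thesis using chi_order[OF x] by simp
qed

lemma chi_inv_conj:
  assumes x: "x \<in> carrier R" "x \<noteq> \<zero>" shows "\<chi> (inv x) ^ conj_exp k = \<chi> x ^ k"
proof -
  have U: "x \<in> Units R" using x by (simp add: field_Units)
  then have "\<chi> (inv x) * \<chi> x = 1" using x by (simp add: chi_mult[symmetric] chi_one)
  then have "\<chi> (inv x) ^ conj_exp k * \<chi> x ^ conj_exp k = 1" by (simp add: power_mult_distrib[symmetric])
  with chi_conj[OF x, of k] show ?thesis by (metis mult.commute mult.left_commute mult.right_neutral)
qed

lemma chi_conj_conj: "\<lbrakk>x \<in> carrier R; k > 0\<rbrakk> \<Longrightarrow> \<chi> x ^ conj_exp (conj_exp k) = \<chi> x ^ k"
proof (cases "x = \<zero>")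
  case True
  assume "k > 0"
  then show ?thesis using True m0 by (simp add: chi_zero power_0_left)
next
  case False
  assume x: "x \<in> carrier R"
  show ?thesis using chi_conj[OF x False, of k] chi_conj[OF x False, of "conj_exp k"]
    by (metis mult.commute mult.left_commute mult.right_neutral)
qed

lemma gauss_twist:
  assumes k: "\<not> 2 * m dvd k" and z: "z \<in> carrier R"
  shows "(\<Sum>w\<in>carrier R. \<chi> w ^ k * \<psi> (w \<otimes> z)) = \<chi> z ^ conj_exp k * gauss k"
proof (cases "z = \<zero>")
  case True
  have "k > 0" using k by (intro Nat.gr0I) auto
  then show ?thesis using True sum_chi_power[OF k] m0 by (simp add: psi_zero chi_zero power_0_left)
next
  case False
  have "gauss k = (\<Sum>w\<in>carrier R. \<chi> (z \<otimes> w) ^ k * \<psi> (z \<otimes> w))"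
    unfolding gauss_def using z False by (intro sum_scale[symmetric]) auto
  also have "\<dots> = \<chi> z ^ k * (\<Sum>w\<in>carrier R. \<chi> w ^ k * \<psi> (w \<otimes> z))"
    using z by (simp add: chi_mult power_mult_distrib sum_distrib_left m_comm mult_ac)
  finally show ?thesis using chi_conj[OF z False, of k] by simp
qed

text \<open>The constant \<open>1 / (4 g t0\<^sup>2)\<close>: the factor \<open>4 g\<close> stems from completing the square and \<open>t0\<^sup>2\<close> from the
quotient of the Gauss sums of conjugate characters.\<close>

definition \<kappa> :: 'a where "\<kappa> = inv four_g \<otimes> inv (t0 \<otimes> t0)"

lemma kappa: "\<kappa> \<in> carrier R" "\<chi> \<kappa> ^ m = -1"
proof -
  have t: "t0 \<otimes> t0 \<in> carrier R" "t0 \<otimes> t0 \<noteq> \<zero>" using t0 by (auto simp: integral_iff)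
  have U: "four_g \<in> Units R" "t0 \<otimes> t0 \<in> Units R" using four_g t by (simp_all add: field_Units)
  then have c: "inv four_g \<in> carrier R" "inv (t0 \<otimes> t0) \<in> carrier R" by simp_all
  then show k: "\<kappa> \<in> carrier R" by (simp add: \<kappa>_def)
  have "\<chi> (\<kappa> \<otimes> (t0 \<otimes> t0) \<otimes> four_g) = 1"
  proof -
    have "\<kappa> \<otimes> (t0 \<otimes> t0) \<otimes> four_g = (inv (t0 \<otimes> t0) \<otimes> (t0 \<otimes> t0)) \<otimes> (inv four_g \<otimes> four_g)"
      unfolding \<kappa>_def using c t four_g(1) t0(1) by algebra
    then show ?thesis using U by (simp add: chi_one)
  qed
  then have "(\<chi> \<kappa> * \<chi> (t0 \<otimes> t0) * \<chi> four_g) ^ m = 1" using k t four_g by (simp add: chi_mult)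
  moreover have "\<chi> four_g ^ m = -1"
    using chi_square_m[of "\<one> \<oplus> \<one>"] two g chi_g_m by (simp add: four_g_def chi_mult power_mult_distrib)
  ultimately show "\<chi> \<kappa> ^ m = -1"
    using chi_square_m[OF t0(1,2)] by (simp add: power_mult_distrib)
      (metis minus_equation_iff)
qed

text \<open>Write \<open>\<chi> (Q v)\<close> as a Gauss sum over additive characters \<open>\<psi> (w Q v)\<close>, evaluate the inner quadratic
sum for each \<open>w\<close>, and recognise a Gauss sum of the conjugate character in what remains.\<close>

lemma form_char_transform:
  assumes k: "\<not> 2 * m dvd k" and y: "y \<in> V"
  shows "(\<Sum>v\<in>V. \<chi> (Q v) ^ k * \<psi> (det2 v y)) = - (of_nat q ^ 2) * \<chi> (\<kappa> \<otimes> Q y) ^ conj_exp k"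
proof -
  define T where "T = (\<Sum>v\<in>V. \<chi> (Q v) ^ k * \<psi> (det2 v y))"
  define k' where "k' = conj_exp k"
  define Z where "Z = Q y \<otimes> inv four_g"
  have k0: "k > 0" using k by (intro Nat.gr0I) auto
  then have k0': "k' > 0" using m0 by (simp add: k'_def)
  have k': "\<not> 2 * m dvd k'" unfolding k'_def by (rule conj_exp_nontrivial[OF k])
  have f4: "inv four_g \<in> carrier R" using four_g by (simp add: field_Units)
  have Z: "Z \<in> carrier R" using y f4 by (simp add: Z_def)
  \<comment> \<open>\<open>gauss k'\<close> is the normalising factor in the expansion of \<open>\<chi> (Q v) ^ k\<close> in additive characters\<close>
  have "gauss k' * T = (\<Sum>v\<in>V. (\<chi> (Q v) ^ k * gauss k') * \<psi> (det2 v y))"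
    unfolding T_def by (simp add: sum_distrib_left mult_ac)
  also have "\<dots> = (\<Sum>v\<in>V. \<Sum>w\<in>carrier R. \<chi> w ^ k' * \<psi> (w \<otimes> Q v \<oplus> det2 v y))"
  proof (rule sum.cong[OF refl])
    fix v assume v: "v \<in> V"
    have "\<chi> (Q v) ^ k * gauss k' = (\<Sum>w\<in>carrier R. \<chi> w ^ k' * \<psi> (w \<otimes> Q v))"
      using gauss_twist[OF k', of "Q v"] chi_conj_conj[of "Q v" k] v k0 by (simp add: k'_def)
    then show "(\<chi> (Q v) ^ k * gauss k') * \<psi> (det2 v y) = (\<Sum>w\<in>carrier R. \<chi> w ^ k' * \<psi> (w \<otimes> Q v \<oplus> det2 v y))"
      using v y by (simp add: sum_distrib_left psi_add mult_ac)
  qed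
  also have "\<dots> = (\<Sum>w\<in>carrier R. \<chi> w ^ k' * (\<Sum>v\<in>V. \<psi> (w \<otimes> Q v \<oplus> det2 v y)))"
    by (subst sum.swap) (simp add: sum_distrib_left)
  also have "\<dots> = (\<Sum>w\<in>carrier R - {\<zero>}. \<chi> w ^ k' * (- (of_nat q ^ 2) * \<psi> (Z \<otimes> inv w)))"
    using k0' quadratic_exponential_sum[OF _ _ y]
    by (intro sum.mono_neutral_cong_right) (auto simp: chi_zero Z_def power_0_left)
  also have "\<dots> = - (of_nat q ^ 2) * (\<Sum>w\<in>carrier R - {\<zero>}. \<chi> w ^ k' * \<psi> (Z \<otimes> inv w))"
    by (simp add: sum_distrib_left mult_ac)
  also have "(\<Sum>w\<in>carrier R - {\<zero>}. \<chi> w ^ k' * \<psi> (Z \<otimes> inv w)) = (\<Sum>w\<in>carrier R - {\<zero>}. \<chi> w ^ k * \<psi> (w \<otimes> Z))"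
  proof (rule sum.reindex_bij_witness[of _ "\<lambda>w. inv w" "\<lambda>w. inv w"])
    fix w assume "w \<in> carrier R - {\<zero>}"
    then have w: "w \<in> carrier R" "w \<noteq> \<zero>" "w \<in> Units R" by (auto simp: field_Units)
    then show "inv (inv w) = w" "inv (inv w) = w" by simp_all
    have iw: "inv w \<in> Units R" using w(3) by simp
    then show "inv w \<in> carrier R - {\<zero>}" "inv w \<in> carrier R - {\<zero>}" by (auto simp: field_Units)
    then show "\<chi> (inv w) ^ k * \<psi> (inv w \<otimes> Z) = \<chi> w ^ k' * \<psi> (Z \<otimes> inv w)"
      using chi_inv_conj[of "inv w" k] w Z by (simp add: k'_def m_comm)
  qed
  also have "\<dots> = (\<Sum>w\<in>carrier R. \<chi> w ^ k * \<psi> (w \<otimes> Z))"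
    using k0 by (intro sum.mono_neutral_left) (auto simp: chi_zero power_0_left)
  also have "\<dots> = \<chi> Z ^ k' * gauss k" using gauss_twist[OF k Z] by (simp add: k'_def)
  finally have "of_nat q * (\<chi> t0 ^ k' * T) = of_nat q * (- (of_nat q ^ 2) * (\<chi> Z ^ k' * \<chi> t0 ^ k))"
    by (simp add: gauss_value[OF k] gauss_value[OF k'] mult_ac)
  then have "\<chi> t0 ^ k' * T = - (of_nat q ^ 2) * (\<chi> Z ^ k' * \<chi> t0 ^ k)"
    using q1 by (subst (asm) mult_left_cancel) auto
  then have "(\<chi> t0 ^ k' * T) * \<chi> t0 ^ k = (- (of_nat q ^ 2) * (\<chi> Z ^ k' * \<chi> t0 ^ k)) * \<chi> t0 ^ k"
    by (simp only:)
  then have "(\<chi> t0 ^ k' * \<chi> t0 ^ k) * T = - (of_nat q ^ 2) * (\<chi> Z ^ k' * (\<chi> t0 ^ k * \<chi> t0 ^ k))"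
    by (simp add: mult_ac)
  then have "T = - (of_nat q ^ 2) * (\<chi> Z ^ k' * (\<chi> t0 ^ k * \<chi> t0 ^ k))"
    using chi_conj[OF t0(1,2), of k] by (simp add: k'_def)
  also have "\<chi> t0 ^ k * \<chi> t0 ^ k = \<chi> (inv (t0 \<otimes> t0)) ^ k'"
    using chi_inv_conj[of "t0 \<otimes> t0" k] t0 by (simp add: k'_def chi_mult power_mult_distrib integral_iff)
  also have "\<chi> Z ^ k' * \<chi> (inv (t0 \<otimes> t0)) ^ k' = \<chi> (\<kappa> \<otimes> Q y) ^ k'"
  proof -
    have "inv (t0 \<otimes> t0) \<in> carrier R" using t0 by (simp add: field_Units integral_iff)
    then have "\<kappa> \<otimes> Q y = Z \<otimes> inv (t0 \<otimes> t0)"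
      using f4 y by (simp add: \<kappa>_def Z_def m_ac)
    then show ?thesis using Z \<open>inv (t0 \<otimes> t0) \<in> carrier R\<close> by (simp add: chi_mult power_mult_distrib)
  qed
  finally show ?thesis by (simp add: T_def k'_def)
qed

text \<open>For \<open>\<epsilon> = 1\<close> and \<open>\<epsilon> = -1\<close> these are the vectors on which the norm form is a nonzero square or a
nonsquare.\<close>

definition form_class :: "complex \<Rightarrow> ('a \<times> 'a) set" where "form_class \<epsilon> = {v \<in> V. \<chi> (Q v) ^ m = \<epsilon>}"

lemma zero_notin_form_class: "\<epsilon> \<noteq> 0 \<Longrightarrow> (\<zero>, \<zero>) \<notin> form_class \<epsilon>"
  using m0 Q_zero_iff[of "(\<zero>, \<zero>)"] by (auto simp: form_class_def chi_zero power_0_left)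

lemma form_class_Un: "form_class 1 \<union> form_class (-1) = V - {(\<zero>, \<zero>)}" "form_class 1 \<inter> form_class (-1) = {}"
proof -
  have "v \<in> form_class 1 \<union> form_class (-1)" if "v \<in> V - {(\<zero>, \<zero>)}" for v
  proof -
    have v: "v \<in> V" "v \<noteq> (\<zero>, \<zero>)" using that by simp_all
    then have "\<chi> (Q v) ^ m = 1 \<or> \<chi> (Q v) ^ m = -1" using Q_zero_iff[OF v(1)] by (intro chi_m Q_closed) auto
    then show ?thesis using v(1) unfolding form_class_def by blast
  qed
  then show "form_class 1 \<union> form_class (-1) = V - {(\<zero>, \<zero>)}"
    using zero_notin_form_class[of 1] zero_notin_form_class[of "-1"] by (auto simp: form_class_def)
qed (auto simp: form_class_def)

text \<open>Restricting \<open>\<chi>\<^sup>k\<close> to a class averages the characters with exponents \<open>k\<close> and \<open>k + m\<close>.\<close>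

lemma form_class_indicator:
  assumes "\<epsilon> = 1 \<or> \<epsilon> = -1" "x \<in> carrier R" "k > 0"
  shows "(\<chi> x ^ k + \<epsilon> * \<chi> x ^ (k + m)) / 2 = (if \<chi> x ^ m = \<epsilon> then \<chi> x ^ k else 0)"
proof (cases "x = \<zero>")
  case True
  then show ?thesis using assms m0 by (auto simp: chi_zero power_0_left)
next
  case False
  then show ?thesis using chi_m[OF assms(2) False] assms(1) by (auto simp: power_add)
qed


definition plane :: "('a \<times> 'a) monoid" where "plane = add_monoid R \<times>\<times> add_monoid R"

definition symp :: "'a \<times> 'a \<Rightarrow> 'a \<times> 'a \<Rightarrow> complex" where "symp v y = \<psi> (det2 v y)"

lemma plane_simps [simp]:
  "carrier plane = V" "\<one>\<^bsub>plane\<^esub> = (\<zero>, \<zero>)"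
  "v \<otimes>\<^bsub>plane\<^esub> y = (fst v \<oplus> fst y, snd v \<oplus> snd y)"
  by (simp_all add: plane_def case_prod_beta DirProd_def)

lemma comm_group_plane: "comm_group plane"
  unfolding plane_def by (intro comm_group_DirProd a_comm_group)

lemma inv_plane: "v \<in> V \<Longrightarrow> inv\<^bsub>plane\<^esub> v = (\<ominus> fst v, \<ominus> snd v)"
proof -
  assume v: "v \<in> V"
  have "inv\<^bsub>plane\<^esub> (fst v, snd v) = (inv\<^bsub>add_monoid R\<^esub> fst v, inv\<^bsub>add_monoid R\<^esub> snd v)"
    unfolding plane_def by (rule inv_DirProd) (use v a_group in auto)
  then show ?thesis by (simp add: a_inv_def)
qed

lemma pairing_plane: "pairing plane symp"
  unfolding pairing_def plane_simps
proof (intro conjI ballI)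
  show "comm_group plane" by (rule comm_group_plane)
  show "finite V" by simp
next
  fix v v' y assume "v \<in> V" "v' \<in> V" "y \<in> V"
  then have c: "fst v \<in> carrier R" "snd v \<in> carrier R" "fst v' \<in> carrier R" "snd v' \<in> carrier R"
    "fst y \<in> carrier R" "snd y \<in> carrier R" by auto
  have "det2 (fst v \<oplus> fst v', snd v \<oplus> snd v') y = det2 v y \<oplus> det2 v' y"
    unfolding det2_def fst_conv snd_conv using c by algebra
  then show "symp (fst v \<oplus> fst v', snd v \<oplus> snd v') y = symp v y * symp v' y"
    using \<open>v \<in> V\<close> \<open>v' \<in> V\<close> \<open>y \<in> V\<close> by (simp add: symp_def psi_add)
next
  fix v assume "v \<in> V"
  then show "symp v (\<zero>, \<zero>) = 1" "symp (\<zero>, \<zero>) v = 1"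
    by (auto simp: symp_def det2_def psi_zero a_minus_def)
next
  fix v assume v: "v \<in> V - {(\<zero>, \<zero>)}"
  then have c: "fst v \<in> carrier R" "snd v \<in> carrier R" by auto
  have "symp v y = \<psi> (\<ominus> snd v \<otimes> fst y) * \<psi> (fst v \<otimes> snd y)" if "y \<in> V" for y
    using that c by (auto simp: symp_def det2_def psi_add a_minus_def l_minus)
  then have "(\<Sum>y\<in>V. symp v y) = (\<Sum>y\<in>V. \<psi> (\<ominus> snd v \<otimes> fst y) * \<psi> (fst v \<otimes> snd y))"
    by (intro sum.cong refl) auto
  also have "\<dots> = (\<Sum>x\<in>carrier R. \<psi> (\<ominus> snd v \<otimes> x)) * (\<Sum>x\<in>carrier R. \<psi> (fst v \<otimes> x))"
    by (simp add: sum_product sum.cartesian_product case_prod_beta)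
  also have "\<dots> = 0"
    using c v psi_sum[of "fst v"] psi_sum[of "\<ominus> snd v"] by (cases v) (auto dest: arg_cong[of "\<ominus> _" _ "a_inv R"])
  finally show "(\<Sum>y\<in>V. symp v y) = 0" .
  have "symp y v = \<psi> (snd v \<otimes> fst y) * \<psi> (\<ominus> fst v \<otimes> snd y)" if "y \<in> V" for y
  proof -
    have y: "fst y \<in> carrier R" "snd y \<in> carrier R" using that by auto
    have "det2 y v = snd v \<otimes> fst y \<oplus> \<ominus> fst v \<otimes> snd y"
      unfolding det2_def using c y by algebra
    then show ?thesis using c y by (simp add: symp_def psi_add)
  qed
  then have "(\<Sum>y\<in>V. symp y v) = (\<Sum>y\<in>V. \<psi> (snd v \<otimes> fst y) * \<psi> (\<ominus> fst v \<otimes> snd y))"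
    by (intro sum.cong refl) auto
  also have "\<dots> = (\<Sum>x\<in>carrier R. \<psi> (snd v \<otimes> x)) * (\<Sum>x\<in>carrier R. \<psi> (\<ominus> fst v \<otimes> x))"
    by (simp add: sum_product sum.cartesian_product case_prod_beta)
  also have "\<dots> = 0"
    using c v psi_sum[of "snd v"] psi_sum[of "\<ominus> fst v"] by (cases v) (auto dest: arg_cong[of "\<ominus> _" _ "a_inv R"])
  finally show "(\<Sum>y\<in>V. symp y v) = 0" .
qed

lemma Q_neg: "v \<in> V \<Longrightarrow> Q (inv\<^bsub>plane\<^esub> v) = Q v"
  using g by (simp add: inv_plane) (auto simp: Q_def l_minus r_minus)

lemma inv_form_class: "v \<in> form_class \<epsilon> \<Longrightarrow> inv\<^bsub>plane\<^esub> v \<in> form_class \<epsilon>"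
  using Q_neg[of v] by (auto simp: form_class_def inv_plane)

text \<open>The restriction of \<open>\<chi> (Q v)\<close> to a class, rotated by \<open>\<zeta>\<close> so that its values become \<open>m\<close>-th roots of
unity. Its transform at \<open>y\<close> is governed by the quadratic character of \<open>\<kappa> Q y\<close>; as \<open>\<kappa>\<close> is a nonsquare, the
support is the opposite class.\<close>

lemma form_class_neg_phases:
  assumes e: "\<epsilon> = 1 \<or> \<epsilon> = -1"
  shows "dual_phases plane symp m (- of_nat (q ^ 2)) (form_class \<epsilon>) (form_class (- \<epsilon>))"
proof -
  obtain \<zeta> :: complex where z: "\<zeta> ^ m = \<epsilon>"
  proof (cases "\<epsilon> = 1")
    case True
    then show thesis using that[of 1] by simp
  next
    case False
    then show thesis using that[of "\<chi> g"] e chi_g_m by simp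
  qed
  define F where "F = (\<lambda>v. \<zeta> * \<chi> (Q v))"
  define W where "W = (\<lambda>y. \<chi> (\<kappa> \<otimes> Q y))"
  define F' where "F' = (\<lambda>y. \<zeta> * W y ^ (2 * m - 1))"
  have ee: "\<epsilon> * \<epsilon> = 1" "\<epsilon> ^ (2 * m - 1) = \<epsilon>"
    using e m0 by (auto simp: odd_pos minus_one_power_iff)
  have W: "W y ^ m = \<epsilon> \<longleftrightarrow> y \<in> form_class (- \<epsilon>)" if "y \<in> V" for y
    using that kappa by (auto simp: W_def form_class_def chi_mult power_mult_distrib minus_equation_iff)
  have tr: "(\<Sum>v\<in>form_class \<epsilon>. F v ^ k * symp v y) = (if y \<in> form_class (- \<epsilon>) then - of_nat (q ^ 2) * F' y ^ k else 0)"
    if k: "k \<in> {1..<m}" and y: "y \<in> V" for k y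
  proof -
    have k1: "\<not> 2 * m dvd k" "\<not> 2 * m dvd k + m" using k by (auto dest: dvd_imp_le)
    have Qy: "\<kappa> \<otimes> Q y \<in> carrier R" using kappa y by simp
    have "(\<Sum>v\<in>form_class \<epsilon>. F v ^ k * symp v y) = (\<Sum>v\<in>V. if \<chi> (Q v) ^ m = \<epsilon> then F v ^ k * symp v y else 0)"
      by (simp add: sum.If_cases form_class_def Collect_conj_eq)
    also have "\<dots> = (\<Sum>v\<in>V. \<zeta> ^ k / 2 * (\<chi> (Q v) ^ k * \<psi> (det2 v y) + \<epsilon> * (\<chi> (Q v) ^ (k + m) * \<psi> (det2 v y))))"
    proof (rule sum.cong[OF refl])
      fix v assume v: "v \<in> V"
      have "(if \<chi> (Q v) ^ m = \<epsilon> then F v ^ k * symp v y else 0) =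
          \<zeta> ^ k * (if \<chi> (Q v) ^ m = \<epsilon> then \<chi> (Q v) ^ k else 0) * \<psi> (det2 v y)"
        by (simp add: F_def symp_def power_mult_distrib)
      also have "(if \<chi> (Q v) ^ m = \<epsilon> then \<chi> (Q v) ^ k else 0) = (\<chi> (Q v) ^ k + \<epsilon> * \<chi> (Q v) ^ (k + m)) / 2"
        using form_class_indicator[OF e Q_closed[OF v], of k] k by simp
      finally have *: "(if \<chi> (Q v) ^ m = \<epsilon> then F v ^ k * symp v y else 0) =
          \<zeta> ^ k * ((\<chi> (Q v) ^ k + \<epsilon> * \<chi> (Q v) ^ (k + m)) / 2) * \<psi> (det2 v y)" .
      show "(if \<chi> (Q v) ^ m = \<epsilon> then F v ^ k * symp v y else 0) =
          \<zeta> ^ k / 2 * (\<chi> (Q v) ^ k * \<psi> (det2 v y) + \<epsilon> * (\<chi> (Q v) ^ (k + m) * \<psi> (det2 v y)))"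
        unfolding * by (simp add: algebra_simps)
    qed
    also have "\<dots> = \<zeta> ^ k / 2 * ((\<Sum>v\<in>V. \<chi> (Q v) ^ k * \<psi> (det2 v y)) +
        \<epsilon> * (\<Sum>v\<in>V. \<chi> (Q v) ^ (k + m) * \<psi> (det2 v y)))"
      by (simp only: sum_distrib_left[symmetric] sum.distrib)
    also have "\<dots> = \<zeta> ^ k / 2 * (- (of_nat q ^ 2) * W y ^ conj_exp k +
        \<epsilon> * (- (of_nat q ^ 2) * W y ^ conj_exp (k + m)))"
      by (simp only: form_char_transform[OF k1(1) y] form_char_transform[OF k1(2) y] W_def)
    also have "\<dots> = - (of_nat q ^ 2) * \<zeta> ^ k * ((W y ^ conj_exp k + \<epsilon> * W y ^ conj_exp (k + m)) / 2)"
      by (simp add: algebra_simps)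
    also have "W y ^ conj_exp (k + m) = W y ^ (conj_exp k + m)"
    proof (cases "\<kappa> \<otimes> Q y = \<zero>")
      case True
      then show ?thesis using m0 by (simp add: W_def chi_zero power_0_left)
    next
      case False
      have "W y ^ conj_exp (k + m) = W y ^ conj_exp k * (W y ^ m) ^ (2 * m - 1)"
        by (simp only: power_mult[symmetric] power_add[symmetric] distrib_left mult.commute[of m])
      also have "(W y ^ m) ^ (2 * m - 1) = W y ^ m"
        using chi_m[OF Qy False] m0 by (auto simp: W_def minus_one_power_iff)
      finally show ?thesis by (simp add: power_add)
    qed
    also have "(W y ^ conj_exp k + \<epsilon> * W y ^ (conj_exp k + m)) / 2 = (if W y ^ m = \<epsilon> then W y ^ conj_exp k else 0)"
      unfolding W_def using k m0 by (intro form_class_indicator[OF e Qy]) auto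
    finally show ?thesis
      using W[OF y] by (simp add: F'_def power_mult_distrib power_mult)
  qed
  show ?thesis
  proof (rule dual_phasesI[where F = F and F' = F'], unfold plane_simps)
    show "form_class \<epsilon> \<subseteq> V" "form_class (- \<epsilon>) \<subseteq> V" by (auto simp: form_class_def)
    show "(\<Sum>v\<in>form_class \<epsilon>. F v ^ k * symp v y) = (if y \<in> form_class (- \<epsilon>) then - of_nat (q ^ 2) * F' y ^ k else 0)"
      if "k \<in> {1..<m}" "y \<in> V" for k y by (rule tr[OF that])
  next
    fix v assume v: "v \<in> form_class \<epsilon>"
    then have "v \<in> V" by (simp add: form_class_def)
    then show "F (inv\<^bsub>plane\<^esub> v) = F v" by (simp add: F_def Q_neg)
    show "inv\<^bsub>plane\<^esub> v \<in> form_class \<epsilon>" by (rule inv_form_class[OF v])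
    show "F v ^ m = 1" using v z ee by (simp add: F_def form_class_def power_mult_distrib)
  next
    fix y assume y: "y \<in> form_class (- \<epsilon>)"
    then have "W y ^ m = \<epsilon>" using W by (simp add: form_class_def)
    then show "F' y ^ m = 1" using z ee
      by (simp add: F'_def power_mult_distrib power_mult[symmetric] mult.commute[of _ m])
         (simp add: power_mult)
  qed
qed

definition smul :: "'a \<Rightarrow> 'a \<times> 'a \<Rightarrow> 'a \<times> 'a" where "smul c v = (c \<otimes> fst v, c \<otimes> snd v)"

definition line :: "'a \<times> 'a \<Rightarrow> ('a \<times> 'a) set" where "line v = (\<lambda>c. smul c v) ` carrier R"

lemma smul_closed: "\<lbrakk>c \<in> carrier R; v \<in> V\<rbrakk> \<Longrightarrow> smul c v \<in> V"
  by (auto simp: smul_def)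

lemma inj_smul:
  assumes v: "v \<in> V" "v \<noteq> (\<zero>, \<zero>)" shows "inj_on (\<lambda>c. smul c v) (carrier R)"
proof (rule inj_onI)
  fix c d assume cd: "c \<in> carrier R" "d \<in> carrier R" "smul c v = smul d v"
  then have "fst v \<noteq> \<zero> \<or> snd v \<noteq> \<zero>" using v by (cases v) auto
  then show "c = d" using cd v by (auto simp: smul_def m_rcancel)
qed

lemma smul_zero_iff: "\<lbrakk>c \<in> carrier R; v \<in> V; v \<noteq> (\<zero>, \<zero>)\<rbrakk> \<Longrightarrow> smul c v = (\<zero>, \<zero>) \<longleftrightarrow> c = \<zero>"
  by (auto simp: smul_def integral_iff)

lemma line_smul:
  assumes "c \<in> carrier R" "c \<noteq> \<zero>" "v \<in> V" shows "line (smul c v) = line v"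
proof -
  have c: "c \<in> Units R" using assms by (simp add: field_Units)
  have "smul d (smul c v) = smul (d \<otimes> c) v" if "d \<in> carrier R" for d
    using that assms by (auto simp: smul_def m_assoc)
  then have "line (smul c v) = (\<lambda>d. smul (d \<otimes> c) v) ` carrier R"
    unfolding line_def by (intro image_cong refl) auto
  also have "\<dots> = (\<lambda>d. smul d v) ` (\<lambda>d. d \<otimes> c) ` carrier R" by (simp add: image_image)
  also have "(\<lambda>d. d \<otimes> c) ` carrier R = carrier R"
  proof
    show "carrier R \<subseteq> (\<lambda>d. d \<otimes> c) ` carrier R"
    proof
      fix d assume d: "d \<in> carrier R"
      then have "d = (d \<otimes> inv c) \<otimes> c" "d \<otimes> inv c \<in> carrier R" using c assms(1) by (simp_all add: m_assoc)
      then show "d \<in> (\<lambda>d. d \<otimes> c) ` carrier R" by blast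
    qed
  qed (use assms in auto)
  finally show ?thesis by (simp add: line_def)
qed

lemma mem_line_self: "v \<in> V \<Longrightarrow> v \<in> line v"
  unfolding line_def by (rule image_eqI[of _ _ \<one>]) (auto simp: smul_def)

lemma line_eq_iff:
  assumes "v \<in> V" "y \<in> V" "y \<noteq> (\<zero>, \<zero>)" shows "line y = line v \<longleftrightarrow> y \<in> line v"
proof
  assume "line y = line v"
  then show "y \<in> line v" using mem_line_self[OF assms(2)] by simp
next
  assume "y \<in> line v"
  then obtain c where c: "c \<in> carrier R" "y = smul c v" by (auto simp: line_def)
  moreover have "c \<noteq> \<zero>" using c assms by (auto simp: smul_def)
  ultimately show "line y = line v" using line_smul assms by simp
qed

text \<open>Lines are totally isotropic, and maximal with this property.\<close>

lemma det2_zero_iff: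
  assumes v: "v \<in> V" "v \<noteq> (\<zero>, \<zero>)" and y: "y \<in> V"
  shows "det2 v y = \<zero> \<longleftrightarrow> y \<in> line v"
proof -
  obtain a b where ab: "v = (a, b)" "a \<in> carrier R" "b \<in> carrier R" using v by auto
  obtain c d where cd: "y = (c, d)" "c \<in> carrier R" "d \<in> carrier R" using y by auto
  have iff: "det2 v y = \<zero> \<longleftrightarrow> a \<otimes> d = b \<otimes> c" using ab cd by (simp add: det2_def)
  show ?thesis
  proof
    assume "y \<in> line v"
    then obtain r where "r \<in> carrier R" "c = r \<otimes> a" "d = r \<otimes> b" using ab cd by (auto simp: line_def smul_def)
    then have "a \<otimes> d = b \<otimes> c" using ab by (simp add: m_ac)
    then show "det2 v y = \<zero>" by (simp only: iff)
  next
    assume "det2 v y = \<zero>"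
    then have eq: "a \<otimes> d = b \<otimes> c" by (simp only: iff)
    show "y \<in> line v"
    proof (cases "a = \<zero>")
      case False
      then have U: "a \<in> Units R" using ab by (simp add: field_Units)
      define r where "r = c \<otimes> inv a"
      have r: "r \<in> carrier R" using U cd by (simp add: r_def)
      have "r \<otimes> a = c" using U cd ab by (simp add: r_def m_assoc)
      moreover have "r \<otimes> b = d"
      proof -
        have "r \<otimes> b = inv a \<otimes> (b \<otimes> c)" using U cd ab by (simp add: r_def m_ac)
        also have "\<dots> = (inv a \<otimes> a) \<otimes> d" unfolding eq[symmetric] using U cd ab by (simp only: m_assoc Units_inv_closed)
        finally show ?thesis using U cd by simp
      qed
      ultimately show ?thesis using r ab cd by (auto simp: line_def smul_def intro!: image_eqI[of _ _ r])
    next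
      case True
      then have b: "b \<noteq> \<zero>" using v ab by auto
      then have U: "b \<in> Units R" using ab by (simp add: field_Units)
      have "b \<otimes> c = \<zero>" using eq True cd by simp
      then have "c = \<zero>" using b ab cd by (simp only: integral_iff) simp
      moreover have "d \<otimes> inv b \<otimes> b = d" using U cd ab by (simp add: m_assoc)
      moreover have "d \<otimes> inv b \<in> carrier R" using U cd by simp
      ultimately show ?thesis using True ab cd by (auto simp: line_def smul_def intro!: image_eqI[of _ _ "d \<otimes> inv b"])
    qed
  qed
qed

lemma smul_form_class:
  assumes "c \<in> carrier R" "c \<noteq> \<zero>" "v \<in> form_class \<epsilon>" shows "smul c v \<in> form_class \<epsilon>"
proof -
  have v: "v \<in> V" "fst v \<in> carrier R" "snd v \<in> carrier R" using assms(3) by (auto simp: form_class_def)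
  have "Q (smul c v) = (c \<otimes> c) \<otimes> Q v"
    unfolding Q_def smul_def fst_conv snd_conv using v assms(1) g by algebra
  then have "\<chi> (Q (smul c v)) ^ m = \<chi> (Q v) ^ m"
    using assms v chi_square_m[OF assms(1,2)] by (simp add: chi_mult power_mult_distrib)
  then show ?thesis using assms v smul_closed by (simp add: form_class_def)
qed

text \<open>The classes are unions of punctured lines, because \<open>Q (c v) = c\<^sup>2 Q v\<close>.\<close>

lemma form_class_fibre:
  assumes v: "v \<in> form_class \<epsilon>" and e: "\<epsilon> \<noteq> 0"
  shows "{w \<in> form_class \<epsilon>. line w = line v} = (\<lambda>c. smul c v) ` (carrier R - {\<zero>})"
proof -
  have v': "v \<in> V" "v \<noteq> (\<zero>, \<zero>)" using v zero_notin_form_class[OF e] by (auto simp: form_class_def)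
  show ?thesis
  proof (intro subset_antisym subsetI)
    fix w assume "w \<in> {w \<in> form_class \<epsilon>. line w = line v}"
    then have w: "w \<in> V" "w \<noteq> (\<zero>, \<zero>)" "line w = line v" using zero_notin_form_class[OF e] by (auto simp: form_class_def)
    then have "w \<in> line v" using line_eq_iff[OF v'(1)] by blast
    then obtain c where c: "c \<in> carrier R" "w = smul c v" by (auto simp: line_def)
    moreover have "c \<noteq> \<zero>" using c w(2) v' by (auto simp: smul_zero_iff)
    ultimately show "w \<in> (\<lambda>c. smul c v) ` (carrier R - {\<zero>})" by blast
  next
    fix w assume "w \<in> (\<lambda>c. smul c v) ` (carrier R - {\<zero>})"
    then obtain c where "c \<in> carrier R" "c \<noteq> \<zero>" "w = smul c v" by auto
    then show "w \<in> {w \<in> form_class \<epsilon>. line w = line v}" using smul_form_class v line_smul v' by auto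
  qed
qed

lemma sum_form_class_lines:
  fixes f :: "'a \<times> 'a \<Rightarrow> complex"
  assumes e: "\<epsilon> \<noteq> 0"
    and f: "\<And>v. v \<in> form_class \<epsilon> \<Longrightarrow> (\<Sum>c\<in>carrier R - {\<zero>}. f (smul c v)) = F (line v)"
  shows "(\<Sum>v\<in>form_class \<epsilon>. f v) = (\<Sum>l\<in>line ` form_class \<epsilon>. F l)"
proof -
  have fin: "finite (form_class \<epsilon>)" by (rule finite_subset[of _ V]) (auto simp: form_class_def)
  have "(\<Sum>v\<in>form_class \<epsilon>. f v) = (\<Sum>l\<in>line ` form_class \<epsilon>. \<Sum>w\<in>{w \<in> form_class \<epsilon>. line w = l}. f w)"
    by (rule sum.image_gen[OF fin])
  also have "\<dots> = (\<Sum>l\<in>line ` form_class \<epsilon>. F l)"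
  proof (rule sum.cong[OF refl])
    fix l assume "l \<in> line ` form_class \<epsilon>"
    then obtain v where v: "v \<in> form_class \<epsilon>" "l = line v" by auto
    then have v': "v \<in> V" "v \<noteq> (\<zero>, \<zero>)" using zero_notin_form_class[OF e] by (auto simp: form_class_def)
    have "(\<Sum>w\<in>{w \<in> form_class \<epsilon>. line w = l}. f w) = (\<Sum>c\<in>carrier R - {\<zero>}. f (smul c v))"
      unfolding v(2) form_class_fibre[OF v(1) e]
      by (rule sum.reindex_cong[OF _ refl refl]) (rule inj_on_subset[OF inj_smul[OF v']], auto)
    then show "(\<Sum>w\<in>{w \<in> form_class \<epsilon>. line w = l}. f w) = F l" using f[OF v(1)] v(2) by simp
  qed
  finally show ?thesis .
qed

text \<open>The difference of the two cardinalities is the transform of the quadratic character \<open>\<chi>\<^sup>m\<close> of \<open>Q\<close> at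
the zero vector, which vanishes.\<close>

lemma card_form_class:
  assumes "\<epsilon> = 1 \<or> \<epsilon> = -1" shows "2 * of_nat (card (form_class \<epsilon>)) = (of_nat q ^ 4 - 1 :: complex)"
proof -
  have fin: "finite (form_class a)" for a by (rule finite_subset[of _ V]) (auto simp: form_class_def)
  have zV: "(\<zero>, \<zero>) \<in> V" by simp
  have nd: "\<not> 2 * m dvd m" using m0 by (auto dest: dvd_imp_le)
  have "(\<Sum>v\<in>V. \<chi> (Q v) ^ m * \<psi> (det2 v (\<zero>, \<zero>))) = 0"
    unfolding form_char_transform[OF nd zV] using m0 kappa(1) Q_zero_iff[OF zV]
    by (simp add: chi_zero power_0_left)
  also have "(\<Sum>v\<in>V. \<chi> (Q v) ^ m * \<psi> (det2 v (\<zero>, \<zero>))) = (\<Sum>v\<in>V. \<chi> (Q v) ^ m)"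
    by (intro sum.cong refl) (auto simp: det2_def psi_zero a_minus_def)
  also have "\<dots> = \<chi> (Q (\<zero>, \<zero>)) ^ m + (\<Sum>v\<in>V - {(\<zero>, \<zero>)}. \<chi> (Q v) ^ m)"
    using zV by (intro sum.remove) auto
  also have "\<dots> = (\<Sum>v\<in>form_class 1 \<union> form_class (-1). \<chi> (Q v) ^ m)"
    using Q_zero_iff[OF zV] m0 by (simp add: form_class_Un chi_zero power_0_left)
  also have "\<dots> = of_nat (card (form_class 1)) - of_nat (card (form_class (-1)))"
    using form_class_Un(2) fin by (subst sum.union_disjoint) (auto simp: form_class_def)
  finally have 1: "of_nat (card (form_class 1)) = (of_nat (card (form_class (-1))) :: complex)" by simp
  have "card (form_class 1) + card (form_class (-1)) = card (V - {(\<zero>, \<zero>)})"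
    unfolding form_class_Un(1)[symmetric] using form_class_Un(2) fin by (intro card_Un_disjoint[symmetric]) auto
  also have "\<dots> + 1 = q ^ 4" using zV card q1
    by (simp add: card_Diff_singleton card_cartesian_product power_add[symmetric])
  finally have "of_nat (card (form_class 1) + card (form_class (-1)) + 1) = (of_nat (q ^ 4) :: complex)" by simp
  then show ?thesis using 1 assms by (auto simp: algebra_simps eq_diff_eq)
qed

lemma card_lines:
  assumes e: "\<epsilon> = 1 \<or> \<epsilon> = -1" shows "2 * card (line ` form_class \<epsilon>) = q ^ 2 + 1"
proof -
  have e0: "\<epsilon> \<noteq> 0" using e by auto
  have qq: "q ^ 2 > 1" using q1 by (metis one_less_power zero_less_numeral)
  have "(\<Sum>v\<in>form_class \<epsilon>. 1) = (\<Sum>l\<in>line ` form_class \<epsilon>. of_nat q ^ 2 - 1 :: complex)"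
    by (rule sum_form_class_lines[OF e0]) (use qq in \<open>simp add: card of_nat_diff\<close>)
  then have "of_nat (card (form_class \<epsilon>)) = of_nat (card (line ` form_class \<epsilon>)) * (of_nat q ^ 2 - 1 :: complex)"
    by simp
  then have "(2 * of_nat (card (line ` form_class \<epsilon>))) * (of_nat q ^ 2 - 1) = (of_nat q ^ 4 - 1 :: complex)"
    using card_form_class[OF e] by (simp add: mult.assoc)
  also have "\<dots> = (of_nat q ^ 2 + 1) * (of_nat q ^ 2 - 1)" by (simp add: algebra_simps power_add[symmetric])
  finally have eq: "(2 * of_nat (card (line ` form_class \<epsilon>))) * (of_nat q ^ 2 - 1) = (of_nat q ^ 2 + 1) * (of_nat q ^ 2 - 1 :: complex)" .
  have "2 * of_nat (card (line ` form_class \<epsilon>)) = (of_nat q ^ 2 + 1 :: complex)"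
  proof -
    have "of_nat (q ^ 2) \<noteq> (1 :: complex)" using qq by (metis less_irrefl of_nat_1 of_nat_eq_iff)
    then have "(of_nat q ^ 2 - 1 :: complex) \<noteq> 0" by simp
    then show ?thesis by (rule mult_right_cancel[THEN iffD1, OF _ eq])
  qed
  then have "of_nat (2 * card (line ` form_class \<epsilon>)) = (of_nat (q ^ 2 + 1) :: complex)" by simp
  then show ?thesis by (simp only: of_nat_eq_iff)
qed

text \<open>A class contains \<open>(q\<^sup>2 + 1) / 2\<close> lines, a number of the form \<open>1 + m r\<close>. Give the zero vector and one
line the label \<open>1\<close> and distribute the \<open>m\<close>-th roots of unity evenly over the other lines. Each line is
its own annihilator, so the transform at a nonzero \<open>y\<close> sees only the line through \<open>y\<close>; the even
distribution makes the remaining contributions cancel.\<close>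

lemma form_class_pos_phases:
  assumes e: "\<epsilon> = 1 \<or> \<epsilon> = -1" and dvd: "2 * m dvd q + 1"
  shows "dual_phases plane symp m (of_nat (q ^ 2)) (insert (\<zero>, \<zero>) (form_class \<epsilon>)) (insert (\<zero>, \<zero>) (form_class \<epsilon>))"
proof -
  define L where "L = line ` form_class \<epsilon>"
  have e0: "\<epsilon> \<noteq> 0" using e by auto
  have fin_class: "finite (form_class \<epsilon>)" by (rule finite_subset[of _ V]) (auto simp: form_class_def)
  then have finL: "finite L" by (simp add: L_def)
  obtain h where h: "bij_betw h L {0..<card L}" using ex_bij_betw_finite_nat[OF finL] by blast
  define \<omega> where "\<omega> = cis (2 * pi / m)"
  have wm: "\<omega> ^ m = 1" using m0 by (simp add: \<omega>_def DeMoivre)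
  obtain r where r: "card L = Suc (m * r)"
  proof -
    obtain j where j: "q + 1 = 2 * m * j" using dvd by blast
    have "2 * card L = q ^ 2 + 1" unfolding L_def by (rule card_lines[OF e])
    also have "q ^ 2 + 1 = (q - 1) * (q + 1) + 2" using q1
      by (cases q) (simp_all add: power2_eq_square algebra_simps)
    also have "\<dots> = 2 * Suc (m * (j * (q - 1)))" unfolding j by simp
    finally show thesis using that[of "j * (q - 1)"] by simp
  qed
  have wk: "(\<Sum>l\<in>L. (\<omega> ^ h l) ^ k) = 1" if k: "k \<in> {1..<m}" for k
  proof -
    have ne: "\<omega> ^ k \<noteq> 1"
    proof
      assume "\<omega> ^ k = 1"
      have inj: "inj_on (\<lambda>k. cis (2 * pi * real k / real m)) {..<m}"
        using bij_betw_roots_unity[OF m0] by (rule bij_betw_imp_inj_on)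
      have "\<omega> ^ k = cis (2 * pi * real k / real m)" "1 = cis (2 * pi * real 0 / real m)"
        by (simp_all add: \<omega>_def DeMoivre mult_ac)
      then have "k = 0" using \<open>\<omega> ^ k = 1\<close> k by (intro inj_onD[OF inj, of k 0]) auto
      then show False using k by simp
    qed
    have "(\<Sum>l\<in>L. (\<omega> ^ h l) ^ k) = (\<Sum>i\<in>{0..<card L}. (\<omega> ^ i) ^ k)"
      by (rule sum.reindex_bij_betw[OF h])
    also have "\<dots> = (\<Sum>i<card L. (\<omega> ^ k) ^ i)"
      by (simp add: atLeast0LessThan power_mult[symmetric] mult.commute)
    also have "\<dots> = ((\<omega> ^ k) ^ card L - 1) / (\<omega> ^ k - 1)" by (rule geometric_sum[OF ne])
    also have "(\<omega> ^ k) ^ card L = \<omega> ^ k"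
    proof -
      have "(\<omega> ^ k) ^ card L = \<omega> ^ k * ((\<omega> ^ m) ^ r) ^ k"
        unfolding r by (simp add: power_mult[symmetric] mult_ac)
      then show ?thesis by (simp add: wm)
    qed
    finally show ?thesis using ne by simp
  qed
  \<comment> \<open>the line numbered \<open>0\<close> shares the label \<open>1\<close> with the zero vector\<close>
  define P where "P = (\<lambda>v. if v = (\<zero>, \<zero>) then 1 else \<omega> ^ h (line v))"
  have form_classD: "v \<in> V" "v \<noteq> (\<zero>, \<zero>)" if "v \<in> form_class \<epsilon>" for v
    using that zero_notin_form_class[OF e0] by (auto simp: form_class_def)
  have Pm: "P v ^ m = 1" for v
    by (simp add: P_def power_mult[symmetric] mult.commute) (simp add: power_mult wm)
  have tr: "(\<Sum>v\<in>insert (\<zero>, \<zero>) (form_class \<epsilon>). P v ^ k * symp v y) =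
      (if y \<in> insert (\<zero>, \<zero>) (form_class \<epsilon>) then of_nat (q ^ 2) * P y ^ k else 0)"
    if k: "k \<in> {1..<m}" and y: "y \<in> V" for k y
  proof -
    have "(\<Sum>v\<in>form_class \<epsilon>. P v ^ k * symp v y) =
        (\<Sum>l\<in>L. (\<omega> ^ h l) ^ k * ((if y \<in> l then of_nat (q ^ 2) else 0) - 1))"
      unfolding L_def
    proof (rule sum_form_class_lines[OF e0])
      fix v assume v: "v \<in> form_class \<epsilon>"
      have "P (smul c v) ^ k * symp (smul c v) y = (\<omega> ^ h (line v)) ^ k * \<psi> (det2 v y \<otimes> c)"
        if c: "c \<in> carrier R - {\<zero>}" for c
      proof -
        have "det2 (smul c v) y = det2 v y \<otimes> c"
        proof -
          have "fst v \<in> carrier R" "snd v \<in> carrier R" "fst y \<in> carrier R" "snd y \<in> carrier R" "c \<in> carrier R"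
            using form_classD[OF v] y c by auto
          then show ?thesis unfolding det2_def smul_def fst_conv snd_conv by algebra
        qed
        moreover have "P (smul c v) = \<omega> ^ h (line v)"
          using form_classD[OF v] c line_smul[of c v] smul_zero_iff[of c v] by (auto simp: P_def)
        ultimately show ?thesis by (simp add: symp_def)
      qed
      then have "(\<Sum>c\<in>carrier R - {\<zero>}. P (smul c v) ^ k * symp (smul c v) y) =
          (\<omega> ^ h (line v)) ^ k * (\<Sum>c\<in>carrier R - {\<zero>}. \<psi> (det2 v y \<otimes> c))"
        by (simp add: sum_distrib_left)
      also have "(\<Sum>c\<in>carrier R - {\<zero>}. \<psi> (det2 v y \<otimes> c)) = (\<Sum>c\<in>carrier R. \<psi> (det2 v y \<otimes> c)) - 1"
        using form_classD(1)[OF v] y by (subst sum.remove[of "carrier R" \<zero>]) (simp_all add: psi_zero)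
      also have "(\<Sum>c\<in>carrier R. \<psi> (det2 v y \<otimes> c)) = (if y \<in> line v then of_nat (q ^ 2) else 0)"
        using psi_sum[of "det2 v y"] det2_zero_iff[OF form_classD[OF v] y] form_classD(1)[OF v] y card by simp
      finally show "(\<Sum>c\<in>carrier R - {\<zero>}. P (smul c v) ^ k * symp (smul c v) y) =
          (\<omega> ^ h (line v)) ^ k * ((if y \<in> line v then of_nat (q ^ 2) else 0) - 1)" .
    qed
    also have "\<dots> = of_nat (q ^ 2) * (\<Sum>l\<in>L. if y \<in> l then (\<omega> ^ h l) ^ k else 0) - (\<Sum>l\<in>L. (\<omega> ^ h l) ^ k)"
      unfolding sum_distrib_left sum_subtractf[symmetric]
      by (intro sum.cong refl) (auto simp: algebra_simps)
    also have "(\<Sum>l\<in>L. (\<omega> ^ h l) ^ k) = 1" by (rule wk[OF k])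
    finally have 1: "(\<Sum>v\<in>form_class \<epsilon>. P v ^ k * symp v y) =
      of_nat (q ^ 2) * (\<Sum>l\<in>L. if y \<in> l then (\<omega> ^ h l) ^ k else 0) - 1" .
    have s0: "P (\<zero>, \<zero>) ^ k * symp (\<zero>, \<zero>) y = 1"
      using y by (auto simp: P_def symp_def det2_def a_minus_def psi_zero)
    have "(\<Sum>v\<in>insert (\<zero>, \<zero>) (form_class \<epsilon>). P v ^ k * symp v y) =
        of_nat (q ^ 2) * (\<Sum>l\<in>L. if y \<in> l then (\<omega> ^ h l) ^ k else 0)"
      using fin_class zero_notin_form_class[OF e0] 1 s0 by simp
    also have "(\<Sum>l\<in>L. if y \<in> l then (\<omega> ^ h l) ^ k else 0) =
        (if y \<in> insert (\<zero>, \<zero>) (form_class \<epsilon>) then P y ^ k else 0)"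
    proof (cases "y = (\<zero>, \<zero>)")
      case True
      have "y \<in> l" if lL: "l \<in> L" for l
      proof -
        obtain v where v: "v \<in> form_class \<epsilon>" "l = line v" using lL by (auto simp: L_def)
        then have "smul \<zero> v \<in> l" by (simp add: line_def)
        moreover have "smul \<zero> v = y" using form_classD(1)[OF v(1)] True by (auto simp: smul_def)
        ultimately show ?thesis by simp
      qed
      then have "(\<Sum>l\<in>L. if y \<in> l then (\<omega> ^ h l) ^ k else 0) = (\<Sum>l\<in>L. (\<omega> ^ h l) ^ k)" by simp
      then show ?thesis using True wk[OF k] by (simp add: P_def)
    next
      case False
      have iff: "y \<in> l \<longleftrightarrow> l = line y" if lL: "l \<in> L" for l
      proof -
        obtain v where v: "v \<in> form_class \<epsilon>" "l = line v" using lL by (auto simp: L_def)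
        then show ?thesis using line_eq_iff[OF form_classD(1)[OF v(1)] y False] by auto
      qed
      have "line y \<in> L \<longleftrightarrow> y \<in> form_class \<epsilon>"
      proof
        assume "line y \<in> L"
        then obtain v where v: "v \<in> form_class \<epsilon>" "line y = line v" by (auto simp: L_def)
        then have "y \<in> line v" using line_eq_iff[OF _ y False] form_classD(1) by blast
        then obtain c where c: "c \<in> carrier R" "y = smul c v" by (auto simp: line_def)
        moreover have "c \<noteq> \<zero>" using c False form_classD[OF v(1)] by (auto simp: smul_zero_iff)
        ultimately show "y \<in> form_class \<epsilon>" using smul_form_class v by simp
      qed (simp add: L_def)
      moreover have "(\<Sum>l\<in>L. if y \<in> l then (\<omega> ^ h l) ^ k else 0) = (\<Sum>l\<in>L. if l = line y then (\<omega> ^ h (line y)) ^ k else 0)"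
        by (intro sum.cong refl) (auto simp: iff)
      ultimately show ?thesis using finL False by (simp add: P_def)
    qed
    finally show ?thesis by simp
  qed
  have inv: "inv\<^bsub>plane\<^esub> v \<in> insert (\<zero>, \<zero>) (form_class \<epsilon>)" "P (inv\<^bsub>plane\<^esub> v) = P v"
    if v: "v \<in> insert (\<zero>, \<zero>) (form_class \<epsilon>)" for v
  proof -
    have "inv\<^bsub>plane\<^esub> v \<in> insert (\<zero>, \<zero>) (form_class \<epsilon>) \<and> P (inv\<^bsub>plane\<^esub> v) = P v"
    proof (cases "v = (\<zero>, \<zero>)")
      case True
      then show ?thesis by (simp add: inv_plane)
    next
      case False
      then have vc: "v \<in> form_class \<epsilon>" using v by simp
      have "inv\<^bsub>plane\<^esub> v = smul (\<ominus> \<one>) v" using form_classD[OF vc] by (auto simp: inv_plane smul_def l_minus)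
      moreover have "\<ominus> \<one> \<noteq> \<zero>" by (metis add.inv_eq_1_iff one_closed one_not_zero)
      ultimately show ?thesis using inv_form_class[OF vc] line_smul[of "\<ominus> \<one>" v] form_classD[OF vc] form_classD[OF inv_form_class[OF vc]]
        by (auto simp: P_def)
    qed
    then show "inv\<^bsub>plane\<^esub> v \<in> insert (\<zero>, \<zero>) (form_class \<epsilon>)" "P (inv\<^bsub>plane\<^esub> v) = P v" by auto
  qed
  show ?thesis
    by (rule dual_phasesI[where F = P and F' = P]) (use tr inv Pm in \<open>auto simp: form_class_def\<close>)
qed

text \<open>Negative phases map a class to the opposite class and positive phases map it to itself, which is the
crossing of dual halves required by split type.\<close>

lemma split_type_plane:
  assumes "2 * m dvd q + 1" shows "split_type m (q ^ 2) plane"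
proof (rule split_typeI[OF pairing_plane])
  show "form_class 1 \<inter> form_class (- 1) = {}" "form_class (- 1) \<inter> form_class 1 = {}" using form_class_Un(2) by auto
  show "form_class 1 \<union> form_class (- 1) = carrier plane - {\<one>\<^bsub>plane\<^esub>}" "form_class (- 1) \<union> form_class 1 = carrier plane - {\<one>\<^bsub>plane\<^esub>}"
    using form_class_Un(1) by auto
  show "dual_phases plane symp m (- of_nat (q ^ 2)) (form_class 1) (form_class (-1))"
    "dual_phases plane symp m (- of_nat (q ^ 2)) (form_class (-1)) (form_class 1)"
    using form_class_neg_phases[of 1] form_class_neg_phases[of "-1"] by simp_all
  show "dual_phases plane symp m (of_nat (q ^ 2)) (insert \<one>\<^bsub>plane\<^esub> (form_class 1)) (insert \<one>\<^bsub>plane\<^esub> (form_class 1))"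
    "dual_phases plane symp m (of_nat (q ^ 2)) (insert \<one>\<^bsub>plane\<^esub> (form_class (-1))) (insert \<one>\<^bsub>plane\<^esub> (form_class (-1)))"
    using form_class_pos_phases[OF _ assms] by simp_all
qed

end

section \<open>Elementary abelian groups are of split type\<close>

lemma (in group) ord_of_generator:
  assumes fin: "finite (carrier G)" and a: "a \<in> carrier G" and gen: "carrier G = {a [^] i |i::nat. i \<in> UNIV}"
  shows "ord a = card (carrier G)"
proof -
  have "carrier G = (\<lambda>i. a [^] i) ` {0..ord a - 1}"
    using gen ord_elems[OF fin a] by auto
  moreover have "card ((\<lambda>i. a [^] i) ` {0..ord a - 1}) = ord a"
    using ord_inj[OF a] ord_ge_1[OF fin a] by (simp add: card_image)
  ultimately show ?thesis by simp
qed

lemma (in field) generator_pow_eq_iff: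
  assumes fin: "finite (carrier R)" and g: "g \<in> carrier (Multiplicative_Group.mult_of R)"
    and gen: "carrier (Multiplicative_Group.mult_of R) = {g [^] i |i::nat. i \<in> UNIV}"
  shows "g [^] (i::nat) = g [^] (j::nat) \<longleftrightarrow> [i = j] (mod (card (carrier R) - 1))"
proof -
  interpret M: group "Multiplicative_Group.mult_of R" by (rule field_mult_group)
  have "M.ord g = card (carrier (Multiplicative_Group.mult_of R))"
    using gen fin by (intro M.ord_of_generator g finite_mult_of) (simp_all add: Multiplicative_Group.nat_pow_mult_of)
  also have "\<dots> = card (carrier R) - 1" using fin by simp
  finally have o: "M.ord g = card (carrier R) - 1" .
  have "g [^] i = g [^] j \<longleftrightarrow> [int i = int j] (mod int (M.ord g))"
    using M.int_pow_eq[OF g, of "int i" "int j"]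
    by (simp add: int_pow_int Multiplicative_Group.nat_pow_mult_of cong_iff_dvd_diff dvd_diff_commute)
  then show ?thesis by (simp add: o cong_int_iff)
qed

text \<open>The character sends a generator \<open>g\<close> to \<open>\<zeta> = exp (\<i> \<pi> / m)\<close>; this is well defined because \<open>2 m\<close>
divides \<open>q\<^sup>2 - 1\<close>. The nonzero elements of the subfield of order \<open>q\<close> are the powers of \<open>g ^ (q + 1)\<close>, and
their images are trivial because \<open>2 m\<close> divides \<open>q + 1\<close>.\<close>

lemma (in finite_field_char) exists_mult_char:
  fixes q p e m :: nat
  assumes card: "card (carrier R) = q ^ 2" and p: "Factorial_Ring.prime p" and podd: "odd p"
    and char: "[p] \<cdot>\<^bsub>R\<^esub> \<one> = \<zero>" and qp: "q = p ^ e" and q1: "q > 1" and m: "m > 0" and dvd: "2 * m dvd q + 1"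
  shows "\<exists>\<chi> g. finite_field_mult_char R \<psi> \<chi> g m q"
proof -
  obtain g where g: "g \<in> carrier (Multiplicative_Group.mult_of R)" "carrier (Multiplicative_Group.mult_of R) = {g [^] i |i::nat. i \<in> UNIV}"
    using finite_field_mult_group_has_gen[OF fin] by blast
  have g': "g \<in> carrier R" "g \<noteq> \<zero>" using g(1) by auto
  have gen: "\<exists>i::nat. x = g [^] i" if "x \<in> carrier R" "x \<noteq> \<zero>" for x
    using g(2) that by auto
  have gpow: "g [^] (i::nat) = g [^] (j::nat) \<longleftrightarrow> [i = j] (mod (q ^ 2 - 1))" for i j
    using generator_pow_eq_iff[OF fin g] by (simp add: card)
  have q2: "q ^ 2 - 1 = (q - 1) * (q + 1)" using q1 by (cases q) (simp_all add: power2_eq_square algebra_simps)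
  have md: "2 * m dvd q ^ 2 - 1" unfolding q2 using dvd by (rule dvd_mult)
  \<comment> \<open>a primitive \<open>2 m\<close>-th root of unity\<close>
  define \<zeta> where "\<zeta> = cis (pi / m)"
  have z2m: "\<zeta> ^ (2 * m) = 1" using m by (simp add: \<zeta>_def DeMoivre)
  have zpow: "\<zeta> ^ i = \<zeta> ^ j" if "[i = j] (mod (2 * m))" for i j
  proof -
    have "\<zeta> ^ k = \<zeta> ^ (k mod (2 * m))" for k
    proof -
      have "\<zeta> ^ k = \<zeta> ^ (2 * m * (k div (2 * m)) + k mod (2 * m))" by simp
      also have "\<dots> = (\<zeta> ^ (2 * m)) ^ (k div (2 * m)) * \<zeta> ^ (k mod (2 * m))"
        by (simp only: power_add power_mult)
      finally show ?thesis by (simp add: z2m)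
    qed
    then show ?thesis using that by (metis cong_def)
  qed
  define \<chi> where "\<chi> = (\<lambda>x. if x = \<zero> then 0 else \<zeta> ^ (LEAST i::nat. x = g [^] i))"
  have gnz: "g [^] i \<noteq> \<zero>" for i :: nat using g(2) by auto
  have chi_pow: "\<chi> (g [^] i) = \<zeta> ^ i" for i :: nat
  proof -
    have "g [^] i = g [^] (LEAST j::nat. g [^] i = g [^] j)"
      by (rule LeastI[of "\<lambda>j. g [^] i = g [^] j" i]) simp
    then have "[(LEAST j::nat. g [^] i = g [^] j) = i] (mod (q ^ 2 - 1))" by (simp add: gpow cong_sym_eq)
    then have "[(LEAST j::nat. g [^] i = g [^] j) = i] (mod (2 * m))"
      using md by (rule cong_dvd_modulus_nat)
    then show ?thesis using gnz by (simp add: \<chi>_def zpow)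
  qed
  have sub_iff: "(g [^] i) [^] q = g [^] i \<longleftrightarrow> q + 1 dvd i" for i :: nat
  proof -
    have "(g [^] i) [^] q = g [^] i \<longleftrightarrow> [i * q = i] (mod (q ^ 2 - 1))"
      using g' by (simp add: nat_pow_pow gpow)
    also have "\<dots> \<longleftrightarrow> q ^ 2 - 1 dvd i * q - i"
      using q1 by (intro cong_altdef_nat) simp
    also have "i * q - i = (q - 1) * i" by (simp only: diff_mult_distrib mult_1 mult.commute[of q i])
    also have "q ^ 2 - 1 dvd (q - 1) * i \<longleftrightarrow> q + 1 dvd i"
      unfolding q2 using q1 by (subst nat_mult_dvd_cancel_disj) simp
    finally show ?thesis .
  qed
  have sub_card: "card {x \<in> carrier R. x [^] q = x} = q"
  proof -
    have "{x \<in> carrier R. x [^] q = x} = insert \<zero> ((\<lambda>j. g [^] ((q + 1) * j)) ` {..<q - 1})"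
    proof (intro subset_antisym subsetI)
      fix x assume x: "x \<in> {x \<in> carrier R. x [^] q = x}"
      show "x \<in> insert \<zero> ((\<lambda>j. g [^] ((q + 1) * j)) ` {..<q - 1})"
      proof (cases "x = \<zero>")
        case False
        then obtain i :: nat where i: "x = g [^] i" using gen x by auto
        then have "q + 1 dvd i" using x sub_iff by simp
        then obtain j where j: "i = (q + 1) * j" by blast
        have "[(q + 1) * j = (q + 1) * (j mod (q - 1))] (mod (q ^ 2 - 1))"
          unfolding q2 by (simp add: cong_def mult_mod_right mult.commute)
        then have "x = g [^] ((q + 1) * (j mod (q - 1)))" using i j gpow by simp
        moreover have "j mod (q - 1) < q - 1" using q1 by simp
        ultimately show ?thesis by blast
      qed simp
    next
      fix x assume "x \<in> insert \<zero> ((\<lambda>j. g [^] ((q + 1) * j)) ` {..<q - 1})"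
      then consider "x = \<zero>" | j where "x = g [^] ((q + 1) * j)" by blast
      then show "x \<in> {x \<in> carrier R. x [^] q = x}"
      proof cases
        case 1
        then show ?thesis using q1 nat_pow_zero[of q] by simp
      next
        case 2
        have "x [^] q = x" unfolding 2 sub_iff by (rule dvd_triv_left)
        moreover have "x \<in> carrier R" unfolding 2 using g' by simp
        ultimately show ?thesis by blast
      qed
    qed
    moreover have "inj_on (\<lambda>j. g [^] ((q + 1) * j)) {..<q - 1}"
    proof (rule inj_onI)
      fix i j assume ij: "i \<in> {..<q - 1}" "j \<in> {..<q - 1}" "g [^] ((q + 1) * i) = g [^] ((q + 1) * j)"
      then have "[(q + 1) * i = (q + 1) * j] (mod ((q + 1) * (q - 1)))"
        by (simp only: gpow q2 mult.commute[of "q - 1"])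
      then have "(q + 1) * (i mod (q - 1)) = (q + 1) * (j mod (q - 1))" by (simp only: cong_def mult_mod_right)
      then have "i mod (q - 1) = j mod (q - 1)" unfolding mult_cancel1 by simp
      then show "i = j" using ij by simp
    qed
    moreover have "\<zero> \<notin> (\<lambda>j. g [^] ((q + 1) * j)) ` {..<q - 1}"
      by (metis (no_types, lifting) gnz imageE)
    ultimately show ?thesis using q1 by (simp add: card_image)
  qed
  have two: "\<one> \<oplus> \<one> \<noteq> \<zero>"
  proof
    assume two: "\<one> \<oplus> \<one> = \<zero>"
    obtain k where k: "p = 2 * k + 1" using podd by (rule oddE)
    have "[(2 * i)] \<cdot>\<^bsub>R\<^esub> \<one> = \<zero>" for i :: nat
      by (induction i) (simp_all add: a_assoc two)
    then have "[p] \<cdot>\<^bsub>R\<^esub> \<one> = \<one>" by (simp add: k)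
    then show False using char by simp
  qed
  have "finite_field_mult_char R \<psi> \<chi> g m q"
  proof unfold_locales
    show "\<one> \<oplus> \<one> \<noteq> \<zero>" "1 < q" "0 < m" "card (carrier R) = q ^ 2"
      "g \<in> carrier R" "g \<noteq> \<zero>" "card {x \<in> carrier R. x [^] q = x} = q"
      by (fact two q1 m card g' sub_card)+
    show "\<chi> \<zero> = 0" by (simp add: \<chi>_def)
    show "\<chi> g = cis (pi / m)" using chi_pow[of 1] g' by (simp add: \<zeta>_def)
    show "\<exists>i::nat. x = g [^] i" if "x \<in> carrier R" "x \<noteq> \<zero>" for x by (rule gen[OF that])
    show "\<chi> (x \<otimes> y) = \<chi> x * \<chi> y" if xy: "x \<in> carrier R" "y \<in> carrier R" for x y
    proof (cases "x = \<zero> \<or> y = \<zero>")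
      case True
      then show ?thesis using xy by (auto simp: \<chi>_def)
    next
      case False
      then obtain i j :: nat where "x = g [^] i" "y = g [^] j" using gen xy by metis
      then show ?thesis using g' by (simp add: nat_pow_mult chi_pow power_add)
    qed
    show "(x \<oplus> y) [^] q = x \<oplus> y"
      if "x \<in> carrier R" "y \<in> carrier R" "x [^] q = x" "y [^] q = y" for x y
      using freshman_power[OF p char that(1,2), of e] that(3,4) by (simp add: qp)
    show "\<chi> x = 1" if x: "x \<in> carrier R" "x [^] q = x" "x \<noteq> \<zero>" for x
    proof -
      obtain i :: nat where i: "x = g [^] i" using gen x by blast
      then have "2 * m dvd i" using x(2) sub_iff dvd by (metis dvd_trans)
      then have "[i = 0] (mod (2 * m))" by (simp add: cong_0_iff)
      then show ?thesis using zpow[of i 0] by (simp add: i chi_pow)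
    qed
  qed
  then show ?thesis by blast
qed

text \<open>The group is isomorphic to the plane over the field with \<open>q\<^sup>2\<close> elements, as both are elementary abelian
of the same order; it remains to provide the characters of that field.\<close>

lemma split_type_elementary_abelian:
  fixes G :: "('a, 'b) monoid_scheme"
  assumes q: "primepow q" and m: "m > 0" and dvd: "2 * m dvd q + 1"
    and G: "elementary_abelian G" and oG: "order G = q ^ 4"
  shows "split_type m (q ^ 2) G"
proof -
  obtain p e where p: "Factorial_Ring.prime p" and e: "e > 0" and qp: "q = p ^ e"
    using q by (auto simp: primepow_def)
  have p1: "p > 1" using p by (rule prime_gt_1_nat)
  have q1: "q > 1" unfolding qp using p1 e by (metis one_less_power)
  have "odd q" using dvd by (metis dvd_mult_left even_plus_one_iff)
  then have podd: "odd p" using qp e by auto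
  obtain F :: "((int list \<times> nat) multiset \<Rightarrow> int) ring" where F: "field F" "card (carrier F) = p ^ (2 * e)"
    "\<And>x. x \<in> carrier F \<Longrightarrow> [p] \<cdot>\<^bsub>F\<^esub> x = \<zero>\<^bsub>F\<^esub>"
    using exists_finite_field[OF p, of "2 * e"] e by auto
  interpret F: field F by fact
  have cF: "card (carrier F) = q ^ 2" using F(2) by (simp add: qp power_mult[symmetric] mult.commute)
  then have finF: "finite (carrier F)" using q1 by (metis card.infinite power_not_zero not_one_less_zero)
  have aF: "comm_group (add_monoid F)" by (rule F.a_comm_group)
  have expF: "x [^]\<^bsub>add_monoid F\<^esub> p = \<one>\<^bsub>add_monoid F\<^esub>" if "x \<in> carrier (add_monoid F)" for x
    using F(3) that by (simp add: add_pow_def)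
  have "carrier (add_monoid F) \<noteq> {\<one>\<^bsub>add_monoid F\<^esub>}"
  proof -
    have "\<one>\<^bsub>F\<^esub> \<in> carrier F" "\<one>\<^bsub>F\<^esub> \<noteq> \<zero>\<^bsub>F\<^esub>" by simp_all
    then show ?thesis by (simp del: F.one_closed F.one_not_zero) blast
  qed
  then obtain \<psi> a where psi: "additive_char (add_monoid F) \<psi>" "a \<in> carrier F" "\<psi> a \<noteq> 1"
    using exponent_prime_nontrivial_char[OF aF _ p expF] finF by auto
  interpret C: finite_field_char F \<psi>
    by unfold_locales (use finF psi in \<open>auto simp: additive_char_def\<close>)
  obtain \<chi> g where "finite_field_mult_char F \<psi> \<chi> g m q"
    using C.exists_mult_char[OF cF p podd F(3)[OF F.one_closed] qp q1 m dvd] by blast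
  then interpret K: finite_field_mult_char F \<psi> \<chi> g m q .
  have cG: "comm_group G" using G by (simp add: elementary_abelian_def)
  have cardG: "card (carrier G) = q ^ 4" using oG by (simp add: order_def)
  then have finG: "finite (carrier G)" using q1 by (metis card.infinite power_not_zero not_one_less_zero)
  obtain p' :: nat where p'0: "Factorial_Ring.prime p'" "\<forall>x\<in>carrier G. x [^]\<^bsub>G\<^esub> p' = \<one>\<^bsub>G\<^esub>"
    using G unfolding elementary_abelian_def by blast
  note p' = p'0(1) p'0(2)[rule_format]
  have "card (carrier G) \<noteq> 1" using cardG q1 by (metis one_less_power less_irrefl zero_less_numeral)
  then have "carrier G \<noteq> {\<one>\<^bsub>G\<^esub>}" by auto
  then obtain H where H: "G\<lparr>carrier := H\<rparr> \<times>\<times> integer_mod_group p' \<cong> G"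
    using comm_group.exponent_prime_splits[OF cG finG p'] by blast
  have "p' dvd card (carrier G)"
    using iso_same_card[OF H] prime_gt_0_nat[OF p'(1)]
    by (simp add: card_cartesian_product carrier_integer_mod_group) (metis dvd_triv_right)
  then have "p' dvd p ^ (e * 4)" by (simp add: cardG qp power_mult)
  then have "p' = p" using p p'(1) by (metis prime_dvd_power primes_dvd_imp_eq)
  with p'(2) have expG: "x [^]\<^bsub>G\<^esub> p = \<one>\<^bsub>G\<^esub>" if "x \<in> carrier G" for x using that by simp
  have plane_pow: "v [^]\<^bsub>K.plane\<^esub> n = ([n] \<cdot>\<^bsub>F\<^esub> fst v, [n] \<cdot>\<^bsub>F\<^esub> snd v)" for v and n :: nat
    by (induction n) simp_all
  have "K.plane \<cong> G"
  proof (rule exponent_prime_iso[OF p K.comm_group_plane _ _ cG finG expG])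
    show "finite (carrier K.plane)" using finF by simp
    show "x [^]\<^bsub>K.plane\<^esub> p = \<one>\<^bsub>K.plane\<^esub>" if "x \<in> carrier K.plane" for x
      using that F(3) by (auto simp: plane_pow)
    show "card (carrier K.plane) = card (carrier G)"
      by (simp add: cF cardG card_cartesian_product power_add[symmetric])
  qed
  moreover have "group G" using cG by (simp add: comm_group_def)
  ultimately show ?thesis by (rule split_type_iso[OF K.split_type_plane[OF dvd]])
qed

section \<open>The strongly regular graphs\<close>

lemma prod_square_cong_one:
  fixes q :: "nat \<Rightarrow> nat"
  assumes "\<And>i. i \<in> I \<Longrightarrow> 2 * m dvd q i + 1"
  shows "int m dvd int (\<Prod>i\<in>I. q i ^ 2) - 1"
proof -
  have "[int (q i ^ 2) = 1] (mod int m)" if "i \<in> I" for i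
  proof -
    have "m dvd q i + 1" using assms[OF that] by (rule dvd_mult_right)
    then have "int m dvd int (q i + 1)" by (simp only: int_dvd_int_iff)
    then have "int m dvd (int (q i) + 1) * (int (q i) - 1)" by (intro dvd_mult2) (simp add: add.commute)
    then show ?thesis by (simp add: cong_iff_dvd_diff power2_eq_square algebra_simps)
  qed
  then have "[(\<Prod>i\<in>I. int (q i ^ 2)) = (\<Prod>i\<in>I. 1)] (mod int m)" by (rule cong_prod)
  then show ?thesis by (simp add: cong_iff_dvd_diff)
qed

theorem theorem1p4:
  fixes m s u :: nat and q :: "nat \<Rightarrow> nat"
    and G :: "nat \<Rightarrow> ('a, 'b) monoid_scheme"
  assumes "m > 0" and "s \<ge> 1"
    and "\<And>i. i \<in> {1..s} \<Longrightarrow> primepow (q i)"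
    and "\<And>i. i \<in> {1..s} \<Longrightarrow> 2 * m dvd q i + 1"
    and "\<And>i. i \<in> {1..s} \<Longrightarrow> elementary_abelian (G i)"
    and "\<And>i. i \<in> {1..s} \<Longrightarrow> order (G i) = q i ^ 4"
    and "u = (\<Prod>i\<in>{1..s}. q i ^ 2)"
  shows "\<forall>h\<in>{0..m}. \<exists>c::int.
           real_of_int c = real h * (real u - 1) / real m \<and>
           (\<exists>\<Gamma>. Cayley_graph_on (product_group {1..s} G) \<Gamma> \<and>
                strongly_regular_graph \<Gamma> (int u ^ 2) (c * (int u + 1))
                  (- int u + c ^ 2 + 3 * c) (c ^ 2 + c))"
proof
  fix h assume h: "h \<in> {0..m}"
  have group: "group (G i)" if "i \<in> {1..s}" for i
    using assms(5)[OF that] by (simp add: elementary_abelian_def comm_group_def)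
  have "split_type m u (product_group {1..s} G)"
    unfolding assms(7)
  proof (rule split_type_product_group[OF group])
    fix i assume i: "i \<in> {1..s}"
    show "split_type m (q i ^ 2) (G i)"
      by (rule split_type_elementary_abelian[OF assms(3)[OF i] assms(1) assms(4)[OF i] assms(5)[OF i] assms(6)[OF i]])
  qed
  moreover have "card (carrier (product_group {1..s} G)) = u ^ 2"
  proof -
    have "card (carrier (product_group {1..s} G)) = (\<Prod>i\<in>{1..s}. card (carrier (G i)))"
      by (simp add: card_PiE)
    also have "\<dots> = (\<Prod>i\<in>{1..s}. (q i ^ 2) ^ 2)"
      using assms(6) by (intro prod.cong refl) (simp add: order_def power_mult[symmetric])
    also have "\<dots> = u ^ 2" unfolding assms(7) by (simp only: prod_power_distrib)
    finally show ?thesis .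
  qed
  moreover obtain k where k: "int u - 1 = int m * k"
    using prod_square_cong_one[of "{1..s}" m q] assms(4,7) by (auto elim: dvdE)
  moreover define c where "c = int h * k"
  ultimately have "\<exists>\<Gamma>. Cayley_graph_on (product_group {1..s} G) \<Gamma> \<and>
      strongly_regular_graph \<Gamma> (int u ^ 2) (c * (int u + 1)) (- int u + c ^ 2 + 3 * c) (c ^ 2 + c)"
    using assms(1) h by (intro split_type_cayley) auto
  moreover have "real_of_int c = real h * (real u - 1) / real m"
  proof -
    have "real u - 1 = real m * real_of_int k"
      using arg_cong[OF k, of real_of_int] by simp
    then show ?thesis using assms(1) by (simp add: c_def)
  qed
  ultimately show "\<exists>c::int. real_of_int c = real h * (real u - 1) / real m \<and>
      (\<exists>\<Gamma>. Cayley_graph_on (product_group {1..s} G) \<Gamma> \<and>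
        strongly_regular_graph \<Gamma> (int u ^ 2) (c * (int u + 1)) (- int u + c ^ 2 + 3 * c) (c ^ 2 + c))"
    by blast
qed

end
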